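(* Let $x,y\in\mathbb R^d_+$; all comparison constants below are independent of $x,y$. (a) For $x_d\wedge y_d>|x-y|$ it holds that $$q(x,y)\asymp(x_d\wedge y_d)^{-d-\alpha}\asymp(x_d\vee y_d)^{-d-\alpha}\quad\text{and}\quad \mathcal B(x,y)-1\asymp\left(\frac{|x-y|}{x_d\wedge y_d}\right)^{d+\alpha}.$$ (b) For $x_d\wedge y_d\le|x-y|$ it holds that $$q(x,y)\asymp J(x,y)\asymp|x-y|^{-d-\alpha}\,\Psi_1\!\left(\frac{|x-y|^2}{x_dy_d}\right).$$ In particular, if $\gamma_1>0$, then $q(x,y)\asymp J(x,y)\asymp|x-y|^{-d-\alpha}\Psi\big(\frac{|x-y|^2}{x_dy_d}\big)$ for $x_d\wedge y_d\le|x-y|$, and if $\gamma_2<0$, then $q(x,y)\asymp J(x,y)\asymp|x-y|^{-d-\alpha}$ for $x_d\wedge y_d\le|x-y|$.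
   Context: Let $d\ge1$, $\alpha\in(0,2)$, $\mathbb R^d_\pm=\{x=(\tilde x,x_d)\in\mathbb R^d:\pm x_d>0\}$ (if $d=1$, $x=x_d$). Let $-\infty<\gamma_1\le\gamma_2<1\wedge\alpha$ and let $\Psi:[0,\infty)\to(0,\infty)$ be a Borel function with $\Psi(t)=\Psi(2)$ for $t\in[0,2)$ and, for some $C_1,C_2>0$, $$C_1(R/r)^{\gamma_1}\le\frac{\Psi(R)}{\Psi(r)}\le C_2(R/r)^{\gamma_2},\qquad2\le r<R<\infty.$$ Put $\Psi_1(u)=\int_1^u\frac{\Psi(v)}v\,dv$ for $u\ge2$ and $\Psi_1(u)=\Psi_1(2)$ for $u\in[0,2)$. Let $j(x,y)=\mathcal A(d,\alpha)|x-y|^{-d-\alpha}$ with $\mathcal A(d,\alpha)=2^\alpha\pi^{-d/2}\Gamma((d+\alpha)/2)/|\Gamma(-\alpha/2)|$. For $z\in\mathbb R^d_-$, $y\in\mathbb R^d_+$ let $\tilde p(z,y)=|z_d|^\alpha\,\Psi\big(\frac{|y-z|^2}{y_d|z_d|}\big)|y-z|^{-d-\alpha}$. The integral $A=\int_{\mathbb R^d_+}\tilde p(z,y)\,dy$ is finite and does not depend on $z\in\mathbb R^d_-$; let $p(z,y)=A^{-1}\tilde p(z,y)$ (return kernel). The resurrection kernel is $$q(x,y)=\int_{\mathbb R^d_-}j(x,z)p(z,y)\,dz=\frac{\mathcal A(d,\alpha)}A\int_{\mathbb R^d_-}\Psi\left(\frac{|y-z|^2}{y_d|z_d|}\right)\frac{|z_d|^\alpha}{|x-z|^{d+\alpha}|y-z|^{d+\alpha}}\,dz,\quad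 x,y\in\mathbb R^d_+.$$ Put $J(x,y)=j(x,y)+q(x,y)$ and $\mathcal B(x,y)=1+q(x,y)/j(x,y)$ (with $\mathcal B(x,x)=1$). $f\asymp g$ means $c^{-1}g\le f\le cg$ for a constant $c\ge1$; $a\wedge b=\min$, $a\vee b=\max$. *)

theory Defs
  imports "HOL-Analysis.Analysis"
begin

text \<open>
  Points of $d$-dimensional Euclidean space have type \<^typ>\<open>real ^ 'n\<close> with $d$ the cardinality of
  \<open>'n\<close>. A finite index type has no canonical last element, so the index \<open>k\<close> of the coordinate
  normal to the hyperplane (the paper's $x_d$) is an explicit parameter.
\<close>

definition upper_half :: "'n::finite \<Rightarrow> (real ^ 'n) set" where
  "upper_half k = {x. x $ k > 0}"

definition lower_half :: "'n::finite \<Rightarrow> (real ^ 'n) set" where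
  "lower_half k = {x. x $ k < 0}"

definition stable_const :: "real \<Rightarrow> real \<Rightarrow> real" where
  "stable_const d \<alpha> =
     2 powr \<alpha> * pi powr (- d / 2) * Gamma ((d + \<alpha>) / 2) / \<bar>Gamma (- \<alpha> / 2)\<bar>"

text \<open>On the diagonal, where the kernel is infinite, this real-valued version is 0.\<close>

definition jker :: "real \<Rightarrow> real ^ 'n::finite \<Rightarrow> real ^ 'n \<Rightarrow> real" where
  "jker \<alpha> x y = stable_const (real CARD('n)) \<alpha> * norm (x - y) powr (- real CARD('n) - \<alpha>)"

definition ptilde ::
  "real \<Rightarrow> (real \<Rightarrow> real) \<Rightarrow> 'n::finite \<Rightarrow> real ^ 'n \<Rightarrow> real ^ 'n \<Rightarrow> real" where
  "ptilde \<alpha> \<Psi> k z y =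
     \<bar>z $ k\<bar> powr \<alpha> * \<Psi> ((norm (y - z))\<^sup>2 / (y $ k * \<bar>z $ k\<bar>))
       * norm (y - z) powr (- real CARD('n) - \<alpha>)"

text \<open>
  The normalizing constant is written as a function of \<open>z\<close>, so that its independence of
  \<open>z\<close> in the lower half-space is not built into the definitions.
\<close>

definition ret_const ::
  "real \<Rightarrow> (real \<Rightarrow> real) \<Rightarrow> 'n::finite \<Rightarrow> real ^ 'n \<Rightarrow> real" where
  "ret_const \<alpha> \<Psi> k z = (LINT y:upper_half k|lborel. ptilde \<alpha> \<Psi> k z y)"

definition return_kernel ::
  "real \<Rightarrow> (real \<Rightarrow> real) \<Rightarrow> 'n::finite \<Rightarrow> real ^ 'n \<Rightarrow> real ^ 'n \<Rightarrow> real" where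
  "return_kernel \<alpha> \<Psi> k z y = inverse (ret_const \<alpha> \<Psi> k z) * ptilde \<alpha> \<Psi> k z y"

definition qker ::
  "real \<Rightarrow> (real \<Rightarrow> real) \<Rightarrow> 'n::finite \<Rightarrow> real ^ 'n \<Rightarrow> real ^ 'n \<Rightarrow> real" where
  "qker \<alpha> \<Psi> k x y =
     (LINT z:lower_half k|lborel. jker \<alpha> x z * return_kernel \<alpha> \<Psi> k z y)"

definition Jker ::
  "real \<Rightarrow> (real \<Rightarrow> real) \<Rightarrow> 'n::finite \<Rightarrow> real ^ 'n \<Rightarrow> real ^ 'n \<Rightarrow> real" where
  "Jker \<alpha> \<Psi> k x y = jker \<alpha> x y + qker \<alpha> \<Psi> k x y"

definition Bcal ::
  "real \<Rightarrow> (real \<Rightarrow> real) \<Rightarrow> 'n::finite \<Rightarrow> real ^ 'n \<Rightarrow> real ^ 'n \<Rightarrow> real" where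
  "Bcal \<alpha> \<Psi> k x y = (if x = y then 1 else 1 + qker \<alpha> \<Psi> k x y / jker \<alpha> x y)"

definition Psi1 :: "(real \<Rightarrow> real) \<Rightarrow> real \<Rightarrow> real" where
  "Psi1 \<Psi> u = (if u < 2 then LINT v:{1..2}|lborel. \<Psi> v / v else LINT v:{1..u}|lborel. \<Psi> v / v)"

definition comparable_on ::
  "('a \<times> 'a) set \<Rightarrow> ('a \<Rightarrow> 'a \<Rightarrow> real) \<Rightarrow> ('a \<Rightarrow> 'a \<Rightarrow> real) \<Rightarrow> bool" where
  "comparable_on S f g \<longleftrightarrow>
     (\<exists>c\<ge>1. \<forall>(x, y)\<in>S. inverse c * g x y \<le> f x y \<and> f x y \<le> c * g x y)"

definition near_pairs :: "'n::finite \<Rightarrow> ((real ^ 'n) \<times> (real ^ 'n)) set" where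
  "near_pairs k =
     {(x, y). x \<in> upper_half k \<and> y \<in> upper_half k \<and> min (x $ k) (y $ k) > norm (x - y)}"

definition far_pairs :: "'n::finite \<Rightarrow> ((real ^ 'n) \<times> (real ^ 'n)) set" where
  "far_pairs k =
     {(x, y). x \<in> upper_half k \<and> y \<in> upper_half k \<and> min (x $ k) (y $ k) \<le> norm (x - y)}"

end

theory Submission
  imports Defs
begin

text \<open>
  Write $w = |z_k|$ for the depth of a point $z$ of the lower half-space, $D = d + \alpha$, and let
  $x'$ be the foot of $x$ on the boundary hyperplane. Two facts reduce every estimate to an integral
  over a half-line.

  First, if $x$ and $z$ lie on opposite sides of the boundary, then $|x - z|$ is comparable to
  $s = x_k + |z - x'|$ (\<open>foot_distance\<close>), a function of the distance to a boundary point. Seen from a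
  boundary point, the weight $w^\beta$ on a half-space is homogeneous, so it has polar coordinates:
  for $\beta > -1$ the integral of $w^\beta g(|z - x'|)$ is a constant times
  $\int_0^\infty t^{d+\beta-1} g(t)\,dt$ (\<open>half_space_polar\<close>). This follows from scaling alone.

  Secondly, $\Psi(v s / w)$ lies between $(s/w)^{\gamma_1} \Psi(v)$ and $(s/w)^{\gamma_2} \Psi(v)$ up
  to constants as long as $w \le s$ (\<open>Psi_split\<close>). So the dependence of the integrand on $w$ is
  squeezed between two power weights. After integration in polar coordinates these give the same
  function of the remaining parameters, and the difference of the exponents affects only constants.

  The normalizing constant and the kernel $q$ for near pairs then become integrals of pure powers,
  which scaling evaluates (\<open>half_space_power_integral\<close>). The integral for the normalizing constant
  converges at the boundary because $\gamma_2 < 1$ and at infinity because $\gamma_2 < \alpha$. For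
  near pairs $|x - z|$, $|y - z|$ and $y_k + |z - y'|$ are all comparable.

  For far pairs put $r = |x - y|$. Where $z$ is closer to $y$ than to $x$, one takes
  $s = y_k + |z - y'|$ and finds, up to constants, $r^{-D} \int_{y_k}^r \Psi(s/y_k)\,ds/s$, which is $r^{-D}$ times
  the integral of $\Psi(v)/v$ over $[1, r/y_k]$. Where $z$ is closer to $x$, one takes
  $s = x_k + |z - x'|$ and finds $r^{-D} \int_{x_k}^r \Psi(r^2/(y_k s))\,ds/s$, which is $r^{-D}$
  times the integral of $\Psi(v)/v$ over $[r/y_k, r^2/(x_k y_k)]$. The two intervals fit together, and
  their sum is $r^{-D} \Psi_1(r^2/(x_k y_k))$. The part $s > r$ contributes at most a multiple of
  $r^{-D} \Psi(r/y_k)$, which $\Psi_1$ absorbs because $\Psi(v)$ is bounded by a multiple of its own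
  logarithmic integral over $[v/2, v]$. Finally $j = O(q)$ for far pairs, since $\Psi_1$ is bounded
  below, so that $J$ is comparable to $q$.

  If $\gamma_1 > 0$, the integral $\Psi_1(u)$ is dominated by its upper end and hence comparable to
  $\Psi(u)$; if $\gamma_2 < 0$, it stays bounded.
\<close>

section \<open>Powers, integrals of nonnegative functions, and comparability\<close>

lemma powr_comparable:
  fixes x y a \<gamma> :: real
  assumes "x > 0" "y > 0" "a \<ge> 1" "x \<le> a * y" "y \<le> a * x"
  shows "x powr \<gamma> \<le> a powr \<bar>\<gamma>\<bar> * y powr \<gamma>"
proof (cases "\<gamma> \<ge> 0")
  case True
  have "x powr \<gamma> \<le> (a * y) powr \<gamma>"
    using assms True by (intro powr_mono2) auto
  also have "\<dots> = a powr \<bar>\<gamma>\<bar> * y powr \<gamma>"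
    using assms True by (simp add: powr_mult)
  finally show ?thesis .
next
  case False
  have "x powr \<gamma> \<le> (y / a) powr \<gamma>"
    using assms False by (intro powr_mono2') (auto simp: field_simps)
  also have "\<dots> = a powr \<bar>\<gamma>\<bar> * y powr \<gamma>"
    using assms False by (simp add: powr_divide powr_minus field_simps)
  finally show ?thesis .
qed

lemma powr_neg_le:
  fixes x y c D :: real
  assumes "0 < x" "x \<le> c * y" "c > 0" "D \<ge> 0"
  shows "y powr (- D) \<le> c powr D * x powr (- D)"
proof -
  have "y > 0" using assms by (smt (verit) mult_nonneg_nonpos)
  have "(x / c) \<le> y" using assms by (simp add: field_simps)
  then have "y powr (- D) \<le> (x / c) powr (- D)"
    using assms by (intro powr_mono2') auto
  also have "\<dots> = c powr D * x powr (- D)"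
    using assms by (simp add: powr_divide powr_minus field_simps)
  finally show ?thesis .
qed

lemma four_mult_le_power2:
  fixes a b c :: real
  assumes "a + b \<le> c" "a > 0" "b > 0"
  shows "4 * (a * b) \<le> c\<^sup>2"
proof -
  have "4 * (a * b) \<le> (a + b)\<^sup>2"
    using zero_le_power2[of "a - b"] by (simp add: power2_eq_square algebra_simps)
  also have "\<dots> \<le> c\<^sup>2" using assms by (intro power_mono) auto
  finally show ?thesis .
qed

lemma ennreal_bound_trans:
  assumes "x \<le> ennreal a * y" "y \<le> ennreal b * z" "a \<ge> 0"
  shows "x \<le> ennreal (a * b) * z"
proof -
  have "x \<le> ennreal a * (ennreal b * z)"
    using assms by (meson mult_left_mono order_trans zero_le)
  then show ?thesis
    using assms(3) by (simp add: ennreal_mult' mult.assoc)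
qed

lemma ennreal_bound_mult_left:
  assumes "x \<le> ennreal a * y" "y \<le> ennreal b" "a \<ge> 0"
  shows "x \<le> ennreal (a * b)"
  using ennreal_bound_trans[OF assms(1), of b 1] assms(2,3) by simp

lemma ennreal_div_le_cancel:
  assumes "ennreal a \<le> ennreal c * P" "c > 0"
  shows "ennreal (a / c) \<le> P"
proof -
  have "ennreal (a / c) = ennreal (1 / c) * ennreal a"
    using assms(2) by (simp add: ennreal_mult'[symmetric])
  also have "\<dots> \<le> ennreal (1 / c) * (ennreal c * P)"
    using assms(1) by (rule mult_left_mono) simp
  also have "\<dots> = P"
    using assms(2) by (simp add: mult.assoc[symmetric] ennreal_mult'[symmetric])
  finally show ?thesis .
qed

lemma nn_integral_Icc_le:
  fixes f :: "real \<Rightarrow> real"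
  assumes "\<And>t. a \<le> t \<Longrightarrow> t \<le> b \<Longrightarrow> f t \<le> M" "a \<le> b" "M \<ge> 0"
  shows "(\<integral>\<^sup>+t\<in>{a..b}. ennreal (f t) \<partial>lborel) \<le> ennreal (M * (b - a))"
proof -
  have "(\<integral>\<^sup>+t\<in>{a..b}. ennreal (f t) \<partial>lborel) \<le> (\<integral>\<^sup>+t. ennreal M * indicator {a..b} t \<partial>lborel)"
    using assms by (intro nn_integral_mono) (auto simp: indicator_def ennreal_leI)
  also have "\<dots> = ennreal (M * (b - a))"
    using assms by (simp add: nn_integral_cmult_indicator ennreal_mult)
  finally show ?thesis .
qed

lemma nn_integral_Icc_ge:
  fixes f :: "real \<Rightarrow> real"
  assumes "\<And>t. a \<le> t \<Longrightarrow> t \<le> b \<Longrightarrow> M \<le> f t" "a \<le> b" "M \<ge> 0"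
  shows "ennreal (M * (b - a)) \<le> (\<integral>\<^sup>+t\<in>{a..b}. ennreal (f t) \<partial>lborel)"
proof -
  have "ennreal (M * (b - a)) = (\<integral>\<^sup>+t. ennreal M * indicator {a..b} t \<partial>lborel)"
    using assms by (simp add: nn_integral_cmult_indicator ennreal_mult)
  also have "\<dots> \<le> (\<integral>\<^sup>+t\<in>{a..b}. ennreal (f t) \<partial>lborel)"
    using assms by (intro nn_integral_mono) (auto simp: indicator_def ennreal_leI)
  finally show ?thesis .
qed

lemma nn_integral_set_le_scaled:
  fixes f g :: "'a \<Rightarrow> real"
  assumes "(\<lambda>x. ennreal (g x) * indicator A x) \<in> borel_measurable M" "C \<ge> 0"
    and "\<And>x. x \<in> A \<Longrightarrow> f x \<le> C * g x"
  shows "(\<integral>\<^sup>+x\<in>A. ennreal (f x) \<partial>M) \<le> ennreal C * (\<integral>\<^sup>+x\<in>A. ennreal (g x) \<partial>M)"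
proof -
  have "(\<integral>\<^sup>+x\<in>A. ennreal (f x) \<partial>M) \<le> (\<integral>\<^sup>+x. ennreal C * (ennreal (g x) * indicator A x) \<partial>M)"
    using assms by (intro nn_integral_mono) (auto simp: indicator_def ennreal_mult'[symmetric] intro: ennreal_leI)
  also have "\<dots> = ennreal C * (\<integral>\<^sup>+x\<in>A. ennreal (g x) \<partial>M)"
    by (rule nn_integral_cmult[OF assms(1)])
  finally show ?thesis .
qed

lemma set_lebesgue_integral_between:
  fixes f :: "'a \<Rightarrow> real"
  assumes meas: "(\<lambda>x. indicator A x * f x) \<in> borel_measurable M"
    and nonneg: "\<And>x. x \<in> A \<Longrightarrow> f x \<ge> 0"
    and "ennreal a \<le> (\<integral>\<^sup>+x\<in>A. ennreal (f x) \<partial>M)" "(\<integral>\<^sup>+x\<in>A. ennreal (f x) \<partial>M) \<le> ennreal b" "b \<ge> 0"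
  shows "a \<le> (LINT x:A|M. f x)" "(LINT x:A|M. f x) \<le> b"
proof -
  have "(LINT x:A|M. f x) = enn2real (\<integral>\<^sup>+x. ennreal (indicator A x * f x) \<partial>M)"
    unfolding set_lebesgue_integral_def real_scaleR_def
    using nonneg by (intro integral_eq_nn_integral meas) (auto simp: indicator_def)
  also have "(\<integral>\<^sup>+x. ennreal (indicator A x * f x) \<partial>M) = (\<integral>\<^sup>+x\<in>A. ennreal (f x) \<partial>M)"
    by (intro nn_integral_cong) (auto simp: indicator_def)
  finally have eq: "(LINT x:A|M. f x) = enn2real (\<integral>\<^sup>+x\<in>A. ennreal (f x) \<partial>M)" .
  have fin: "(\<integral>\<^sup>+x\<in>A. ennreal (f x) \<partial>M) < top"
    using assms(4) by (simp add: order.strict_trans1)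
  show "(LINT x:A|M. f x) \<le> b"
    unfolding eq using assms(4,5) by (intro enn2real_leI)
  show "a \<le> (LINT x:A|M. f x)"
  proof -
    have "ennreal a \<le> ennreal (enn2real (\<integral>\<^sup>+x\<in>A. ennreal (f x) \<partial>M))"
      using assms(3) by (simp only: ennreal_enn2real[OF fin])
    then show ?thesis
      unfolding eq by (subst (asm) ennreal_le_iff) simp_all
  qed
qed

lemma nn_integral_powr_from_0:
  assumes "a > -1" "c \<ge> 0"
  shows "(\<integral>\<^sup>+t\<in>{0..c}. ennreal (t powr a) \<partial>lborel) = ennreal (c powr (a + 1) / (a + 1))"
  by (rule nn_integral_has_integral_lebesgue'[OF _ has_integral_powr_from_0[OF assms]]) simp

lemma nn_integral_powr_to_inf:
  assumes "e < -1" "a > 0"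
  shows "(\<integral>\<^sup>+t\<in>{a..}. ennreal (t powr e) \<partial>lborel) = ennreal (a powr (e + 1) / (- (e + 1)))"
  using nn_integral_has_integral_lebesgue'[OF _ has_integral_powr_to_inf[OF assms]]
  by (simp add: minus_divide_right)

text \<open>
  The substitution $s = a v$ reduces the integral to the case $a = 1$. There $c > 0$ gives convergence at
  the lower end and $b > c$ gives convergence at infinity.
\<close>

lemma nn_integral_shifted_powr:
  fixes c b :: real
  assumes "c > 0" "b > c"
  obtains K where "K > 0"
    "\<And>a. a > 0 \<Longrightarrow> (\<integral>\<^sup>+s\<in>{a<..}. ennreal ((s - a) powr (c - 1)) * ennreal (s powr (- b)) \<partial>lborel)
       = ennreal (K * a powr (c - b))"
proof -
  define I where "I = (\<integral>\<^sup>+v\<in>{1<..}. ennreal ((v - 1) powr (c - 1)) * ennreal (v powr (- b)) \<partial>lborel)"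
  have "I \<le> (\<integral>\<^sup>+v. ennreal ((v - 1) powr (c - 1)) * indicator {0..1} (v - 1) +
       ennreal (2 powr \<bar>c - 1\<bar>) * (ennreal (v powr (c - 1 - b)) * indicator {2..} v) \<partial>lborel)"
    unfolding I_def
  proof (intro nn_integral_mono)
    fix v :: real
    show "ennreal ((v - 1) powr (c - 1)) * ennreal (v powr (- b)) * indicator {1<..} v \<le>
      ennreal ((v - 1) powr (c - 1)) * indicator {0..1} (v - 1) +
       ennreal (2 powr \<bar>c - 1\<bar>) * (ennreal (v powr (c - 1 - b)) * indicator {2..} v)"
    proof -
      consider "v \<le> 1" | "1 < v" "v \<le> 2" | "v > 2" by linarith
      then show ?thesis
      proof cases
        case 2
        have "v powr (- b) \<le> v powr 0"
          using 2 assms by (intro powr_mono) auto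
        then have "(v - 1) powr (c - 1) * v powr (- b) \<le> (v - 1) powr (c - 1)"
          using 2 by (intro mult_left_le) auto
        then have "ennreal ((v - 1) powr (c - 1)) * ennreal (v powr (- b)) \<le> ennreal ((v - 1) powr (c - 1))"
          by (simp add: ennreal_mult[symmetric] ennreal_leI)
        then show ?thesis using 2 by (simp add: add_increasing2)
      next
        case 3
        have "(v - 1) powr (c - 1) * v powr (- b) \<le> (2 powr \<bar>c - 1\<bar> * v powr (c - 1)) * v powr (- b)"
          using 3 by (intro mult_right_mono powr_comparable) auto
        also have "\<dots> = 2 powr \<bar>c - 1\<bar> * v powr (c - 1 - b)"
          by (simp add: powr_add[symmetric] mult.assoc)
        finally show ?thesis
          using 3 by (simp add: ennreal_mult[symmetric] ennreal_leI)
      qed simp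
    qed
  qed
  also have "\<dots> = (\<integral>\<^sup>+v. ennreal ((v - 1) powr (c - 1)) * indicator {0..1} (v - 1) \<partial>lborel) +
      ennreal (2 powr \<bar>c - 1\<bar>) * (\<integral>\<^sup>+v\<in>{2..}. ennreal (v powr (c - 1 - b)) \<partial>lborel)"
    by (subst nn_integral_add; (subst nn_integral_cmult)?) simp_all
  also have "(\<integral>\<^sup>+v. ennreal ((v - 1) powr (c - 1)) * indicator {0..1} (v - 1) \<partial>lborel) =
      (\<integral>\<^sup>+t\<in>{0..1}. ennreal (t powr (c - 1)) \<partial>lborel)"
    by (subst (2) nn_integral_real_affine[where c=1 and t="-1"]) simp_all
  also have "\<dots> + ennreal (2 powr \<bar>c - 1\<bar>) * (\<integral>\<^sup>+v\<in>{2..}. ennreal (v powr (c - 1 - b)) \<partial>lborel) < \<infinity>"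
    using nn_integral_powr_from_0[of "c - 1" 1] nn_integral_powr_to_inf[of "c - 1 - b" 2] assms
    by (simp add: ennreal_mult_less_top)
  finally obtain K where K: "K \<ge> 0" "I = ennreal K"
    by (metis ennreal_enn2real enn2real_nonneg infinity_ennreal_def)
  have "ennreal (inverse (2 powr \<bar>c - 1\<bar>) * 3 powr (- b) * (3 - 2)) \<le>
       (\<integral>\<^sup>+v\<in>{2..3}. ennreal ((v - 1) powr (c - 1) * v powr (- b)) \<partial>lborel)"
  proof (rule nn_integral_Icc_ge)
    fix v :: real assume v: "2 \<le> v" "v \<le> 3"
    have "1 powr (c - 1) \<le> 2 powr \<bar>c - 1\<bar> * (v - 1) powr (c - 1)"
      using v by (intro powr_comparable) auto
    then have "inverse (2 powr \<bar>c - 1\<bar>) \<le> (v - 1) powr (c - 1)"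
      by (simp add: field_simps)
    moreover have "3 powr (- b) \<le> v powr (- b)"
      using v assms by (intro powr_mono2') auto
    ultimately show "inverse (2 powr \<bar>c - 1\<bar>) * 3 powr (- b) \<le> (v - 1) powr (c - 1) * v powr (- b)"
      by (intro mult_mono) auto
  qed simp_all
  also have "\<dots> \<le> I"
    unfolding I_def by (intro nn_integral_mono) (auto simp: indicator_def ennreal_mult)
  finally have "ennreal (inverse (2 powr \<bar>c - 1\<bar>) * 3 powr (- b)) \<le> ennreal K"
    by (simp add: K(2))
  then have "inverse (2 powr \<bar>c - 1\<bar>) * 3 powr (- b) \<le> K"
    using K(1) by (simp only: ennreal_le_iff)
  moreover have "inverse (2 powr \<bar>c - 1\<bar>) * 3 powr (- b) > 0"
    by simp
  ultimately have "K > 0" by linarith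
  then show ?thesis
  proof (rule that)
    fix a :: real assume a: "a > 0"
    have "(\<integral>\<^sup>+s\<in>{a<..}. ennreal ((s - a) powr (c - 1)) * ennreal (s powr (- b)) \<partial>lborel) =
      ennreal a * (\<integral>\<^sup>+v. ennreal ((a * v - a) powr (c - 1)) * ennreal ((a * v) powr (- b)) * indicator {a<..} (a * v) \<partial>lborel)"
      using a by (subst nn_integral_real_affine[where c=a and t=0]) simp_all
    also have "\<dots> = ennreal a * (\<integral>\<^sup>+v. ennreal (a powr (c - 1 - b)) *
        (ennreal ((v - 1) powr (c - 1)) * ennreal (v powr (- b)) * indicator {1<..} v) \<partial>lborel)"
    proof (rule arg_cong2[where f="(*)", OF refl], rule nn_integral_cong)
      fix v :: real
      have "(a * v - a) powr (c - 1) * (a * v) powr (- b) =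
          a powr (c - 1 - b) * ((v - 1) powr (c - 1) * v powr (- b))" if "1 < v"
      proof -
        have "a * v - a = a * (v - 1)" by (simp add: algebra_simps)
        then show ?thesis
          using a that powr_add[of a "c - 1" "- b"] by (simp add: powr_mult)
      qed
      then show "ennreal ((a * v - a) powr (c - 1)) * ennreal ((a * v) powr (- b)) * indicator {a<..} (a * v) =
          ennreal (a powr (c - 1 - b)) * (ennreal ((v - 1) powr (c - 1)) * ennreal (v powr (- b)) * indicator {1<..} v)"
        using a by (cases "1 < v") (simp_all add: ennreal_mult[symmetric])
    qed
    also have "\<dots> = ennreal a * (ennreal (a powr (c - 1 - b)) * I)"
      unfolding I_def by (subst nn_integral_cmult) simp_all
    also have "\<dots> = ennreal (K * (a powr 1 * a powr (c - 1 - b)))"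
      using a K by (simp add: ennreal_mult[symmetric] mult_ac)
    also have "a powr 1 * a powr (c - 1 - b) = a powr (c - b)"
      by (simp only: powr_add[symmetric]) simp
    finally show "(\<integral>\<^sup>+s\<in>{a<..}. ennreal ((s - a) powr (c - 1)) * ennreal (s powr (- b)) \<partial>lborel)
       = ennreal (K * a powr (c - b))" .
  qed
qed

lemma comparable_onI:
  assumes "\<And>x y. (x, y) \<in> S \<Longrightarrow> 0 \<le> f x y \<and> 0 \<le> g x y \<and> g x y \<le> a * f x y \<and> f x y \<le> b * g x y"
  shows "comparable_on S f g"
proof -
  define c where "c = max 1 (max a b)"
  have c: "c \<ge> 1" "a \<le> c" "b \<le> c" by (auto simp: c_def)
  have "inverse c * g x y \<le> f x y \<and> f x y \<le> c * g x y" if "(x, y) \<in> S" for x y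
  proof -
    note h = assms[OF that]
    have "g x y \<le> c * f x y" "f x y \<le> c * g x y"
      using h c mult_right_mono[of a c "f x y"] mult_right_mono[of b c "g x y"] by linarith+
    then show ?thesis using c(1) by (simp add: field_simps)
  qed
  then show ?thesis unfolding comparable_on_def using c(1) by blast
qed

lemma comparable_on_trans:
  assumes "comparable_on S f g" "comparable_on S g h"
  shows "comparable_on S f h"
proof -
  obtain c where c: "c \<ge> 1" "\<And>x y. (x, y) \<in> S \<Longrightarrow> inverse c * g x y \<le> f x y \<and> f x y \<le> c * g x y"
    using assms(1) unfolding comparable_on_def by blast
  obtain c' where c': "c' \<ge> 1" "\<And>x y. (x, y) \<in> S \<Longrightarrow> inverse c' * h x y \<le> g x y \<and> g x y \<le> c' * h x y"
    using assms(2) unfolding comparable_on_def by blast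
  have "inverse (c * c') * h x y \<le> f x y \<and> f x y \<le> c * c' * h x y" if "(x, y) \<in> S" for x y
  proof
    have "inverse c * (inverse c' * h x y) \<le> inverse c * g x y"
      using c(1) c'(2)[OF that] by (intro mult_left_mono) auto
    then show "inverse (c * c') * h x y \<le> f x y"
      using c(2)[OF that] by (simp add: mult.assoc)
    have "c * g x y \<le> c * (c' * h x y)"
      using c(1) c'(2)[OF that] by (intro mult_left_mono) auto
    then show "f x y \<le> c * c' * h x y"
      using c(2)[OF that] by (simp add: mult.assoc)
  qed
  moreover have "c * c' \<ge> 1" using c(1) c'(1) by (simp add: mult_ge1_I)
  ultimately show ?thesis unfolding comparable_on_def by blast
qed

lemma comparable_on_cong:
  assumes "\<And>x y. (x, y) \<in> S \<Longrightarrow> f x y = f' x y \<and> g x y = g' x y"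
  shows "comparable_on S f g \<longleftrightarrow> comparable_on S f' g'"
  unfolding comparable_on_def using assms by (auto intro!: ex_cong1)

section \<open>Polar coordinates for homogeneous weights on a half-space\<close>

lemma nn_integral_lborel_scaleR:
  fixes f :: "'a::euclidean_space \<Rightarrow> ennreal"
  assumes [measurable]: "f \<in> borel_measurable borel" and "s > 0"
  shows "(\<integral>\<^sup>+z. f z \<partial>lborel) = ennreal (s ^ DIM('a)) * (\<integral>\<^sup>+z. f (s *\<^sub>R z) \<partial>lborel)"
  using assms(2)
  by (subst lborel_affine[of s 0])
     (simp_all add: nn_integral_density nn_integral_distr nn_integral_cmult ennreal_power)

lemma nn_integral_lborel_translate:
  fixes f :: "'a::euclidean_space \<Rightarrow> ennreal"
  assumes [measurable]: "f \<in> borel_measurable borel"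
  shows "(\<integral>\<^sup>+z. f z \<partial>lborel) = (\<integral>\<^sup>+z. f (p + z) \<partial>lborel)"
  by (subst lborel_distr_plus[of p, symmetric]) (simp add: nn_integral_distr)

text \<open>
  By scaling, the weight gives the ball of radius $s$ the mass $\kappa s^{d+\beta}$. So the image of the
  weighted measure under the norm has the same distribution function as the measure with density
  $\kappa (d+\beta) t^{d+\beta-1}$ on the positive half-line, and the two measures agree.
\<close>

lemma nn_integral_homogeneous_polar:
  fixes W :: "'a::euclidean_space \<Rightarrow> real" and g :: "real \<Rightarrow> ennreal" and \<beta> \<kappa> :: real
  assumes W[measurable]: "W \<in> borel_measurable borel"
    and hom: "\<And>c z. c > 0 \<Longrightarrow> W (c *\<^sub>R z) = c powr \<beta> * W z"
    and \<beta>: "real DIM('a) + \<beta> > 0"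
    and mass: "(\<integral>\<^sup>+z\<in>cball 0 1. ennreal (W z) \<partial>lborel) = ennreal \<kappa>" "\<kappa> \<ge> 0"
    and g[measurable]: "g \<in> borel_measurable borel"
  shows "(\<integral>\<^sup>+z. ennreal (W z) * g (norm z) \<partial>lborel) =
    ennreal (\<kappa> * (DIM('a) + \<beta>)) * (\<integral>\<^sup>+t\<in>{0<..}. ennreal (t powr (DIM('a) + \<beta> - 1)) * g t \<partial>lborel)"
proof -
  define b where "b = real DIM('a) + \<beta>"
  define M where "M = distr (density lborel (\<lambda>z. ennreal (W z))) borel (norm :: 'a \<Rightarrow> real)"
  define N where "N = density lborel
     (\<lambda>t. ennreal (\<kappa> * b) * (ennreal (t powr (b - 1)) * indicator {0<..} t))"
  have b: "b > 0" using \<beta> by (simp add: b_def)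
  have eM: "emeasure M {..s} = (\<integral>\<^sup>+z. ennreal (W z) * indicator (cball 0 s) z \<partial>lborel)" for s
  proof -
    have "norm -` {..s} = cball (0 :: 'a) s"
      by auto
    then show ?thesis
      unfolding M_def by (simp add: emeasure_distr emeasure_density)
  qed
  have ball: "emeasure M {..s} = ennreal (\<kappa> * s powr b)" if s: "s > 0" for s
  proof -
    have [measurable]: "cball (0 :: 'a) r \<in> sets borel" for r
      by simp
    have "emeasure M {..s} = ennreal (s ^ DIM('a)) *
       (\<integral>\<^sup>+z. ennreal (W (s *\<^sub>R z)) * indicator (cball 0 s) (s *\<^sub>R z) \<partial>lborel)"
      unfolding eM by (rule nn_integral_lborel_scaleR[OF _ s]) (simp del: mem_cball)
    also have "(\<integral>\<^sup>+z. ennreal (W (s *\<^sub>R z)) * indicator (cball 0 s) (s *\<^sub>R z) \<partial>lborel) =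
       (\<integral>\<^sup>+z. ennreal (s powr \<beta>) * (ennreal (W z) * indicator (cball 0 1) z) \<partial>lborel)"
      using s by (intro nn_integral_cong) (auto simp: hom ennreal_mult' indicator_def)
    also have "\<dots> = ennreal (s powr \<beta>) * ennreal \<kappa>"
      by (subst nn_integral_cmult) (simp_all add: mass del: mem_cball)
    also have "ennreal (s ^ DIM('a)) * \<dots> = ennreal (\<kappa> * s powr b)"
      using s \<open>\<kappa> \<ge> 0\<close>
      by (simp add: b_def powr_add powr_realpow ennreal_mult[symmetric] mult_ac)
    finally show ?thesis .
  qed
  have eN: "emeasure N {..s} = ennreal (\<kappa> * b) *
      (\<integral>\<^sup>+t. ennreal (t powr (b - 1)) * indicator {0<..s} t \<partial>lborel)" for s
    unfolding N_def
    by (simp add: emeasure_density mult.assoc nn_integral_cmult)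
       (auto intro!: arg_cong2[where f="(*)"] nn_integral_cong simp: indicator_def)
  have "emeasure N {..s} = ennreal (\<kappa> * s powr b)" if s: "s > 0" for s
  proof -
    have "(\<integral>\<^sup>+t. ennreal (t powr (b - 1)) * indicator {0<..s} t \<partial>lborel) =
      (\<integral>\<^sup>+t. ennreal (t powr (b - 1)) * indicator {0..s} t \<partial>lborel)"
      by (intro nn_integral_cong) (auto simp: indicator_def)
    also have "\<dots> = ennreal (s powr b / b)"
      using nn_integral_powr_from_0[of "b - 1" s] b s by simp
    finally show ?thesis
      using b s \<open>\<kappa> \<ge> 0\<close> by (simp add: eN ennreal_mult[symmetric])
  qed
  with ball have pos: "emeasure M {..s} = emeasure N {..s}" if "s > 0" for s
    using that by simp
  have nonpos: "emeasure M {..s} = emeasure N {..s}" if s: "s \<le> 0" for s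
  proof -
    have zero: "z = 0" if "norm z \<le> s" for z :: 'a
      using that s by (metis norm_le_zero_iff order_trans)
    have "emeasure M {..s} \<le> (\<integral>\<^sup>+z. ennreal (W z) * indicator {0} z \<partial>lborel)"
      unfolding eM using zero by (intro nn_integral_mono) (auto simp: indicator_def)
    also have "\<dots> = 0"
      by (simp add: nn_integral_null_set)
    finally show ?thesis using s by (simp add: eN)
  qed
  \<comment> \<open>The half-lines \<open>{..s}\<close> generate the Borel sets, and both measures are finite on them.\<close>
  have "M = N"
  proof (rule measure_eqI_generator_eq[where E="range (\<lambda>a. {..a::real})" and \<Omega>=UNIV
        and A="\<lambda>i. {..real i + 1}"])
    show "Int_stable (range (\<lambda>a. {..a::real}))"
      by (auto simp: Int_stable_def)
    show "emeasure M X = emeasure N X" if "X \<in> range (\<lambda>a. {..a::real})" for X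
    proof -
      from that obtain s where "X = {..s}" by (rule rangeE)
      then show ?thesis using pos[of s] nonpos[of s] by (cases "s > 0") auto
    qed
    have "sets (borel :: real measure) = sigma_sets UNIV (range (\<lambda>a. {..a::real}))"
      by (simp add: borel_eq_atMost)
    then show "sets M = sigma_sets UNIV (range (\<lambda>a. {..a::real}))"
       "sets N = sigma_sets UNIV (range (\<lambda>a. {..a::real}))"
      by (simp_all add: M_def N_def)
    show "(\<Union>i. {..real i + 1}) = UNIV"
    proof (intro equalityI subsetI UNIV_I)
      fix x :: real
      obtain i :: nat where "x \<le> real i"
        using real_arch_simple by blast
      then show "x \<in> (\<Union>i. {..real i + 1})"
        by (intro UN_I[of i]) auto
    qed
    show "emeasure M {..real i + 1} \<noteq> \<infinity>" for i
      by (simp add: ball)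
  qed auto
  then have "(\<integral>\<^sup>+t. g t \<partial>M) = (\<integral>\<^sup>+t. g t \<partial>N)" by simp
  also have "(\<integral>\<^sup>+t. g t \<partial>M) = (\<integral>\<^sup>+z. ennreal (W z) * g (norm z) \<partial>lborel)"
    unfolding M_def by (simp add: nn_integral_distr nn_integral_density)
  also have "(\<integral>\<^sup>+t. g t \<partial>N) = ennreal (\<kappa> * b) * (\<integral>\<^sup>+t\<in>{0<..}. ennreal (t powr (b - 1)) * g t \<partial>lborel)"
    unfolding N_def by (simp add: nn_integral_density nn_integral_cmult[symmetric] mult_ac)
  finally show ?thesis by (simp add: b_def)
qed

lemma norm_axis_real: "norm (axis i c :: real ^ 'n::finite) = \<bar>c\<bar>"
  by (simp add: norm_vec_def L2_set_def axis_def if_distrib[of norm] if_distrib[of "\<lambda>x. x\<^sup>2"] cong: if_cong)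

text \<open>
  The normalizing constant is an integral over the upper half-space, the kernel $q$ one over the lower;
  this predicate lets both share one polar formula.
\<close>

definition half_space :: "'n::finite \<Rightarrow> (real ^ 'n) set \<Rightarrow> bool" where
  "half_space k H \<longleftrightarrow> H = upper_half k \<or> H = lower_half k"

lemma half_space_open: "half_space k H \<Longrightarrow> open H"
  unfolding half_space_def upper_half_def lower_half_def
  by (auto intro!: open_Collect_less continuous_intros)

lemma half_space_coord_nonzero: "half_space k H \<Longrightarrow> z \<in> H \<Longrightarrow> z $ k \<noteq> 0"
  by (auto simp: half_space_def upper_half_def lower_half_def)

lemma half_space_nontrivial: "half_space k H \<Longrightarrow> ball 0 1 \<inter> H \<noteq> {}"
proof -
  assume H: "half_space k H"
  have "axis k (1/2) \<in> ball 0 1 \<inter> H \<or> axis k (-1/2) \<in> ball 0 1 \<inter> H"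
    using H by (auto simp: half_space_def upper_half_def lower_half_def norm_axis_real)
  then show ?thesis by blast
qed

text \<open>
  The unit ball lies in the cube $[-1,1]^d$, where the weight is a product of functions of one
  coordinate.
\<close>

lemma half_space_mass_finite:
  fixes k :: "'n::finite"
  assumes "\<beta> > -1"
  shows "(\<integral>\<^sup>+z\<in>cball (0::real^'n) 1. ennreal (\<bar>z $ k\<bar> powr \<beta>) \<partial>lborel) < \<infinity>"
proof -
  define f :: "real^'n \<Rightarrow> real \<Rightarrow> real" where
    "f b x = (if b = axis k 1 then \<bar>x\<bar> powr \<beta> * indicator {-1..1} x else indicator {-1..1} x)" for b x
  have [measurable]: "f b \<in> borel_measurable borel" for b
    unfolding f_def by (cases "b = axis k 1") simp_all
  have f_nonneg: "0 \<le> f b x" for b x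
    by (simp add: f_def)
  have fin: "(\<integral>\<^sup>+x. ennreal (f b x) \<partial>lborel) < \<infinity>" for b
  proof (cases "b = axis k 1")
    case True
    have half: "(\<integral>\<^sup>+x\<in>{0..1}. ennreal (x powr \<beta>) \<partial>lborel) < \<infinity>"
      using nn_integral_powr_from_0[of \<beta> 1] assms by simp
    have "(\<integral>\<^sup>+x\<in>{-1..0}. ennreal (\<bar>x\<bar> powr \<beta>) \<partial>lborel) =
          (\<integral>\<^sup>+x. ennreal (\<bar>-x\<bar> powr \<beta>) * indicator {-1..0} (-x) \<partial>lborel)"
      by (subst nn_integral_real_affine[where c="-1" and t=0]) simp_all
    also have "\<dots> = (\<integral>\<^sup>+x\<in>{0..1}. ennreal (x powr \<beta>) \<partial>lborel)"
      by (intro nn_integral_cong) (auto simp: indicator_def)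
    finally have half': "(\<integral>\<^sup>+x\<in>{-1..0}. ennreal (\<bar>x\<bar> powr \<beta>) \<partial>lborel) < \<infinity>"
      using half by simp
    have "(\<integral>\<^sup>+x. ennreal (f b x) \<partial>lborel) \<le>
      (\<integral>\<^sup>+x. ennreal (x powr \<beta>) * indicator {0..1} x + ennreal (\<bar>x\<bar> powr \<beta>) * indicator {-1..0} x \<partial>lborel)"
      using True by (intro nn_integral_mono) (auto simp: f_def indicator_def)
    also have "\<dots> < \<infinity>"
      using half half' by (subst nn_integral_add) auto
    finally show ?thesis .
  next
    case False
    then show ?thesis by (simp add: f_def ennreal_indicator)
  qed
  have "(\<integral>\<^sup>+z\<in>cball (0::real^'n) 1. ennreal (\<bar>z $ k\<bar> powr \<beta>) \<partial>lborel) \<le>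
     (\<integral>\<^sup>+z. (\<Prod>b\<in>Basis. ennreal (f b (z \<bullet> b))) \<partial>lborel)"
  proof (intro nn_integral_mono)
    fix z :: "real^'n"
    have k: "axis k 1 \<in> (Basis :: (real^'n) set)" by (simp add: axis_in_Basis_iff)
    show "ennreal (\<bar>z $ k\<bar> powr \<beta>) * indicator (cball 0 1) z \<le> (\<Prod>b\<in>Basis. ennreal (f b (z \<bullet> b)))"
    proof (cases "z \<in> cball 0 1")
      case True
      have le: "\<bar>z \<bullet> b\<bar> \<le> 1" if "b \<in> Basis" for b
        using Basis_le_norm[OF that, of z] True by simp
      have "(\<Prod>b\<in>Basis. f b (z \<bullet> b)) = f (axis k 1) (z \<bullet> axis k 1) * (\<Prod>b\<in>Basis - {axis k 1}. f b (z \<bullet> b))"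
        by (rule prod.remove[OF finite_Basis k])
      also have "(\<Prod>b\<in>Basis - {axis k 1}. f b (z \<bullet> b)) = 1"
        using le by (intro prod.neutral) (auto simp: f_def indicator_def abs_le_iff)
      also have "f (axis k 1) (z \<bullet> axis k 1) * 1 = \<bar>z $ k\<bar> powr \<beta>"
        using le[OF k] by (auto simp: f_def indicator_def abs_le_iff inner_axis)
      finally show ?thesis
        using True f_nonneg by (simp add: prod_ennreal)
    qed simp
  qed
  also have "\<dots> = (\<Prod>b\<in>(Basis :: (real^'n) set). \<integral>\<^sup>+x. ennreal (f b x) \<partial>lborel)"
    by (rule nn_integral_lborel_prod) auto
  also have "\<dots> < \<infinity>"
  proof -
    have "(\<Prod>b\<in>B. \<integral>\<^sup>+x. ennreal (f b x) \<partial>lborel) < \<infinity>" if "finite B" for B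
      using that by induction (use fin in \<open>auto simp: ennreal_mult_less_top\<close>)
    then show ?thesis by simp
  qed
  finally show ?thesis .
qed

text \<open>
  A half-space is a cone with respect to each of its boundary points, hence the condition $p_k = 0$.
  The constant is positive because the half-space meets the unit ball in a nonempty open set.
\<close>

lemma half_space_polar:
  fixes k :: "'n::finite"
  assumes H: "half_space k H" and \<beta>: "\<beta> > -1"
  obtains \<kappa> where "\<kappa> > 0"
    "\<And>p g. p $ k = 0 \<Longrightarrow> g \<in> borel_measurable borel \<Longrightarrow>
      (\<integral>\<^sup>+z\<in>H. ennreal (\<bar>z $ k\<bar> powr \<beta>) * g (norm (z - p)) \<partial>lborel) =
      ennreal \<kappa> * (\<integral>\<^sup>+t\<in>{0<..}. ennreal (t powr (real CARD('n) + \<beta> - 1)) * g t \<partial>lborel)"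
proof -
  define W :: "real^'n \<Rightarrow> real" where "W z = \<bar>z $ k\<bar> powr \<beta> * indicator H z" for z
  have HB[measurable]: "H \<in> sets borel" using half_space_open[OF H] by simp
  have W[measurable]: "W \<in> borel_measurable borel"
    unfolding W_def by measurable
  have hom: "W (c *\<^sub>R z) = c powr \<beta> * W z" if "c > 0" for c z
  proof -
    have "c *\<^sub>R z \<in> H \<longleftrightarrow> z \<in> H"
      using that H by (auto simp: half_space_def upper_half_def lower_half_def zero_less_mult_iff mult_less_0_iff)
    then show ?thesis
      using that by (auto simp: W_def indicator_def abs_mult powr_mult)
  qed
  have d1: "real CARD('n) \<ge> 1"
    by (simp add: Suc_leI)
  from d1 \<beta> have d\<beta>: "real CARD('n) + \<beta> > 0"
    by linarith
  have "(\<integral>\<^sup>+z\<in>cball 0 1. ennreal (W z) \<partial>lborel) \<le> (\<integral>\<^sup>+z\<in>cball (0::real^'n) 1. ennreal (\<bar>z $ k\<bar> powr \<beta>) \<partial>lborel)"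
    by (intro nn_integral_mono) (auto simp: W_def indicator_def)
  also have "\<dots> < \<infinity>"
    by (rule half_space_mass_finite[OF \<beta>])
  finally obtain m where m: "m \<ge> 0" "(\<integral>\<^sup>+z\<in>cball 0 1. ennreal (W z) \<partial>lborel) = ennreal m"
    by (metis ennreal_enn2real enn2real_nonneg infinity_ennreal_def)
  have "m \<noteq> 0"
  proof
    assume "m = 0"
    with m have "(\<integral>\<^sup>+z\<in>cball 0 1. ennreal (W z) \<partial>lborel) = 0"
      by simp
    moreover have [measurable]: "cball (0 :: real^'n) 1 \<in> sets borel"
      by simp
    ultimately have "AE z in lborel. ennreal (W z) * indicator (cball 0 1) z = 0"
      by (subst (asm) nn_integral_0_iff_AE) (simp_all del: mem_cball)
    moreover have "ennreal (W z) * indicator (cball 0 1) z \<noteq> 0" if "z \<in> ball 0 1 \<inter> H" for z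
      using that half_space_coord_nonzero[OF H, of z] by (auto simp: W_def)
    ultimately have "AE z in lborel. z \<notin> ball 0 1 \<inter> H"
      by (metis (mono_tags, lifting) eventually_mono)
    then have "ball 0 1 \<inter> H \<in> null_sets lborel"
      by (subst AE_iff_null_sets) auto
    then have "negligible (ball 0 1 \<inter> H)"
      by (simp add: negligible_iff_null_sets null_sets_completionI)
    then show False
      using open_not_negligible[of "ball 0 1 \<inter> H"] half_space_nontrivial[OF H] half_space_open[OF H]
      by (simp add: open_Int)
  qed
  with m have mpos: "m > 0" by simp
  show ?thesis
  proof
    show "m * (real CARD('n) + \<beta>) > 0"
      using mpos d\<beta> by simp
    fix p :: "real^'n" and g :: "real \<Rightarrow> ennreal"
    assume p: "p $ k = 0" and [measurable]: "g \<in> borel_measurable borel"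
    have "(\<integral>\<^sup>+z\<in>H. ennreal (\<bar>z $ k\<bar> powr \<beta>) * g (norm (z - p)) \<partial>lborel) =
       (\<integral>\<^sup>+z. ennreal (\<bar>(p + z) $ k\<bar> powr \<beta>) * g (norm (p + z - p)) * indicator H (p + z) \<partial>lborel)"
      by (rule nn_integral_lborel_translate) measurable
    also have "\<dots> = (\<integral>\<^sup>+z. ennreal (W z) * g (norm z) \<partial>lborel)"
    proof (intro nn_integral_cong)
      fix z
      have "p + z \<in> H \<longleftrightarrow> z \<in> H"
        using p H by (auto simp: half_space_def upper_half_def lower_half_def)
      then show "ennreal (\<bar>(p + z) $ k\<bar> powr \<beta>) * g (norm (p + z - p)) * indicator H (p + z) =
         ennreal (W z) * g (norm z)"
        using p by (auto simp: W_def indicator_def)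
    qed
    also have "\<dots> = ennreal (m * (DIM(real^'n) + \<beta>)) *
        (\<integral>\<^sup>+t\<in>{0<..}. ennreal (t powr (DIM(real^'n) + \<beta> - 1)) * g t \<partial>lborel)"
      using d\<beta> m by (intro nn_integral_homogeneous_polar hom) auto
    finally show "(\<integral>\<^sup>+z\<in>H. ennreal (\<bar>z $ k\<bar> powr \<beta>) * g (norm (z - p)) \<partial>lborel) =
      ennreal (m * (real CARD('n) + \<beta>)) *
      (\<integral>\<^sup>+t\<in>{0<..}. ennreal (t powr (real CARD('n) + \<beta> - 1)) * g t \<partial>lborel)"
      by simp
  qed
qed

lemma half_space_measurable[measurable]:
  "upper_half k \<in> sets borel" "lower_half k \<in> sets borel"
  using half_space_open[of k "upper_half k"] half_space_open[of k "lower_half k"]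
  by (auto simp: half_space_def)

lemma borel_measurable_nth_compose[measurable (raw)]:
  "f \<in> borel_measurable M \<Longrightarrow> (\<lambda>x. (f x :: real ^ 'n::finite) $ k) \<in> borel_measurable M"
  by (rule measurable_compose[of f M borel "\<lambda>x. x $ k"])
     (simp_all add: borel_measurable_continuous_onI continuous_on_component)

text \<open>
  The form in which the polar formula is used: the radial variable $s = a + |z - p|$ is the one that is
  comparable to a distance across the boundary.
\<close>

lemma half_space_radial_integral:
  fixes k :: "'n::finite"
  assumes "half_space k H" "\<beta> > -1"
  obtains \<kappa> where "\<kappa> > 0"
    "\<And>p a g. p $ k = 0 \<Longrightarrow> g \<in> borel_measurable borel \<Longrightarrow>
      (\<integral>\<^sup>+z\<in>H. ennreal (\<bar>z $ k\<bar> powr \<beta>) * g (a + norm (z - p)) \<partial>lborel) =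
      ennreal \<kappa> * (\<integral>\<^sup>+s\<in>{a<..}. ennreal ((s - a) powr (real CARD('n) + \<beta> - 1)) * g s \<partial>lborel)"
proof -
  obtain \<kappa> where \<kappa>: "\<kappa> > 0"
    "\<And>p g. p $ k = 0 \<Longrightarrow> g \<in> borel_measurable borel \<Longrightarrow>
      (\<integral>\<^sup>+z\<in>H. ennreal (\<bar>z $ k\<bar> powr \<beta>) * g (norm (z - p)) \<partial>lborel) =
      ennreal \<kappa> * (\<integral>\<^sup>+t\<in>{0<..}. ennreal (t powr (real CARD('n) + \<beta> - 1)) * g t \<partial>lborel)"
    using half_space_polar[OF assms] by blast
  show ?thesis
  proof (rule that[OF \<kappa>(1)])
    fix p :: "real^'n" and a and g :: "real \<Rightarrow> ennreal"
    assume p: "p $ k = 0" and g[measurable]: "g \<in> borel_measurable borel"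
    have "(\<integral>\<^sup>+z\<in>H. ennreal (\<bar>z $ k\<bar> powr \<beta>) * g (a + norm (z - p)) \<partial>lborel) =
      ennreal \<kappa> * (\<integral>\<^sup>+t\<in>{0<..}. ennreal (t powr (real CARD('n) + \<beta> - 1)) * g (a + t) \<partial>lborel)"
      by (rule \<kappa>(2)[OF p, of "\<lambda>t. g (a + t)"]) measurable
    also have "(\<integral>\<^sup>+t\<in>{0<..}. ennreal (t powr (real CARD('n) + \<beta> - 1)) * g (a + t) \<partial>lborel) =
       (\<integral>\<^sup>+s\<in>{a<..}. ennreal ((s - a) powr (real CARD('n) + \<beta> - 1)) * g s \<partial>lborel)"
      by (subst (2) nn_integral_real_affine[where c=1 and t=a])
         (auto intro!: nn_integral_cong simp: indicator_def)
    finally show "(\<integral>\<^sup>+z\<in>H. ennreal (\<bar>z $ k\<bar> powr \<beta>) * g (a + norm (z - p)) \<partial>lborel) =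
      ennreal \<kappa> * (\<integral>\<^sup>+s\<in>{a<..}. ennreal ((s - a) powr (real CARD('n) + \<beta> - 1)) * g s \<partial>lborel)" .
  qed
qed

lemma half_space_power_integral:
  fixes k :: "'n::finite"
  assumes "half_space k H" "\<beta> > -1" "b > real CARD('n) + \<beta>"
  obtains K where "K > 0"
    "\<And>p a. p $ k = 0 \<Longrightarrow> a > 0 \<Longrightarrow>
      (\<integral>\<^sup>+z\<in>H. ennreal (\<bar>z $ k\<bar> powr \<beta> * (a + norm (z - p)) powr (- b)) \<partial>lborel) =
      ennreal (K * a powr (real CARD('n) + \<beta> - b))"
proof -
  obtain \<kappa> where \<kappa>: "\<kappa> > 0"
    "\<And>p a g. p $ k = 0 \<Longrightarrow> g \<in> borel_measurable borel \<Longrightarrow>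
      (\<integral>\<^sup>+z\<in>H. ennreal (\<bar>z $ k\<bar> powr \<beta>) * g (a + norm (z - p)) \<partial>lborel) =
      ennreal \<kappa> * (\<integral>\<^sup>+s\<in>{a<..}. ennreal ((s - a) powr (real CARD('n) + \<beta> - 1)) * g s \<partial>lborel)"
    using half_space_radial_integral[OF assms(1,2)] by blast
  have "real CARD('n) \<ge> 1"
    by (simp add: Suc_leI)
  then have "real CARD('n) + \<beta> > 0"
    using assms(2) by linarith
  then obtain K where K: "K > 0"
    "\<And>a. a > 0 \<Longrightarrow> (\<integral>\<^sup>+s\<in>{a<..}. ennreal ((s - a) powr (real CARD('n) + \<beta> - 1)) * ennreal (s powr (- b)) \<partial>lborel)
       = ennreal (K * a powr (real CARD('n) + \<beta> - b))"
    using nn_integral_shifted_powr[of "real CARD('n) + \<beta>" b] assms(3) by blast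
  show ?thesis
  proof (rule that[of "\<kappa> * K"])
    show "\<kappa> * K > 0" using \<kappa>(1) K(1) by simp
    fix p :: "real^'n" and a :: real assume p: "p $ k = 0" and a: "a > 0"
    show "(\<integral>\<^sup>+z\<in>H. ennreal (\<bar>z $ k\<bar> powr \<beta> * (a + norm (z - p)) powr (- b)) \<partial>lborel) =
      ennreal (\<kappa> * K * a powr (real CARD('n) + \<beta> - b))"
      using \<kappa>(2)[OF p, of "\<lambda>s. ennreal (s powr (- b))" a] K(2)[OF a] \<kappa>(1) K(1)
      by (simp add: ennreal_mult mult.assoc)
  qed
qed

section \<open>Distances across the boundary\<close>

text \<open>
  The orthogonal projection to the boundary hyperplane.
\<close>

definition foot :: "'n::finite \<Rightarrow> real ^ 'n \<Rightarrow> real ^ 'n" where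
  "foot k x = x - axis k (x $ k)"

lemma foot_nth[simp]: "foot k x $ k = 0"
  by (simp add: foot_def)

text \<open>
  On opposite sides, $|x - z|$ is at least $|x' - z|$, because the inner product that appears when the
  square is expanded has the favourable sign, and at least $|x_k| + |z_k|$; the triangle inequality
  gives the reverse bound.
\<close>

lemma foot_distance:
  fixes x z :: "real ^ 'n::finite"
  assumes "x $ k * z $ k \<le> 0"
  defines "s \<equiv> \<bar>x $ k\<bar> + norm (z - foot k x)"
  shows "norm (x - z) \<le> s" "s \<le> 2 * norm (x - z)" "\<bar>z $ k\<bar> \<le> s"
    "\<bar>x $ k\<bar> + \<bar>z $ k\<bar> \<le> norm (x - z)"
proof -
  have eq: "z - x = (z - foot k x) - axis k (x $ k)"
    by (simp add: foot_def)
  have "norm (x - z) = norm (z - x)" by (rule norm_minus_commute)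
  also have "\<dots> \<le> norm (z - foot k x) + norm (axis k (x $ k) :: real^'n)"
    unfolding eq by (rule norm_triangle_ineq4)
  finally show "norm (x - z) \<le> s" by (simp add: s_def norm_axis_real)
  have "(norm (z - x))\<^sup>2 = (norm (z - foot k x))\<^sup>2 + (norm (axis k (x $ k) :: real^'n))\<^sup>2
      - 2 * ((z - foot k x) \<bullet> axis k (x $ k))"
    unfolding eq by (simp add: power2_norm_eq_inner inner_diff_left inner_diff_right inner_commute)
  also have "(z - foot k x) \<bullet> axis k (x $ k) = x $ k * z $ k"
    by (simp add: inner_axis)
  finally have "(norm (z - x))\<^sup>2 \<ge> (norm (z - foot k x))\<^sup>2"
    using assms(1) zero_le_power2[of "norm (axis k (x $ k) :: real^'n)"] by linarith
  then have le: "norm (z - foot k x) \<le> norm (x - z)"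
    by (metis norm_ge_zero norm_minus_commute power2_le_imp_le)
  have "\<bar>(x - z) $ k\<bar> \<le> norm (x - z)"
    by (rule component_le_norm_cart)
  moreover have "\<bar>(x - z) $ k\<bar> = \<bar>x $ k\<bar> + \<bar>z $ k\<bar>"
    using assms(1) by (auto simp: mult_le_0_iff)
  ultimately show d: "\<bar>x $ k\<bar> + \<bar>z $ k\<bar> \<le> norm (x - z)" by simp
  with le show "s \<le> 2 * norm (x - z)"
    by (simp add: s_def)
  show "\<bar>z $ k\<bar> \<le> s"
    using component_le_norm_cart[of "z - foot k x" k] by (simp add: s_def)
qed

section \<open>Weakly scaling functions and their logarithmic integral\<close>

text \<open>
  Positivity, constancy below 2 and measurability are required on the whole real line, which saves side
  conditions. A function that is given on $[0,\infty)$ only is covered by composing it with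
  $t \mapsto \max(0, t)$.
\<close>

locale weak_scaling =
  fixes \<Psi> :: "real \<Rightarrow> real" and \<gamma>\<^sub>1 \<gamma>\<^sub>2 C\<^sub>1 C\<^sub>2 :: real
  assumes Psi_measurable[measurable]: "\<Psi> \<in> borel_measurable borel"
    and Psi_pos: "\<And>t. \<Psi> t > 0"
    and Psi_const: "\<And>t. t < 2 \<Longrightarrow> \<Psi> t = \<Psi> 2"
    and C_pos: "C\<^sub>1 > 0" "C\<^sub>2 > 0"
    and Psi_scaling: "\<And>r R. 2 \<le> r \<Longrightarrow> r < R \<Longrightarrow>
          C\<^sub>1 * (R / r) powr \<gamma>\<^sub>1 \<le> \<Psi> R / \<Psi> r \<and> \<Psi> R / \<Psi> r \<le> C\<^sub>2 * (R / r) powr \<gamma>\<^sub>2"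
begin

lemma Psi_nonneg[simp]: "0 \<le> \<Psi> t"
  using Psi_pos[of t] by simp

lemma Psi_max: "\<Psi> t = \<Psi> (max 2 t)"
  using Psi_const[of t] by (auto simp: max_def)

text \<open>
  The scaling condition concerns arguments from 2 on. Below 2 the function is constant, and for arguments
  above a fixed positive bound, replacing $t$ by $\max(2, t)$ changes all ratios by a bounded factor
  only.
\<close>

lemma scaling_from:
  fixes r0 :: real
  assumes "r0 > 0"
  obtains C where "C \<ge> 1"
    "\<And>r R. r0 \<le> r \<Longrightarrow> r \<le> R \<Longrightarrow> (R / r) powr \<gamma>\<^sub>1 * \<Psi> r \<le> C * \<Psi> R"
    "\<And>r R. r0 \<le> r \<Longrightarrow> r \<le> R \<Longrightarrow> \<Psi> R \<le> C * ((R / r) powr \<gamma>\<^sub>2 * \<Psi> r)"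
proof -
  \<comment> \<open>The largest factor by which passing from \<open>t\<close> to \<open>max 2 t\<close> can change an argument that is at least \<open>r0\<close>.\<close>
  define a where "a = max 1 (2 / r0)"
  define C where "C = max 1 (max (1 / C\<^sub>1 * a powr \<bar>\<gamma>\<^sub>1\<bar>) (C\<^sub>2 * a powr \<bar>\<gamma>\<^sub>2\<bar>))
     + a powr \<bar>\<gamma>\<^sub>1\<bar> + a powr \<bar>\<gamma>\<^sub>2\<bar>"
  have a: "a \<ge> 1" by (simp add: a_def)
  have C: "C \<ge> 1" "1 / C\<^sub>1 * a powr \<bar>\<gamma>\<^sub>1\<bar> \<le> C" "C\<^sub>2 * a powr \<bar>\<gamma>\<^sub>2\<bar> \<le> C" "a powr \<bar>\<gamma>\<^sub>1\<bar> \<le> C" "a powr \<bar>\<gamma>\<^sub>2\<bar> \<le> C"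
    by (simp_all add: C_def add_increasing2 add_increasing)
  have *: "(R / r) powr \<gamma>\<^sub>1 * \<Psi> r \<le> C * \<Psi> R \<and> \<Psi> R \<le> C * ((R / r) powr \<gamma>\<^sub>2 * \<Psi> r)"
    if r: "r0 \<le> r" "r \<le> R" for r R
  proof -
    define r' R' where "r' = max 2 r" and "R' = max 2 R"
    have P: "\<Psi> r = \<Psi> r'" "\<Psi> R = \<Psi> R'"
      using Psi_max by (simp_all add: r'_def R'_def)
    have pos: "r > 0" "R > 0" "r' > 0" "R' > 0" "2 \<le> r'" "r' \<le> R'" "r \<le> r'" "R \<le> R'"
      using r assms by (auto simp: r'_def R'_def)
    have "2 \<le> a * r0"
      using assms by (simp add: a_def max_def field_simps)
    then have "2 \<le> a * r" "2 \<le> a * R"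
      using r a by (smt (verit) mult_left_mono)+
    then have le: "r' \<le> a * r" "R' \<le> a * R"
      using a pos by (auto simp: r'_def R'_def)
    have ratio: "R / r \<le> a * (R' / r')" "R' / r' \<le> a * (R / r)"
    proof -
      have "R * r' \<le> R' * (a * r)"
        using le pos by (intro mult_mono) auto
      then show "R / r \<le> a * (R' / r')"
        using pos by (simp add: field_simps)
      have "R' * r \<le> a * R * r'"
        using le pos by (intro mult_mono) auto
      then show "R' / r' \<le> a * (R / r)"
        using pos by (simp add: field_simps)
    qed
    have pw: "(R / r) powr \<gamma> \<le> a powr \<bar>\<gamma>\<bar> * (R' / r') powr \<gamma>"
       "(R' / r') powr \<gamma> \<le> a powr \<bar>\<gamma>\<bar> * (R / r) powr \<gamma>" for \<gamma>
      using ratio pos a by (auto intro!: powr_comparable)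
    show ?thesis
    proof (cases "r' = R'")
      case True
      have "(R / r) powr \<gamma>\<^sub>1 \<le> C" "1 \<le> C * (R / r) powr \<gamma>\<^sub>2"
        using pw(1)[of \<gamma>\<^sub>1] pw(2)[of \<gamma>\<^sub>2] C(4,5) True pos
        by (auto intro: order_trans mult_right_mono)
      then show ?thesis
        using P True Psi_pos[of R'] by (simp add: mult_right_mono)
    next
      case False
      then have sc: "C\<^sub>1 * (R' / r') powr \<gamma>\<^sub>1 * \<Psi> r' \<le> \<Psi> R'" "\<Psi> R' \<le> C\<^sub>2 * (R' / r') powr \<gamma>\<^sub>2 * \<Psi> r'"
        using Psi_scaling[of r' R'] pos Psi_pos[of r'] by (auto simp: field_simps)
      have "(R / r) powr \<gamma>\<^sub>1 * \<Psi> r' \<le> a powr \<bar>\<gamma>\<^sub>1\<bar> * (R' / r') powr \<gamma>\<^sub>1 * \<Psi> r'"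
        by (intro mult_right_mono pw) simp
      also have "\<dots> = (1 / C\<^sub>1 * a powr \<bar>\<gamma>\<^sub>1\<bar>) * (C\<^sub>1 * (R' / r') powr \<gamma>\<^sub>1 * \<Psi> r')"
        using C_pos by simp
      also have "\<dots> \<le> C * \<Psi> R'"
        using sc C C_pos by (intro mult_mono) auto
      finally have 1: "(R / r) powr \<gamma>\<^sub>1 * \<Psi> r' \<le> C * \<Psi> R'" .
      have "\<Psi> R' \<le> C\<^sub>2 * (a powr \<bar>\<gamma>\<^sub>2\<bar> * (R / r) powr \<gamma>\<^sub>2) * \<Psi> r'"
        using sc(2) pw(2)[of \<gamma>\<^sub>2] C_pos
        by (meson Psi_nonneg less_imp_le mult_left_mono mult_right_mono order_trans)
      also have "\<dots> = (C\<^sub>2 * a powr \<bar>\<gamma>\<^sub>2\<bar>) * ((R / r) powr \<gamma>\<^sub>2 * \<Psi> r')"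
        by simp
      also have "\<dots> \<le> C * ((R / r) powr \<gamma>\<^sub>2 * \<Psi> r')"
        using C by (intro mult_right_mono) auto
      finally show ?thesis using 1 P by simp
    qed
  qed
  show ?thesis
    using that[of C] C(1) * by blast
qed

lemma Psi_comparable:
  assumes "r0 > 0" "a \<ge> 1"
  obtains C where "C \<ge> 1"
    "\<And>r R. r0 \<le> r \<Longrightarrow> r0 \<le> R \<Longrightarrow> r \<le> a * R \<Longrightarrow> R \<le> a * r \<Longrightarrow> \<Psi> R \<le> C * \<Psi> r"
proof -
  obtain C where C: "C \<ge> 1"
    "\<And>r R. r0 \<le> r \<Longrightarrow> r \<le> R \<Longrightarrow> (R / r) powr \<gamma>\<^sub>1 * \<Psi> r \<le> C * \<Psi> R"
    "\<And>r R. r0 \<le> r \<Longrightarrow> r \<le> R \<Longrightarrow> \<Psi> R \<le> C * ((R / r) powr \<gamma>\<^sub>2 * \<Psi> r)"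
    using scaling_from[OF assms(1)] by blast
  define K where "K = C * (a powr \<bar>\<gamma>\<^sub>1\<bar> + a powr \<bar>\<gamma>\<^sub>2\<bar>)"
  have "a powr \<bar>\<gamma>\<^sub>1\<bar> \<ge> 1" "a powr \<bar>\<gamma>\<^sub>2\<bar> \<ge> 1"
    using assms by (auto intro: ge_one_powr_ge_zero)
  then have K: "K \<ge> 1" "C * a powr \<bar>\<gamma>\<^sub>1\<bar> \<le> K" "C * a powr \<bar>\<gamma>\<^sub>2\<bar> \<le> K"
    using C(1) unfolding K_def by (auto simp: distrib_left intro: add_increasing2 mult_ge1_I)
  show ?thesis
  proof
    fix r R assume r: "r0 \<le> r" "r0 \<le> R" "r \<le> a * R" "R \<le> a * r"
    have pos: "r > 0" "R > 0" using r assms by auto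
    have pw: "x powr \<gamma> \<le> a powr \<bar>\<gamma>\<bar>" if "1 \<le> x" "x \<le> a" for x \<gamma>
      using powr_comparable[of x 1 a \<gamma>] that mult_mono[of 1 a 1 x] by simp
    show "\<Psi> R \<le> K * \<Psi> r"
    proof (cases "r \<le> R")
      case True
      have "\<Psi> R \<le> C * ((R / r) powr \<gamma>\<^sub>2 * \<Psi> r)"
        using C(3) r True by blast
      also have "\<dots> \<le> C * (a powr \<bar>\<gamma>\<^sub>2\<bar> * \<Psi> r)"
        using pw[of "R / r" \<gamma>\<^sub>2] True pos r C(1)
        by (intro mult_left_mono mult_right_mono) (auto simp: field_simps)
      also have "\<dots> \<le> K * \<Psi> r"
        using mult_right_mono[OF K(3) Psi_nonneg[of r]] by (simp add: mult_ac)
      finally show ?thesis .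
    next
      case False
      have "\<Psi> R = (r / R) powr (-\<gamma>\<^sub>1) * ((r / R) powr \<gamma>\<^sub>1 * \<Psi> R)"
        using pos by (simp add: powr_minus)
      also have "\<dots> \<le> a powr \<bar>\<gamma>\<^sub>1\<bar> * (C * \<Psi> r)"
      proof (rule mult_mono)
        show "(r / R) powr (-\<gamma>\<^sub>1) \<le> a powr \<bar>\<gamma>\<^sub>1\<bar>"
          using pw[of "r / R" "-\<gamma>\<^sub>1"] r False pos by (simp add: field_simps)
        show "(r / R) powr \<gamma>\<^sub>1 * \<Psi> R \<le> C * \<Psi> r"
          using C(2)[of R r] r False by simp
      qed simp_all
      also have "\<dots> \<le> K * \<Psi> r"
        using mult_right_mono[OF K(2) Psi_nonneg[of r]] by (simp add: mult_ac)
      finally show ?thesis .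
    qed
  qed (fact K(1))
qed

text \<open>
  The separation of variables on which all kernel estimates rest: an argument comparable to $v s / w$
  with $w \le s$ may be replaced by $v$ at the price of a power of $s/w$. The ratio 16 covers the loss
  from replacing distances by comparable ones, which is a factor of at most 4 before squaring.
\<close>

lemma Psi_split:
  obtains C where "C \<ge> 1"
    "\<And>\<rho> v s w. 0 < w \<Longrightarrow> w \<le> s \<Longrightarrow> 1/2 \<le> v \<Longrightarrow> 1/2 \<le> \<rho> \<Longrightarrow> \<rho> \<le> 16 * (v * (s / w)) \<Longrightarrow>
       v * (s / w) \<le> 16 * \<rho> \<Longrightarrow> \<Psi> \<rho> \<le> C * ((s / w) powr \<gamma>\<^sub>2 * \<Psi> v)"
    "\<And>\<rho> v s w. 0 < w \<Longrightarrow> w \<le> s \<Longrightarrow> 1/2 \<le> v \<Longrightarrow> 1/2 \<le> \<rho> \<Longrightarrow> \<rho> \<le> 16 * (v * (s / w)) \<Longrightarrow>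
       v * (s / w) \<le> 16 * \<rho> \<Longrightarrow> (s / w) powr \<gamma>\<^sub>1 * \<Psi> v \<le> C * \<Psi> \<rho>"
proof -
  obtain A where A: "A \<ge> 1"
    "\<And>r R. 1/2 \<le> r \<Longrightarrow> r \<le> R \<Longrightarrow> (R / r) powr \<gamma>\<^sub>1 * \<Psi> r \<le> A * \<Psi> R"
    "\<And>r R. 1/2 \<le> r \<Longrightarrow> r \<le> R \<Longrightarrow> \<Psi> R \<le> A * ((R / r) powr \<gamma>\<^sub>2 * \<Psi> r)"
    using scaling_from[of "1/2"] by auto
  obtain B where B: "B \<ge> 1"
    "\<And>r R. 1/2 \<le> r \<Longrightarrow> 1/2 \<le> R \<Longrightarrow> r \<le> 16 * R \<Longrightarrow> R \<le> 16 * r \<Longrightarrow> \<Psi> R \<le> B * \<Psi> r"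
    using Psi_comparable[of "1/2" 16] by auto
  show ?thesis
  proof (rule that[of "A * B"])
    show "A * B \<ge> 1" using A(1) B(1) by (simp add: mult_ge1_I)
    fix \<rho> v s w :: real
    assume h: "0 < w" "w \<le> s" "1/2 \<le> v" "1/2 \<le> \<rho>" "\<rho> \<le> 16 * (v * (s / w))" "v * (s / w) \<le> 16 * \<rho>"
    define R where "R = v * (s / w)"
    have "1 \<le> s / w" using h by simp
    then have "v \<le> R"
      using h(3) mult_left_mono[of 1 "s / w" v] by (simp add: R_def)
    then have R: "v \<le> R" "1/2 \<le> R"
      using h(3) by linarith+
    have q: "R / v = s / w" using h(3) by (simp add: R_def)
    have "\<Psi> \<rho> \<le> B * \<Psi> R"
      using B(2)[of R \<rho>] h R by (simp add: R_def)
    also have "\<dots> \<le> B * (A * ((s / w) powr \<gamma>\<^sub>2 * \<Psi> v))"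
      using A(3)[of v R] h(3) R(1) B(1) q by simp
    finally show "\<Psi> \<rho> \<le> A * B * ((s / w) powr \<gamma>\<^sub>2 * \<Psi> v)"
      by (simp add: mult_ac)
    have "(s / w) powr \<gamma>\<^sub>1 * \<Psi> v \<le> A * \<Psi> R"
      using A(2)[of v R] h(3) R(1) q by simp
    also have "\<dots> \<le> A * (B * \<Psi> \<rho>)"
      using B(2)[of \<rho> R] h R A(1) by (simp add: R_def)
    finally show "(s / w) powr \<gamma>\<^sub>1 * \<Psi> v \<le> A * B * \<Psi> \<rho>"
      by (simp add: mult_ac)
  qed
qed

definition log_integral :: "real \<Rightarrow> real \<Rightarrow> ennreal" where
  "log_integral a b = (\<integral>\<^sup>+v\<in>{a..b}. ennreal (\<Psi> v / v) \<partial>lborel)"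

lemma log_integral_mono:
  "a' \<le> a \<Longrightarrow> b \<le> b' \<Longrightarrow> log_integral a b \<le> log_integral a' b'"
  unfolding log_integral_def by (intro nn_integral_mono) (auto simp: indicator_def)

lemma log_integral_split:
  "log_integral a c \<le> log_integral a b + log_integral b c"
proof -
  have "log_integral a c \<le> (\<integral>\<^sup>+v. ennreal (\<Psi> v / v) * indicator {a..b} v + ennreal (\<Psi> v / v) * indicator {b..c} v \<partial>lborel)"
    unfolding log_integral_def by (intro nn_integral_mono) (auto simp: indicator_def)
  also have "\<dots> = log_integral a b + log_integral b c"
    unfolding log_integral_def by (rule nn_integral_add) auto
  finally show ?thesis .
qed

lemma log_integral_le_Psi:
  assumes "v0 > 0" "a \<ge> 1"
  obtains C where "C \<ge> 1" "\<And>v. v0 \<le> v \<Longrightarrow> log_integral v (a * v) \<le> ennreal (C * \<Psi> v)"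
proof -
  obtain C where C: "C \<ge> 1"
    "\<And>r R. v0 \<le> r \<Longrightarrow> v0 \<le> R \<Longrightarrow> r \<le> a * R \<Longrightarrow> R \<le> a * r \<Longrightarrow> \<Psi> R \<le> C * \<Psi> r"
    using Psi_comparable[OF assms] by blast
  show ?thesis
  proof (rule that[of "C * a"])
    show "C * a \<ge> 1" using C assms by (simp add: mult_ge1_I)
    fix v assume v: "v0 \<le> v"
    have vpos: "v > 0" using v assms by simp
    have av: "v \<le> a * v" using assms vpos by simp
    have "log_integral v (a * v) \<le> ennreal (C * \<Psi> v / v * (a * v - v))"
      unfolding log_integral_def
    proof (rule nn_integral_Icc_le)
      fix t assume t: "v \<le> t" "t \<le> a * v"
      have "v \<le> a * t" using t av assms vpos by (smt (verit) mult_left_mono)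
      then have "\<Psi> t \<le> C * \<Psi> v"
        using C(2)[of v t] t v by auto
      then show "\<Psi> t / t \<le> C * \<Psi> v / v"
        using t vpos C(1) by (intro frac_le) auto
    qed (use av C vpos in auto)
    also have "\<dots> \<le> ennreal (C * a * \<Psi> v)"
      using vpos C(1) by (intro ennreal_leI) (simp add: field_simps)
    finally show "log_integral v (a * v) \<le> ennreal (C * a * \<Psi> v)" .
  qed
qed

lemma Psi_le_log_integral:
  obtains C where "C \<ge> 1" "\<And>v. 2 \<le> v \<Longrightarrow> ennreal (\<Psi> v) \<le> ennreal C * log_integral (v / 2) v"
proof -
  obtain C where C: "C \<ge> 1"
    "\<And>r R. 1 \<le> r \<Longrightarrow> 1 \<le> R \<Longrightarrow> r \<le> 2 * R \<Longrightarrow> R \<le> 2 * r \<Longrightarrow> \<Psi> R \<le> C * \<Psi> r"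
    using Psi_comparable[of 1 2] by auto
  show ?thesis
  proof (rule that[of "2 * C"])
    show "2 * C \<ge> 1" using C(1) by simp
    fix v :: real assume v: "2 \<le> v"
    have half: "\<Psi> v / C / v * (v - v / 2) = \<Psi> v / (2 * C)"
      using v by (simp add: field_split_simps)
    have "ennreal (\<Psi> v / C / v * (v - v / 2)) \<le> log_integral (v / 2) v"
      unfolding log_integral_def
    proof (rule nn_integral_Icc_ge)
      fix t assume t: "v / 2 \<le> t" "t \<le> v"
      have "\<Psi> v \<le> C * \<Psi> t"
        using C(2)[of t v] t v by auto
      then have "\<Psi> v / C \<le> \<Psi> t" using C(1) by (simp add: field_simps)
      then show "\<Psi> v / C / v \<le> \<Psi> t / t"
        using t v by (intro frac_le) simp_all
    qed (use v C(1) in simp_all)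
    then have "ennreal (\<Psi> v / (2 * C)) \<le> log_integral (v / 2) v"
      by (simp only: half)
    then have "ennreal (2 * C) * ennreal (\<Psi> v / (2 * C)) \<le> ennreal (2 * C) * log_integral (v / 2) v"
      by (intro mult_left_mono) auto
    also have "ennreal (2 * C) * ennreal (\<Psi> v / (2 * C)) = ennreal (2 * C * (\<Psi> v / (2 * C)))"
      using C(1) by (intro ennreal_mult'[symmetric]) simp
    also have "2 * C * (\<Psi> v / (2 * C)) = \<Psi> v"
      using C(1) by simp
    finally show "ennreal (\<Psi> v) \<le> ennreal (2 * C) * log_integral (v / 2) v" .
  qed
qed

text \<open>
  The logarithmic integral is insensitive to its end points: the part below $2l$ is at most a multiple of
  $\Psi(2l)$ and the part beyond $u$ is at most a multiple of $\Psi(u)$. Both values are controlled by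
  an integral over an interval $[v/2, v]$ inside $[l, u]$; this is what $u \ge 2l$ is for.
\<close>

lemma log_integral_absorb:
  assumes "l \<ge> 1" "a \<ge> 1"
  obtains C where "C \<ge> 1"
    "\<And>u w. 2 * l \<le> u \<Longrightarrow> w \<le> a * u \<Longrightarrow> log_integral (1/2) w \<le> ennreal C * log_integral l u"
proof -
  have l4: "4 * l \<ge> 1" and half: "(1/2 :: real) > 0" using assms by simp_all
  obtain A1 where A1: "A1 \<ge> 1" "\<And>v. 1/2 \<le> v \<Longrightarrow> log_integral v (4 * l * v) \<le> ennreal (A1 * \<Psi> v)"
    using log_integral_le_Psi[of "1/2" "4 * l"] l4 half by blast
  obtain A2 where A2: "A2 \<ge> 1" "\<And>v. 1/2 \<le> v \<Longrightarrow> log_integral v (a * v) \<le> ennreal (A2 * \<Psi> v)"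
    using log_integral_le_Psi[of "1/2" a] assms(2) half by blast
  obtain A3 where A3: "A3 \<ge> 1" "\<And>v. 2 \<le> v \<Longrightarrow> ennreal (\<Psi> v) \<le> ennreal A3 * log_integral (v / 2) v"
    using Psi_le_log_integral by blast
  obtain A4 where A4: "A4 \<ge> 1"
    "\<And>r R. 1/2 \<le> r \<Longrightarrow> 1/2 \<le> R \<Longrightarrow> r \<le> 4 * l * R \<Longrightarrow> R \<le> 4 * l * r \<Longrightarrow> \<Psi> R \<le> A4 * \<Psi> r"
    using Psi_comparable[of "1/2" "4 * l"] l4 half by blast
  show ?thesis
  proof (rule that[of "A1 * A4 * A3 + 1 + A2 * A3"])
    have nonneg: "0 \<le> A1 * A4 * A3" "0 \<le> A2 * A3"
      using A1(1) A2(1) A3(1) A4(1) by (simp_all add: mult_nonneg_nonneg)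
    then show "A1 * A4 * A3 + 1 + A2 * A3 \<ge> 1"
      by linarith
    fix u w assume u: "2 * l \<le> u" and w: "w \<le> a * u"
    let ?I = "log_integral l u"
    have Psi_le: "ennreal (\<Psi> v) \<le> ennreal A3 * ?I" if "2 * l \<le> v" "v \<le> u" for v
    proof -
      have "log_integral (v / 2) v \<le> ?I"
        using that by (intro log_integral_mono) simp_all
      then have "ennreal A3 * log_integral (v / 2) v \<le> ennreal A3 * ?I"
        by (rule mult_left_mono) simp
      moreover have "2 \<le> v" using that assms(1) by linarith
      ultimately show ?thesis
        using A3(2)[of v] by (meson order_trans)
    qed
    have "\<Psi> (1/2) \<le> A4 * \<Psi> (2 * l)"
    proof (rule A4(2))
      have "2 * l * (4 * l) \<ge> 1 / 2"
        using assms(1) by (intro order_trans[OF _ mult_mono[of 2 "2 * l" 4 "4 * l"]]) simp_all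
      then show "1 / 2 \<le> 4 * l * (2 * l)" by (simp add: mult_ac)
    qed (use assms(1) in simp_all)
    then have "A1 * \<Psi> (1/2) \<le> A1 * A4 * \<Psi> (2 * l)"
      using A1(1) by (simp add: mult.assoc)
    then have "log_integral (1/2) (2 * l) \<le> ennreal (A1 * A4 * \<Psi> (2 * l))"
      using A1(2)[of "1/2"] order_trans[OF _ ennreal_leI] by simp
    then have "log_integral (1/2) (2 * l) \<le> ennreal (A1 * A4) * ennreal (\<Psi> (2 * l))"
      by (simp add: ennreal_mult'')
    then have 1: "log_integral (1/2) (2 * l) \<le> ennreal (A1 * A4 * A3) * ?I"
      using Psi_le[of "2 * l"] u A1(1) A4(1)
      by (intro ennreal_bound_trans[where y="ennreal (\<Psi> (2 * l))" and a="A1 * A4"]) simp_all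
    have 2: "log_integral (2 * l) u \<le> ?I"
      using assms by (intro log_integral_mono) auto
    have "log_integral u w \<le> log_integral u (a * u)"
      using w by (intro log_integral_mono) auto
    also have "\<dots> \<le> ennreal (A2 * \<Psi> u)"
      using A2(2)[of u] u assms(1) by simp
    also have "\<dots> = ennreal A2 * ennreal (\<Psi> u)"
      by (simp add: ennreal_mult'')
    finally have 3: "log_integral u w \<le> ennreal (A2 * A3) * ?I"
      using Psi_le[of u] u A2(1)
      by (intro ennreal_bound_trans[where y="ennreal (\<Psi> u)"]) simp_all
    have "log_integral (1/2) w \<le> log_integral (1/2) (2 * l) + (log_integral (2 * l) u + log_integral u w)"
      using log_integral_split[of "1/2" w "2 * l"] log_integral_split[of "2 * l" w u]
      by (meson add_left_mono order_trans)
    also have "\<dots> \<le> ennreal (A1 * A4 * A3) * ?I + (?I + ennreal (A2 * A3) * ?I)"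
      by (intro add_mono 1 2 3)
    also have "\<dots> = (ennreal (A1 * A4 * A3) + (ennreal 1 + ennreal (A2 * A3))) * ?I"
      by (simp only: distrib_right ennreal_1 mult_1)
    also have "ennreal (A1 * A4 * A3) + (ennreal 1 + ennreal (A2 * A3)) = ennreal (A1 * A4 * A3 + 1 + A2 * A3)"
      using nonneg by (simp only: ennreal_plus add_nonneg_nonneg zero_le_one add.assoc)
    finally show "log_integral (1/2) w \<le> ennreal (A1 * A4 * A3 + 1 + A2 * A3) * ?I" .
  qed
qed

lemma Psi_absorb:
  assumes "a \<ge> 1"
  obtains C where "C \<ge> 1"
    "\<And>u v. 2 \<le> u \<Longrightarrow> v \<le> a * u \<Longrightarrow> ennreal (\<Psi> v) \<le> ennreal C * log_integral 1 u"
proof -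
  obtain A1 where A1: "A1 \<ge> 1"
    "\<And>u w. 2 * 1 \<le> u \<Longrightarrow> w \<le> a * u \<Longrightarrow> log_integral (1/2) w \<le> ennreal A1 * log_integral 1 u"
    using log_integral_absorb[of 1 a] assms by auto
  obtain A3 where A3: "A3 \<ge> 1" "\<And>v. 2 \<le> v \<Longrightarrow> ennreal (\<Psi> v) \<le> ennreal A3 * log_integral (v / 2) v"
    using Psi_le_log_integral by blast
  show ?thesis
  proof (rule that[of "A3 * A1"])
    show "A3 * A1 \<ge> 1" using A1(1) A3(1) by (simp add: mult_ge1_I)
    fix u v assume u: "2 \<le> u" "v \<le> a * u"
    have "max 2 v \<le> a * u" using u assms mult_mono[of 1 a 2 u] by auto
    have "ennreal (\<Psi> v) \<le> ennreal A3 * log_integral (max 2 v / 2) (max 2 v)"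
      using A3(2)[of "max 2 v"] Psi_max[of v] by simp
    moreover have "log_integral (max 2 v / 2) (max 2 v) \<le> log_integral (1/2) (max 2 v)"
      by (intro log_integral_mono) auto
    moreover have "log_integral (1/2) (max 2 v) \<le> ennreal A1 * log_integral 1 u"
      using A1(2)[of u "max 2 v"] u \<open>max 2 v \<le> a * u\<close> by simp
    ultimately show "ennreal (\<Psi> v) \<le> ennreal (A3 * A1) * log_integral 1 u"
      using A3(1) by (intro ennreal_bound_trans[where y="log_integral (max 2 v / 2) (max 2 v)"]) auto
  qed
qed

lemma log_integral_scale:
  assumes "c > 0"
  shows "(\<integral>\<^sup>+s\<in>{a..b}. ennreal (\<Psi> (s / c) / s) \<partial>lborel) = log_integral (a / c) (b / c)"
proof -
  have "(\<integral>\<^sup>+s\<in>{a..b}. ennreal (\<Psi> (s / c) / s) \<partial>lborel) =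
     ennreal c * (\<integral>\<^sup>+v. ennreal (\<Psi> v / (c * v)) * indicator {a..b} (c * v) \<partial>lborel)"
    using assms by (subst nn_integral_real_affine[where c=c and t=0]) auto
  also have "\<dots> = (\<integral>\<^sup>+v. ennreal c * (ennreal (\<Psi> v / (c * v)) * indicator {a..b} (c * v)) \<partial>lborel)"
    by (rule nn_integral_cmult[symmetric]) simp
  also have "\<dots> = log_integral (a / c) (b / c)"
    unfolding log_integral_def using assms
    by (intro nn_integral_cong) (auto simp: indicator_def field_simps ennreal_mult'[symmetric])
  finally show ?thesis .
qed

text \<open>
  The measure $ds/s$ is invariant under $s \mapsto c/s$. The substitution rule asks for an increasing
  map, so it is applied to $s \mapsto -c/s$ after a reflection.
\<close>

lemma log_integral_invert:
  assumes "c > 0" "a > 0" "a \<le> b"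
  shows "(\<integral>\<^sup>+s\<in>{a..b}. ennreal (\<Psi> (c / s) / s) \<partial>lborel) = log_integral (c / b) (c / a)"
proof -
  define f where "f y = \<Psi> (- y) / (- y)" for y
  have [measurable]: "f \<in> borel_measurable borel"
    unfolding f_def by measurable
  have "log_integral (c / b) (c / a) =
      (\<integral>\<^sup>+y. ennreal (f y) * indicator {c / b..c / a} (- y) \<partial>lborel)"
    unfolding log_integral_def f_def by (subst nn_integral_real_affine[where c="-1" and t=0]) simp_all
  also have "\<dots> = (\<integral>\<^sup>+y. ennreal (f y * indicator {- c / a..- c / b} y) \<partial>lborel)"
    by (intro nn_integral_cong) (auto simp: indicator_def)
  also have "\<dots> = (\<integral>\<^sup>+s. ennreal (f (- c / s) * (c / s\<^sup>2) * indicator {a..b} s) \<partial>lborel)"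
  proof (rule nn_integral_substitution)
    show "set_borel_measurable borel {- c / a..- c / b} f"
      unfolding set_borel_measurable_def by measurable
    show "((\<lambda>s. - c / s) has_real_derivative c / x\<^sup>2) (at x)" if "x \<in> {a..b}" for x
      using that assms by (auto intro!: derivative_eq_intros simp: power2_eq_square)
    show "continuous_on {a..b} (\<lambda>s. c / s\<^sup>2)"
      using assms by (auto intro!: continuous_intros)
  qed (use assms in auto)
  also have "\<dots> = (\<integral>\<^sup>+s\<in>{a..b}. ennreal (\<Psi> (c / s) / s) \<partial>lborel)"
    using assms by (intro nn_integral_cong)
      (auto simp: indicator_def f_def power2_eq_square)
  finally show ?thesis ..
qed

lemma log_integral_finite: "log_integral 1 u < \<infinity>"
proof (cases "u \<ge> 1")
  case True
  then obtain C where "\<And>v. 1 \<le> v \<Longrightarrow> log_integral v (u * v) \<le> ennreal (C * \<Psi> v)"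
    using log_integral_le_Psi[of 1 u] by auto
  from this[of 1] show ?thesis
    by (simp add: order.strict_trans1)
next
  case False
  then show ?thesis by (simp add: log_integral_def)
qed

lemma Psi1_eq: "Psi1 \<Psi> u = (LINT v:{1..max 2 u}|lborel. \<Psi> v / v)"
  by (simp add: Psi1_def max_def)

lemma ennreal_Psi1: "ennreal (Psi1 \<Psi> u) = log_integral 1 (max 2 u)"
proof -
  let ?f = "\<lambda>v. indicator {1..max 2 u} v *\<^sub>R (\<Psi> v / v)"
  have eq: "log_integral 1 (max 2 u) = (\<integral>\<^sup>+v. ennreal (?f v) \<partial>lborel)"
    unfolding log_integral_def by (intro nn_integral_cong) (auto simp: indicator_def)
  have "Psi1 \<Psi> u = enn2real (\<integral>\<^sup>+v. ennreal (?f v) \<partial>lborel)"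
    unfolding Psi1_eq set_lebesgue_integral_def
    by (rule integral_eq_nn_integral) (auto simp: indicator_def)
  then show ?thesis
    using log_integral_finite[of "max 2 u"] eq by simp
qed

lemma Psi1_nonneg: "Psi1 \<Psi> u \<ge> 0"
  unfolding Psi1_eq set_lebesgue_integral_def
  by (rule integral_nonneg_AE) (auto simp: indicator_def)

lemma Psi_le_Psi1:
  obtains C where "C \<ge> 1" "\<And>u. \<Psi> u \<le> C * Psi1 \<Psi> u" "\<And>u. 1 \<le> C * Psi1 \<Psi> u"
proof -
  obtain G where G: "G \<ge> 1"
    "\<And>u v. 2 \<le> u \<Longrightarrow> v \<le> 1 * u \<Longrightarrow> ennreal (\<Psi> v) \<le> ennreal G * log_integral 1 u"
    by (rule Psi_absorb[of 1]) (simp, blast)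
  have le: "\<Psi> v \<le> G * Psi1 \<Psi> u" if "v \<le> max 2 u" for u v
  proof -
    have "ennreal (\<Psi> v) \<le> ennreal (G * Psi1 \<Psi> u)"
      using G(2)[of "max 2 u" v] that G(1) by (simp add: ennreal_mult' ennreal_Psi1)
    then show ?thesis using G(1) Psi1_nonneg by (subst (asm) ennreal_le_iff) auto
  qed
  show ?thesis
  proof (rule that[of "G * (1 + 1 / \<Psi> 2)"])
    show "G * (1 + 1 / \<Psi> 2) \<ge> 1" using G(1) by (intro mult_ge1_I) auto
    fix u :: real
    have nn: "0 \<le> G * (1 / \<Psi> 2 * Psi1 \<Psi> u)" using G(1) Psi1_nonneg by simp
    show "\<Psi> u \<le> G * (1 + 1 / \<Psi> 2) * Psi1 \<Psi> u"
      using le[of u u] nn by (simp add: algebra_simps)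
    have "1 = 1 / \<Psi> 2 * \<Psi> 2" using Psi_pos[of 2] by simp
    also have "\<dots> \<le> 1 / \<Psi> 2 * (G * Psi1 \<Psi> u)"
      by (rule mult_left_mono[OF le]) simp_all
    finally show "1 \<le> G * (1 + 1 / \<Psi> 2) * Psi1 \<Psi> u"
      using mult_nonneg_nonneg[OF _ Psi1_nonneg[of u], of G] G(1) by (simp add: algebra_simps)
  qed
qed

text \<open>
  For a positive lower index, $\Psi(v)$ is at most a multiple of $(v/u)^{\gamma_1} \Psi(u)$, and this
  power is integrable against $dv/v$ at zero.
\<close>

lemma Psi1_le_Psi:
  assumes "\<gamma>\<^sub>1 > 0"
  obtains C where "C \<ge> 0" "\<And>u. Psi1 \<Psi> u \<le> C * \<Psi> u"
proof -
  obtain A where A: "A \<ge> 1"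
    "\<And>r R. 1 \<le> r \<Longrightarrow> r \<le> R \<Longrightarrow> (R / r) powr \<gamma>\<^sub>1 * \<Psi> r \<le> A * \<Psi> R"
    by (rule scaling_from[of 1]) (simp, blast)
  show ?thesis
  proof (rule that[of "A / \<gamma>\<^sub>1"])
    show "A / \<gamma>\<^sub>1 \<ge> 0" using A(1) assms by simp
    fix u :: real
    define U where "U = max 2 u"
    have U: "U \<ge> 2" "\<Psi> u = \<Psi> U" using Psi_max[of u] by (auto simp: U_def)
    have "ennreal (Psi1 \<Psi> u) = (\<integral>\<^sup>+v\<in>{1..U}. ennreal (\<Psi> v / v) \<partial>lborel)"
      unfolding ennreal_Psi1 log_integral_def U_def ..
    also have "\<dots> \<le> ennreal (A * \<Psi> U * U powr (- \<gamma>\<^sub>1)) * (\<integral>\<^sup>+v\<in>{1..U}. ennreal (v powr (\<gamma>\<^sub>1 - 1)) \<partial>lborel)"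
    proof (rule nn_integral_set_le_scaled)
      fix v assume "v \<in> {1..U}"
      then have v: "1 \<le> v" "v \<le> U" by auto
      have "\<Psi> v = (U / v) powr (- \<gamma>\<^sub>1) * ((U / v) powr \<gamma>\<^sub>1 * \<Psi> v)"
        using v U by (simp add: powr_minus)
      also have "\<dots> \<le> (U / v) powr (- \<gamma>\<^sub>1) * (A * \<Psi> U)"
        using A(2)[OF v] by (intro mult_left_mono) auto
      also have "(U / v) powr (- \<gamma>\<^sub>1) = U powr (- \<gamma>\<^sub>1) * v powr \<gamma>\<^sub>1"
        using v U by (simp add: powr_divide powr_minus field_simps)
      finally have "\<Psi> v / v \<le> U powr (- \<gamma>\<^sub>1) * v powr \<gamma>\<^sub>1 * (A * \<Psi> U) / v"
        using v by (intro divide_right_mono) auto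
      also have "\<dots> = A * \<Psi> U * U powr (- \<gamma>\<^sub>1) * v powr (\<gamma>\<^sub>1 - 1)"
        using v by (simp add: powr_diff)
      finally show "\<Psi> v / v \<le> A * \<Psi> U * U powr (- \<gamma>\<^sub>1) * v powr (\<gamma>\<^sub>1 - 1)" .
    qed (use A(1) in simp_all)
    also have "\<dots> \<le> ennreal (A * \<Psi> U * U powr (- \<gamma>\<^sub>1)) * ennreal (U powr \<gamma>\<^sub>1 / \<gamma>\<^sub>1)"
    proof (rule mult_left_mono)
      have "(\<integral>\<^sup>+v\<in>{1..U}. ennreal (v powr (\<gamma>\<^sub>1 - 1)) \<partial>lborel) \<le> (\<integral>\<^sup>+v\<in>{0..U}. ennreal (v powr (\<gamma>\<^sub>1 - 1)) \<partial>lborel)"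
        by (intro nn_integral_mono mult_left_mono) (simp_all add: indicator_def)
      also have "\<dots> = ennreal (U powr \<gamma>\<^sub>1 / \<gamma>\<^sub>1)"
        using nn_integral_powr_from_0[of "\<gamma>\<^sub>1 - 1" U] assms U by simp
      finally show "(\<integral>\<^sup>+v\<in>{1..U}. ennreal (v powr (\<gamma>\<^sub>1 - 1)) \<partial>lborel) \<le> ennreal (U powr \<gamma>\<^sub>1 / \<gamma>\<^sub>1)" .
    qed simp
    also have "\<dots> = ennreal (A * \<Psi> U * U powr (- \<gamma>\<^sub>1) * (U powr \<gamma>\<^sub>1 / \<gamma>\<^sub>1))"
      using A(1) by (intro ennreal_mult'[symmetric]) simp
    also have "A * \<Psi> U * U powr (- \<gamma>\<^sub>1) * (U powr \<gamma>\<^sub>1 / \<gamma>\<^sub>1) = A / \<gamma>\<^sub>1 * \<Psi> U"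
      using U by (simp add: powr_minus)
    finally show "Psi1 \<Psi> u \<le> A / \<gamma>\<^sub>1 * \<Psi> u"
      unfolding U(2) using A(1) assms by (subst (asm) ennreal_le_iff) auto
  qed
qed

lemma Psi1_bounded:
  assumes "\<gamma>\<^sub>2 < 0"
  obtains C where "C \<ge> 0" "\<And>u. Psi1 \<Psi> u \<le> C"
proof -
  obtain A where A: "A \<ge> 1"
    "\<And>r R. 1 \<le> r \<Longrightarrow> r \<le> R \<Longrightarrow> \<Psi> R \<le> A * ((R / r) powr \<gamma>\<^sub>2 * \<Psi> r)"
    by (rule scaling_from[of 1]) (simp, blast)
  show ?thesis
  proof (rule that[of "A * \<Psi> 1 * (1 / (- \<gamma>\<^sub>2))"])
    show nonneg: "A * \<Psi> 1 * (1 / (- \<gamma>\<^sub>2)) \<ge> 0"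
      using A(1) assms by (intro mult_nonneg_nonneg) auto
    fix u :: real
    have "ennreal (Psi1 \<Psi> u) = (\<integral>\<^sup>+v\<in>{1..max 2 u}. ennreal (\<Psi> v / v) \<partial>lborel)"
      unfolding ennreal_Psi1 log_integral_def ..
    also have "\<dots> \<le> ennreal (A * \<Psi> 1) * (\<integral>\<^sup>+v\<in>{1..max 2 u}. ennreal (v powr (\<gamma>\<^sub>2 - 1)) \<partial>lborel)"
    proof (rule nn_integral_set_le_scaled)
      fix v assume "v \<in> {1..max 2 u}"
      then have v: "1 \<le> v" by auto
      have "\<Psi> v / v \<le> A * (v powr \<gamma>\<^sub>2 * \<Psi> 1) / v"
        using A(2)[of 1 v] v by (intro divide_right_mono) auto
      also have "\<dots> = A * \<Psi> 1 * v powr (\<gamma>\<^sub>2 - 1)"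
        using v by (simp add: powr_diff)
      finally show "\<Psi> v / v \<le> A * \<Psi> 1 * v powr (\<gamma>\<^sub>2 - 1)" .
    qed (use A(1) in simp_all)
    also have "\<dots> \<le> ennreal (A * \<Psi> 1) * ennreal (1 / (- \<gamma>\<^sub>2))"
    proof (rule mult_left_mono)
      have "(\<integral>\<^sup>+v\<in>{1..max 2 u}. ennreal (v powr (\<gamma>\<^sub>2 - 1)) \<partial>lborel) \<le> (\<integral>\<^sup>+v\<in>{1..}. ennreal (v powr (\<gamma>\<^sub>2 - 1)) \<partial>lborel)"
        by (intro nn_integral_mono mult_left_mono) (simp_all add: indicator_def)
      also have "\<dots> = ennreal (1 / (- \<gamma>\<^sub>2))"
        using nn_integral_powr_to_inf[of "\<gamma>\<^sub>2 - 1" 1] assms by simp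
      finally show "(\<integral>\<^sup>+v\<in>{1..max 2 u}. ennreal (v powr (\<gamma>\<^sub>2 - 1)) \<partial>lborel) \<le> ennreal (1 / (- \<gamma>\<^sub>2))" .
    qed simp
    also have "\<dots> = ennreal (A * \<Psi> 1 * (1 / (- \<gamma>\<^sub>2)))"
      using A(1) assms by (intro ennreal_mult'[symmetric]) simp
    finally show "Psi1 \<Psi> u \<le> A * \<Psi> 1 * (1 / (- \<gamma>\<^sub>2))"
      using nonneg by (subst (asm) ennreal_le_iff) auto
  qed
qed

end

section \<open>The normalizing constant of the return kernel\<close>

text \<open>
  The parameter \<open>D\<close> abbreviates the exponent $d + \alpha$ of the jump kernel.
\<close>

locale resurrection = weak_scaling \<Psi> \<gamma>\<^sub>1 \<gamma>\<^sub>2 C\<^sub>1 C\<^sub>2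
  for \<Psi> :: "real \<Rightarrow> real" and \<gamma>\<^sub>1 \<gamma>\<^sub>2 C\<^sub>1 C\<^sub>2 :: real +
  fixes \<alpha> D :: real and k :: "'n::finite"
  assumes alpha: "0 < \<alpha>" "\<alpha> < 2"
    and gamma: "\<gamma>\<^sub>1 \<le> \<gamma>\<^sub>2" "\<gamma>\<^sub>2 < 1" "\<gamma>\<^sub>2 < \<alpha>"
    and D_def: "D = real CARD('n) + \<alpha>"
begin

lemma D_bounds: "D \<ge> 1 + \<alpha>" "D > 0" "D - \<gamma>\<^sub>1 > 1" "D - \<gamma>\<^sub>2 > 1"
proof -
  have "real CARD('n) \<ge> 1"
    by (simp add: Suc_leI)
  then show "D \<ge> 1 + \<alpha>" by (simp add: D_def)
  then show "D > 0" "D - \<gamma>\<^sub>1 > 1" "D - \<gamma>\<^sub>2 > 1" using alpha gamma by linarith+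
qed

lemma exponent: "- real CARD('n) - \<alpha> = - D"
  by (simp add: D_def)

text \<open>
  The bounds of \<open>Psi_split\<close> with reference point $v = 1$. They are enough where the kernel has only
  one length scale. The distance may be replaced by any comparable $s$.
\<close>

lemma Psi_power_bounds:
  obtains C where "C \<ge> 1"
    "\<And>(y::real^'n) z s. y $ k > 0 \<Longrightarrow> z $ k < 0 \<Longrightarrow> norm (y - z) \<le> s \<Longrightarrow> s \<le> 2 * norm (y - z) \<Longrightarrow>
      \<Psi> ((norm (y - z))\<^sup>2 / (y $ k * \<bar>z $ k\<bar>)) \<le>
        C * (s powr (2 * \<gamma>\<^sub>2) * (y $ k) powr (- \<gamma>\<^sub>2) * \<bar>z $ k\<bar> powr (- \<gamma>\<^sub>2))"
    "\<And>(y::real^'n) z s. y $ k > 0 \<Longrightarrow> z $ k < 0 \<Longrightarrow> norm (y - z) \<le> s \<Longrightarrow> s \<le> 2 * norm (y - z) \<Longrightarrow>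
      s powr (2 * \<gamma>\<^sub>1) * (y $ k) powr (- \<gamma>\<^sub>1) * \<bar>z $ k\<bar> powr (- \<gamma>\<^sub>1) \<le>
        C * \<Psi> ((norm (y - z))\<^sup>2 / (y $ k * \<bar>z $ k\<bar>))"
proof -
  obtain A where A: "A \<ge> 1"
    "\<And>\<rho> v s w. 0 < w \<Longrightarrow> w \<le> s \<Longrightarrow> 1/2 \<le> v \<Longrightarrow> 1/2 \<le> \<rho> \<Longrightarrow> \<rho> \<le> 16 * (v * (s / w)) \<Longrightarrow>
       v * (s / w) \<le> 16 * \<rho> \<Longrightarrow> \<Psi> \<rho> \<le> A * ((s / w) powr \<gamma>\<^sub>2 * \<Psi> v)"
    "\<And>\<rho> v s w. 0 < w \<Longrightarrow> w \<le> s \<Longrightarrow> 1/2 \<le> v \<Longrightarrow> 1/2 \<le> \<rho> \<Longrightarrow> \<rho> \<le> 16 * (v * (s / w)) \<Longrightarrow>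
       v * (s / w) \<le> 16 * \<rho> \<Longrightarrow> (s / w) powr \<gamma>\<^sub>1 * \<Psi> v \<le> A * \<Psi> \<rho>"
    using Psi_split by blast
  define m where "m = 1 + \<Psi> 1 + 1 / \<Psi> 1"
  have m: "m \<ge> 1" "\<Psi> 1 \<le> m" "1 \<le> m * \<Psi> 1"
    using Psi_pos[of 1] by (auto simp: m_def distrib_right)
  have *: "\<Psi> ((norm (y - z))\<^sup>2 / (y $ k * \<bar>z $ k\<bar>)) \<le>
        A * m * (s powr (2 * \<gamma>\<^sub>2) * (y $ k) powr (- \<gamma>\<^sub>2) * \<bar>z $ k\<bar> powr (- \<gamma>\<^sub>2)) \<and>
      s powr (2 * \<gamma>\<^sub>1) * (y $ k) powr (- \<gamma>\<^sub>1) * \<bar>z $ k\<bar> powr (- \<gamma>\<^sub>1) \<le>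
        A * m * \<Psi> ((norm (y - z))\<^sup>2 / (y $ k * \<bar>z $ k\<bar>))"
    if h: "y $ k > 0" "z $ k < 0" "norm (y - z) \<le> s" "s \<le> 2 * norm (y - z)" for y z :: "real^'n" and s
  proof -
    define N Y w where "N = norm (y - z)" and "Y = y $ k" and "w = \<bar>z $ k\<bar>"
    have pos: "Y > 0" "w > 0" using h by (auto simp: Y_def w_def)
    have N: "Y + w \<le> N"
      using foot_distance(4)[of y k z] h mult_pos_neg[of "y $ k" "z $ k"] by (simp add: Y_def w_def N_def)
    have N': "N \<le> s" "s \<le> 2 * N" using h by (auto simp: N_def)
    have sp: "s > 0" using N N' pos by linarith
    \<comment> \<open>The argument of \<open>\<Psi>\<close> is at least 4, hence in the range where the scaling bounds apply.\<close>
    have four: "4 * (Y * w) \<le> N\<^sup>2"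
      using four_mult_le_power2[OF N pos] .
    have sq: "N\<^sup>2 \<le> s\<^sup>2" using N' by (intro power_mono) (auto simp: N_def)
    have sq': "s\<^sup>2 \<le> 4 * N\<^sup>2" using power_mono[OF N'(2), of 2] sp by (simp add: power_mult_distrib)
    have Yw: "Y * w > 0" using pos by simp
    have hyp: "Y * w \<le> s\<^sup>2" "1/2 \<le> N\<^sup>2 / (Y * w)" "N\<^sup>2 / (Y * w) \<le> 16 * (1 * (s\<^sup>2 / (Y * w)))"
       "1 * (s\<^sup>2 / (Y * w)) \<le> 16 * (N\<^sup>2 / (Y * w))"
      using four sq sq' Yw by (auto simp: divide_right_mono field_simps)
    have pw: "(s\<^sup>2 / (Y * w)) powr \<gamma> = s powr (2 * \<gamma>) * Y powr (- \<gamma>) * w powr (- \<gamma>)" for \<gamma>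
    proof -
      have "(s\<^sup>2) powr \<gamma> = s powr (2 * \<gamma>)"
        using sp by (simp add: powr_powr[symmetric])
      then show ?thesis
        using sp pos by (simp add: powr_divide powr_mult powr_minus field_simps)
    qed
    have "\<Psi> (N\<^sup>2 / (Y * w)) \<le> A * ((s\<^sup>2 / (Y * w)) powr \<gamma>\<^sub>2 * \<Psi> 1)"
      using A(2)[of "Y * w" "s\<^sup>2" 1] Yw hyp by simp
    also have "\<dots> \<le> A * ((s\<^sup>2 / (Y * w)) powr \<gamma>\<^sub>2 * m)"
      using m A(1) by (intro mult_left_mono) auto
    finally have 1: "\<Psi> (N\<^sup>2 / (Y * w)) \<le> A * m * ((s\<^sup>2 / (Y * w)) powr \<gamma>\<^sub>2)"
      by (simp add: mult_ac)
    have "(s\<^sup>2 / (Y * w)) powr \<gamma>\<^sub>1 * 1 \<le> (s\<^sup>2 / (Y * w)) powr \<gamma>\<^sub>1 * (m * \<Psi> 1)"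
      using m by (intro mult_left_mono) auto
    also have "\<dots> = m * ((s\<^sup>2 / (Y * w)) powr \<gamma>\<^sub>1 * \<Psi> 1)" by simp
    also have "\<dots> \<le> m * (A * \<Psi> (N\<^sup>2 / (Y * w)))"
      using A(3)[of "Y * w" "s\<^sup>2" 1] Yw hyp m by (intro mult_left_mono) auto
    finally have 2: "(s\<^sup>2 / (Y * w)) powr \<gamma>\<^sub>1 \<le> A * m * \<Psi> (N\<^sup>2 / (Y * w))"
      by (simp add: mult_ac)
    show ?thesis
      using 1 2 unfolding pw unfolding N_def Y_def w_def by simp
  qed
  show ?thesis
  proof (rule that[of "A * m"])
    show "A * m \<ge> 1" using A(1) m(1) by (simp add: mult_ge1_I)
  qed (use * in blast)+
qed

text \<open>
  With $w = |z_k|$ and $s = w + |y - z'|$ the integrand is bounded above and below by multiples of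
  $w^{\alpha-\gamma} y_k^{-\gamma} s^{2\gamma-D}$, where $\gamma = \gamma_2$ for the upper bound and
  $\gamma = \gamma_1$ for the lower. By scaling, the integral of
  $y_k^{-\gamma} s^{2\gamma-D}$ over the upper half-space is a constant multiple of
  $w^{\gamma-\alpha}$, which cancels the factor $w^{\alpha-\gamma}$.
\<close>

lemma ret_const_bounds:
  obtains c C where "c > 0" "C > 0"
    "\<And>z::real^'n. z $ k < 0 \<Longrightarrow> c \<le> ret_const \<alpha> \<Psi> k z"
    "\<And>z::real^'n. z $ k < 0 \<Longrightarrow> ret_const \<alpha> \<Psi> k z \<le> C"
proof -
  obtain A where A: "A \<ge> 1"
    "\<And>(y::real^'n) z s. y $ k > 0 \<Longrightarrow> z $ k < 0 \<Longrightarrow> norm (y - z) \<le> s \<Longrightarrow> s \<le> 2 * norm (y - z) \<Longrightarrow>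
      \<Psi> ((norm (y - z))\<^sup>2 / (y $ k * \<bar>z $ k\<bar>)) \<le>
        A * (s powr (2 * \<gamma>\<^sub>2) * (y $ k) powr (- \<gamma>\<^sub>2) * \<bar>z $ k\<bar> powr (- \<gamma>\<^sub>2))"
    "\<And>(y::real^'n) z s. y $ k > 0 \<Longrightarrow> z $ k < 0 \<Longrightarrow> norm (y - z) \<le> s \<Longrightarrow> s \<le> 2 * norm (y - z) \<Longrightarrow>
      s powr (2 * \<gamma>\<^sub>1) * (y $ k) powr (- \<gamma>\<^sub>1) * \<bar>z $ k\<bar> powr (- \<gamma>\<^sub>1) \<le>
        A * \<Psi> ((norm (y - z))\<^sup>2 / (y $ k * \<bar>z $ k\<bar>))"
    using Psi_power_bounds by blast
  have H: "half_space k (upper_half k)" by (simp add: half_space_def)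
  have pre: "real CARD('n) + - \<gamma> < D - 2 * \<gamma>" if "\<gamma> < \<alpha>" for \<gamma>
    using that by (simp add: D_def)
  obtain K1 where K1: "K1 > 0" "\<And>p a. p $ k = 0 \<Longrightarrow> a > 0 \<Longrightarrow>
      (\<integral>\<^sup>+z\<in>upper_half k. ennreal (\<bar>z $ k\<bar> powr (- \<gamma>\<^sub>1) * (a + norm (z - p)) powr (- (D - 2 * \<gamma>\<^sub>1))) \<partial>lborel) =
      ennreal (K1 * a powr (real CARD('n) + - \<gamma>\<^sub>1 - (D - 2 * \<gamma>\<^sub>1)))"
    using half_space_power_integral[OF H, of "- \<gamma>\<^sub>1" "D - 2 * \<gamma>\<^sub>1"] pre[of \<gamma>\<^sub>1] gamma by auto
  obtain K2 where K2: "K2 > 0" "\<And>p a. p $ k = 0 \<Longrightarrow> a > 0 \<Longrightarrow>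
      (\<integral>\<^sup>+z\<in>upper_half k. ennreal (\<bar>z $ k\<bar> powr (- \<gamma>\<^sub>2) * (a + norm (z - p)) powr (- (D - 2 * \<gamma>\<^sub>2))) \<partial>lborel) =
      ennreal (K2 * a powr (real CARD('n) + - \<gamma>\<^sub>2 - (D - 2 * \<gamma>\<^sub>2)))"
    using half_space_power_integral[OF H, of "- \<gamma>\<^sub>2" "D - 2 * \<gamma>\<^sub>2"] pre[of \<gamma>\<^sub>2] gamma by auto
  have expo: "real CARD('n) + - \<gamma> - (D - 2 * \<gamma>) = \<gamma> - \<alpha>" for \<gamma>
    by (simp add: D_def)
  have bounds: "K1 / A \<le> ret_const \<alpha> \<Psi> k z \<and> ret_const \<alpha> \<Psi> k z \<le> A * 2 powr D * K2"
    if z: "z $ k < 0" for z :: "real^'n"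
  proof -
    define w where "w = \<bar>z $ k\<bar>"
    define s where "s y = w + norm (y - foot k z)" for y
    have w: "w > 0" using z by (simp add: w_def)
    have geo: "norm (y - z) \<le> s y" "s y \<le> 2 * norm (y - z)" if "y \<in> upper_half k" for y
      using foot_distance(1,2)[of z k y] z that mult_pos_neg[of "y $ k" "z $ k"]
      by (simp_all add: s_def w_def upper_half_def mult.commute norm_minus_commute)
    have sp: "s y > 0" for y using w by (simp add: s_def add_pos_nonneg)
    have [measurable]: "s \<in> borel_measurable borel" unfolding s_def by measurable
    have up: "ptilde \<alpha> \<Psi> k z y \<le> A * 2 powr D * w powr (\<alpha> - \<gamma>\<^sub>2) *
        (\<bar>y $ k\<bar> powr (- \<gamma>\<^sub>2) * s y powr (- (D - 2 * \<gamma>\<^sub>2)))" if y: "y \<in> upper_half k" for y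
    proof -
      have y': "y $ k > 0" using y by (simp add: upper_half_def)
      have "ptilde \<alpha> \<Psi> k z y = w powr \<alpha> * \<Psi> ((norm (y - z))\<^sup>2 / (y $ k * \<bar>z $ k\<bar>)) * norm (y - z) powr (- D)"
        by (simp add: ptilde_def exponent w_def)
      also have "\<dots> \<le> w powr \<alpha> * (A * (s y powr (2 * \<gamma>\<^sub>2) * (y $ k) powr (- \<gamma>\<^sub>2) * \<bar>z $ k\<bar> powr (- \<gamma>\<^sub>2))) *
          (2 powr D * s y powr (- D))"
        using A(2)[OF y' z geo[OF y]] powr_neg_le[OF sp geo(2)[OF y]] D_bounds A(1)
        by (intro mult_mono) auto
      also have "\<dots> = A * 2 powr D * (w powr \<alpha> * w powr (- \<gamma>\<^sub>2)) * (\<bar>y $ k\<bar> powr (- \<gamma>\<^sub>2) * (s y powr (2 * \<gamma>\<^sub>2) * s y powr (- D)))"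
        using y' by (simp add: w_def mult_ac)
      also have "w powr \<alpha> * w powr (- \<gamma>\<^sub>2) = w powr (\<alpha> - \<gamma>\<^sub>2)"
        by (simp add: powr_add[symmetric])
      also have "s y powr (2 * \<gamma>\<^sub>2) * s y powr (- D) = s y powr (- (D - 2 * \<gamma>\<^sub>2))"
        by (simp add: powr_add[symmetric])
      finally show ?thesis .
    qed
    have lo: "\<bar>y $ k\<bar> powr (- \<gamma>\<^sub>1) * s y powr (- (D - 2 * \<gamma>\<^sub>1)) \<le> A * w powr (\<gamma>\<^sub>1 - \<alpha>) * ptilde \<alpha> \<Psi> k z y"
      if y: "y \<in> upper_half k" for y
    proof -
      have y': "y $ k > 0" using y by (simp add: upper_half_def)
      have Np: "norm (y - z) > 0" using y' z by auto
      have "\<bar>y $ k\<bar> powr (- \<gamma>\<^sub>1) * s y powr (- (D - 2 * \<gamma>\<^sub>1)) =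
         w powr \<gamma>\<^sub>1 * (s y powr (2 * \<gamma>\<^sub>1) * (y $ k) powr (- \<gamma>\<^sub>1) * \<bar>z $ k\<bar> powr (- \<gamma>\<^sub>1)) * s y powr (- D)"
      proof -
        have "w powr \<gamma>\<^sub>1 * \<bar>z $ k\<bar> powr (- \<gamma>\<^sub>1) = 1"
          using w by (simp add: w_def powr_minus)
        moreover have "s y powr (- (D - 2 * \<gamma>\<^sub>1)) = s y powr (2 * \<gamma>\<^sub>1) * s y powr (- D)"
          by (simp add: powr_add[symmetric])
        ultimately show ?thesis using y' by (simp add: mult_ac)
      qed
      also have "\<dots> \<le> w powr \<gamma>\<^sub>1 * (A * \<Psi> ((norm (y - z))\<^sup>2 / (y $ k * \<bar>z $ k\<bar>))) * norm (y - z) powr (- D)"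
        using A(3)[OF y' z geo[OF y]] geo(1)[OF y] Np D_bounds A(1)
        by (intro mult_mono[OF mult_left_mono] powr_mono2') auto
      also have "\<dots> = A * (w powr (\<gamma>\<^sub>1 - \<alpha>)) * ptilde \<alpha> \<Psi> k z y"
      proof -
        have "w powr \<gamma>\<^sub>1 = w powr (\<gamma>\<^sub>1 - \<alpha>) * w powr \<alpha>"
          by (simp add: powr_add[symmetric])
        then show ?thesis by (simp add: ptilde_def exponent w_def)
      qed
      finally show ?thesis .
    qed
    have "(\<integral>\<^sup>+y\<in>upper_half k. ennreal (ptilde \<alpha> \<Psi> k z y) \<partial>lborel) \<le>
        ennreal (A * 2 powr D * w powr (\<alpha> - \<gamma>\<^sub>2)) * (\<integral>\<^sup>+y\<in>upper_half k. ennreal (\<bar>y $ k\<bar> powr (- \<gamma>\<^sub>2) * s y powr (- (D - 2 * \<gamma>\<^sub>2))) \<partial>lborel)"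
      using up A(1) by (intro nn_integral_set_le_scaled) simp_all
    also have "(\<integral>\<^sup>+y\<in>upper_half k. ennreal (\<bar>y $ k\<bar> powr (- \<gamma>\<^sub>2) * s y powr (- (D - 2 * \<gamma>\<^sub>2))) \<partial>lborel) = ennreal (K2 * w powr (\<gamma>\<^sub>2 - \<alpha>))"
      unfolding s_def by (rule K2(2)[OF foot_nth w, of z, unfolded expo])
    also have "ennreal (A * 2 powr D * w powr (\<alpha> - \<gamma>\<^sub>2)) * \<dots> =
        ennreal (A * 2 powr D * K2 * (w powr (\<alpha> - \<gamma>\<^sub>2) * w powr (\<gamma>\<^sub>2 - \<alpha>)))"
      using A(1) K2(1) by (simp add: ennreal_mult[symmetric] mult_ac)
    also have "w powr (\<alpha> - \<gamma>\<^sub>2) * w powr (\<gamma>\<^sub>2 - \<alpha>) = 1"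
      using w by (simp add: powr_add[symmetric])
    finally have U: "(\<integral>\<^sup>+y\<in>upper_half k. ennreal (ptilde \<alpha> \<Psi> k z y) \<partial>lborel) \<le> ennreal (A * 2 powr D * K2)"
      by simp
    have [measurable]: "ptilde \<alpha> \<Psi> k z \<in> borel_measurable borel"
      unfolding ptilde_def by measurable
    have "ennreal (K1 * w powr (\<gamma>\<^sub>1 - \<alpha>)) = (\<integral>\<^sup>+y\<in>upper_half k. ennreal (\<bar>y $ k\<bar> powr (- \<gamma>\<^sub>1) * s y powr (- (D - 2 * \<gamma>\<^sub>1))) \<partial>lborel)"
      unfolding s_def by (rule K1(2)[OF foot_nth w, of z, unfolded expo, symmetric])
    also have "\<dots> \<le> ennreal (A * w powr (\<gamma>\<^sub>1 - \<alpha>)) *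
       (\<integral>\<^sup>+y\<in>upper_half k. ennreal (ptilde \<alpha> \<Psi> k z y) \<partial>lborel)"
      using lo A(1) by (intro nn_integral_set_le_scaled) simp_all
    finally have "ennreal (K1 * w powr (\<gamma>\<^sub>1 - \<alpha>) / (A * w powr (\<gamma>\<^sub>1 - \<alpha>))) \<le>
       (\<integral>\<^sup>+y\<in>upper_half k. ennreal (ptilde \<alpha> \<Psi> k z y) \<partial>lborel)"
      using A(1) w by (intro ennreal_div_le_cancel) auto
    then have L: "ennreal (K1 / A) \<le> (\<integral>\<^sup>+y\<in>upper_half k. ennreal (ptilde \<alpha> \<Psi> k z y) \<partial>lborel)"
      using w by simp
    show ?thesis
      unfolding ret_const_def
    proof (intro conjI)
      have nonneg: "ptilde \<alpha> \<Psi> k z y \<ge> 0" for y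
        by (simp add: ptilde_def)
      show "K1 / A \<le> (LINT y:upper_half k|lborel. ptilde \<alpha> \<Psi> k z y)"
        "(LINT y:upper_half k|lborel. ptilde \<alpha> \<Psi> k z y) \<le> A * 2 powr D * K2"
        using A(1) K2(1) nonneg by (intro set_lebesgue_integral_between[OF _ _ L U]; simp)+
    qed
  qed
  show ?thesis
    by (rule that[of "K1 / A" "A * 2 powr D * K2"]) (use A(1) K1(1) K2(1) bounds in auto)
qed

lemma stable_const_pos: "stable_const (real CARD('n)) \<alpha> > 0"
proof -
  have "- \<alpha> / 2 \<notin> \<int>\<^sub>\<le>\<^sub>0"
  proof
    assume "- \<alpha> / 2 \<in> \<int>\<^sub>\<le>\<^sub>0"
    then obtain n :: nat where "- \<alpha> / 2 = - of_nat n"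
      by (rule nonpos_Ints_cases')
    then have "real n > 0" "real n < 1" using alpha by auto
    then show False by simp
  qed
  then have "Gamma (- \<alpha> / 2) \<noteq> 0"
    by (simp add: Gamma_eq_zero_iff)
  moreover have "Gamma ((real CARD('n) + \<alpha>) / 2) > 0"
    using alpha by (intro Gamma_real_pos) (simp add: add_nonneg_pos)
  ultimately show ?thesis
    by (simp add: stable_const_def)
qed

text \<open>
  The integrand of $q$ without the factors that are bounded above and below by positive constants.
\<close>

definition kern :: "real ^ 'n \<Rightarrow> real ^ 'n \<Rightarrow> real ^ 'n \<Rightarrow> real" where
  "kern x y z = \<Psi> ((norm (y - z))\<^sup>2 / (y $ k * \<bar>z $ k\<bar>)) * \<bar>z $ k\<bar> powr \<alpha>
     * norm (x - z) powr (- D) * norm (y - z) powr (- D)"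

definition kern_integral :: "real ^ 'n \<Rightarrow> real ^ 'n \<Rightarrow> ennreal" where
  "kern_integral x y = (\<integral>\<^sup>+z\<in>lower_half k. ennreal (kern x y z) \<partial>lborel)"

lemma kern_nonneg[simp]: "kern x y z \<ge> 0"
  by (simp add: kern_def)

lemma kern_measurable[measurable]: "kern x y \<in> borel_measurable borel"
  unfolding kern_def by measurable

lemma qker_comparable_kern_integral:
  obtains c where "c \<ge> 1"
    "\<And>x y a b. 0 \<le> b \<Longrightarrow> ennreal a \<le> kern_integral x y \<Longrightarrow> kern_integral x y \<le> ennreal b \<Longrightarrow>
        a \<le> c * qker \<alpha> \<Psi> k x y"
    "\<And>x y a b. 0 \<le> b \<Longrightarrow> kern_integral x y \<le> ennreal b \<Longrightarrow> qker \<alpha> \<Psi> k x y \<le> c * b"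
proof -
  obtain r R where r: "r > 0" "R > 0" "\<And>z::real^'n. z $ k < 0 \<Longrightarrow> r \<le> ret_const \<alpha> \<Psi> k z"
     "\<And>z::real^'n. z $ k < 0 \<Longrightarrow> ret_const \<alpha> \<Psi> k z \<le> R"
    using ret_const_bounds by blast
  define S where "S = stable_const (real CARD('n)) \<alpha>"
  have S: "S > 0" using stable_const_pos by (simp add: S_def)
  define c where "c = max 1 (max (S / r) (R / S))"
  have c: "c \<ge> 1" "S / r \<le> c" "R / S \<le> c" by (auto simp: c_def)
  define f where "f x y z = jker \<alpha> x z * return_kernel \<alpha> \<Psi> k z y" for x y z :: "real^'n"
  have feq: "f x y z = S / ret_const \<alpha> \<Psi> k z * kern x y z" for x y z
    by (simp add: f_def jker_def return_kernel_def ptilde_def kern_def S_def exponent divide_inverse mult_ac)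
  have retm[measurable]: "ret_const \<alpha> \<Psi> k \<in> borel_measurable borel"
  proof -
    have "(\<lambda>(z, y). indicator (upper_half k) y *\<^sub>R ptilde \<alpha> \<Psi> k z y) \<in>
        borel_measurable (borel \<Otimes>\<^sub>M borel)"
      unfolding ptilde_def by measurable
    then have [measurable]: "(\<lambda>(z, y). indicator (upper_half k) y *\<^sub>R ptilde \<alpha> \<Psi> k z y) \<in>
        borel_measurable (borel \<Otimes>\<^sub>M lborel)"
      by (simp cong: measurable_cong_sets sets_pair_measure_cong)
    show ?thesis
      unfolding ret_const_def set_lebesgue_integral_def by measurable
  qed
  have up: "f x y z \<le> c * kern x y z" if "z \<in> lower_half k" for x y z
  proof -
    have "z $ k < 0" using that by (simp add: lower_half_def)
    then have "S / ret_const \<alpha> \<Psi> k z \<le> S / r"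
      using r S by (intro divide_left_mono) (auto intro: mult_pos_pos less_le_trans)
    then show ?thesis unfolding feq using c by (intro mult_right_mono) auto
  qed
  have lo: "kern x y z \<le> c * f x y z" "0 \<le> f x y z" if "z \<in> lower_half k" for x y z
  proof -
    have z: "z $ k < 0" using that by (simp add: lower_half_def)
    have p: "ret_const \<alpha> \<Psi> k z > 0" using r(1) r(3)[OF z] by linarith
    have "ret_const \<alpha> \<Psi> k z / S \<le> R / S"
      using r(4)[OF z] S by (intro divide_right_mono) auto
    then have "1 \<le> c * (S / ret_const \<alpha> \<Psi> k z)"
      using c p S by (simp add: field_simps)
    then have "1 * kern x y z \<le> c * (S / ret_const \<alpha> \<Psi> k z) * kern x y z"
      by (intro mult_right_mono) simp_all
    then show "kern x y z \<le> c * f x y z"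
      unfolding feq by (simp only: mult_1 mult.assoc)
    show "0 \<le> f x y z" unfolding feq using S p by simp
  qed
  have fm[measurable]: "f x y \<in> borel_measurable borel" for x y
    unfolding feq by measurable
  have F: "kern_integral x y \<le> ennreal c * (\<integral>\<^sup>+z\<in>lower_half k. ennreal (f x y z) \<partial>lborel)"
    "(\<integral>\<^sup>+z\<in>lower_half k. ennreal (f x y z) \<partial>lborel) \<le> ennreal c * kern_integral x y" for x y
    unfolding kern_integral_def using c up lo by (intro nn_integral_set_le_scaled; simp)+
  have qf: "qker \<alpha> \<Psi> k x y = (LINT z:lower_half k|lborel. f x y z)" for x y
    by (simp add: qker_def f_def)
  have *: "a / c \<le> qker \<alpha> \<Psi> k x y \<and> qker \<alpha> \<Psi> k x y \<le> c * b"
    if h: "0 \<le> b" "ennreal a \<le> kern_integral x y" "kern_integral x y \<le> ennreal b" for x y a b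
  proof -
    have "ennreal a \<le> ennreal c * (\<integral>\<^sup>+z\<in>lower_half k. ennreal (f x y z) \<partial>lborel)"
      using h(2) F(1) by (rule order_trans)
    then have L: "ennreal (a / c) \<le> (\<integral>\<^sup>+z\<in>lower_half k. ennreal (f x y z) \<partial>lborel)"
      using c by (intro ennreal_div_le_cancel) auto
    have "ennreal c * kern_integral x y \<le> ennreal c * ennreal b"
      using h(3) by (rule mult_left_mono) simp
    then have U: "(\<integral>\<^sup>+z\<in>lower_half k. ennreal (f x y z) \<partial>lborel) \<le> ennreal (c * b)"
      using F(2)[of x y] c by (simp add: ennreal_mult' order_trans)
    show ?thesis
      unfolding qf using set_lebesgue_integral_between[OF _ _ L U] lo(2) h(1) c by auto
  qed
  show ?thesis
  proof (rule that[OF c(1)])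
    show "a \<le> c * qker \<alpha> \<Psi> k x y"
      if "0 \<le> b" "ennreal a \<le> kern_integral x y" "kern_integral x y \<le> ennreal b" for x y a b
      using *[OF that] c(1) by (simp add: field_simps)
    show "qker \<alpha> \<Psi> k x y \<le> c * b" if "0 \<le> b" "kern_integral x y \<le> ennreal b" for x y b
      using *[OF that(1) _ that(2), of 0] by simp
  qed
qed

section \<open>Pairs that are close compared with their distance to the boundary\<close>

text \<open>
  For a near pair, $|x - y| < x_k$ makes $|x - z|$ and $|y - z|$ comparable, so that $s = y_k + |z - y'|$
  is the only distance that occurs.
\<close>

lemma near_kern_integral:
  obtains C where "C \<ge> 1"
    "\<And>x y. x $ k > 0 \<Longrightarrow> y $ k > 0 \<Longrightarrow> norm (x - y) < x $ k \<Longrightarrow> norm (x - y) < y $ k \<Longrightarrow>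
       ennreal ((y $ k) powr (- D) / C) \<le> kern_integral x y"
    "\<And>x y. x $ k > 0 \<Longrightarrow> y $ k > 0 \<Longrightarrow> norm (x - y) < x $ k \<Longrightarrow> norm (x - y) < y $ k \<Longrightarrow>
       kern_integral x y \<le> ennreal (C * (y $ k) powr (- D))"
proof -
  obtain A where A: "A \<ge> 1"
    "\<And>(y::real^'n) z s. y $ k > 0 \<Longrightarrow> z $ k < 0 \<Longrightarrow> norm (y - z) \<le> s \<Longrightarrow> s \<le> 2 * norm (y - z) \<Longrightarrow>
      \<Psi> ((norm (y - z))\<^sup>2 / (y $ k * \<bar>z $ k\<bar>)) \<le>
        A * (s powr (2 * \<gamma>\<^sub>2) * (y $ k) powr (- \<gamma>\<^sub>2) * \<bar>z $ k\<bar> powr (- \<gamma>\<^sub>2))"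
    "\<And>(y::real^'n) z s. y $ k > 0 \<Longrightarrow> z $ k < 0 \<Longrightarrow> norm (y - z) \<le> s \<Longrightarrow> s \<le> 2 * norm (y - z) \<Longrightarrow>
      s powr (2 * \<gamma>\<^sub>1) * (y $ k) powr (- \<gamma>\<^sub>1) * \<bar>z $ k\<bar> powr (- \<gamma>\<^sub>1) \<le>
        A * \<Psi> ((norm (y - z))\<^sup>2 / (y $ k * \<bar>z $ k\<bar>))"
    using Psi_power_bounds by blast
  have H: "half_space k (lower_half k)" by (simp add: half_space_def)
  have pre: "real CARD('n) + (\<alpha> - \<gamma>) < 2 * D - 2 * \<gamma>" "\<alpha> - \<gamma> > -1" if "\<gamma> < \<alpha>" for \<gamma>
    using that D_bounds alpha by (auto simp: D_def)
  obtain K1 where K1: "K1 > 0" "\<And>p a. p $ k = 0 \<Longrightarrow> a > 0 \<Longrightarrow>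
      (\<integral>\<^sup>+z\<in>lower_half k. ennreal (\<bar>z $ k\<bar> powr (\<alpha> - \<gamma>\<^sub>1) * (a + norm (z - p)) powr (- (2 * D - 2 * \<gamma>\<^sub>1))) \<partial>lborel) =
      ennreal (K1 * a powr (real CARD('n) + (\<alpha> - \<gamma>\<^sub>1) - (2 * D - 2 * \<gamma>\<^sub>1)))"
    using half_space_power_integral[OF H, of "\<alpha> - \<gamma>\<^sub>1" "2 * D - 2 * \<gamma>\<^sub>1"] pre[of \<gamma>\<^sub>1] gamma by auto
  obtain K2 where K2: "K2 > 0" "\<And>p a. p $ k = 0 \<Longrightarrow> a > 0 \<Longrightarrow>
      (\<integral>\<^sup>+z\<in>lower_half k. ennreal (\<bar>z $ k\<bar> powr (\<alpha> - \<gamma>\<^sub>2) * (a + norm (z - p)) powr (- (2 * D - 2 * \<gamma>\<^sub>2))) \<partial>lborel) =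
      ennreal (K2 * a powr (real CARD('n) + (\<alpha> - \<gamma>\<^sub>2) - (2 * D - 2 * \<gamma>\<^sub>2)))"
    using half_space_power_integral[OF H, of "\<alpha> - \<gamma>\<^sub>2" "2 * D - 2 * \<gamma>\<^sub>2"] pre[of \<gamma>\<^sub>2] gamma by auto
  have expo: "real CARD('n) + (\<alpha> - \<gamma>) - (2 * D - 2 * \<gamma>) = \<gamma> - D" for \<gamma>
    by (simp add: D_def)
  define C where "C = max 1 (max (A * 2 powr D / K1) (A * 8 powr D * K2))"
  have C: "C \<ge> 1" "A * 2 powr D / K1 \<le> C" "A * 8 powr D * K2 \<le> C"
    by (auto simp: C_def)
  have *: "ennreal ((y $ k) powr (- D) / C) \<le> kern_integral x y \<and>
      kern_integral x y \<le> ennreal (C * (y $ k) powr (- D))"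
    if h: "x $ k > 0" "y $ k > 0" "norm (x - y) < x $ k" "norm (x - y) < y $ k" for x y
  proof -
    define Y where "Y = y $ k"
    define s where "s z = Y + norm (z - foot k y)" for z
    have Y: "Y > 0" using h by (simp add: Y_def)
    have sp: "s z > 0" for z using Y by (simp add: s_def add_pos_nonneg)
    have [measurable]: "s \<in> borel_measurable borel" unfolding s_def by measurable
    have geo: "norm (y - z) \<le> s z" "s z \<le> 2 * norm (y - z)" "s z \<le> 4 * norm (x - z)"
       "norm (x - z) \<le> 2 * s z" "norm (x - z) > 0" "norm (y - z) > 0" if "z \<in> lower_half k" for z
    proof -
      have z: "z $ k < 0" using that by (simp add: lower_half_def)
      have p: "x $ k * z $ k \<le> 0" "y $ k * z $ k \<le> 0"
        using h z by (auto simp: mult_le_0_iff)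
      note f = foot_distance(1,2,4)[OF p(2)] foot_distance(4)[OF p(1)]
      show 1: "norm (y - z) \<le> s z" "s z \<le> 2 * norm (y - z)"
        using f h by (auto simp: s_def Y_def)
      have "norm (y - z) \<le> norm (x - y) + norm (x - z)"
        using norm_triangle_ineq4[of "x - z" "x - y"] by simp
      then show "s z \<le> 4 * norm (x - z)" using 1 f h by linarith
      have "norm (x - z) \<le> norm (x - y) + norm (y - z)"
        using norm_triangle_ineq[of "x - y" "y - z"] by simp
      then show "norm (x - z) \<le> 2 * s z" using 1 f h by linarith
      show "norm (x - z) > 0" "norm (y - z) > 0" using h z by auto
    qed
    have up: "kern x y z \<le> A * 8 powr D * Y powr (- \<gamma>\<^sub>2) *
        (\<bar>z $ k\<bar> powr (\<alpha> - \<gamma>\<^sub>2) * s z powr (- (2 * D - 2 * \<gamma>\<^sub>2)))" if z: "z \<in> lower_half k" for z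
    proof -
      have z': "z $ k < 0" using z by (simp add: lower_half_def)
      have "kern x y z \<le> A * (s z powr (2 * \<gamma>\<^sub>2) * Y powr (- \<gamma>\<^sub>2) * \<bar>z $ k\<bar> powr (- \<gamma>\<^sub>2)) * \<bar>z $ k\<bar> powr \<alpha>
         * (4 powr D * s z powr (- D)) * (2 powr D * s z powr (- D))"
        unfolding kern_def
        using A(2)[OF h(2) z' geo(1,2)[OF z]] powr_neg_le[OF sp geo(2)[OF z]] powr_neg_le[OF sp geo(3)[OF z]] D_bounds A(1)
        by (intro mult_mono) (auto simp: Y_def)
      also have "\<dots> = A * (4 powr D * 2 powr D) * Y powr (- \<gamma>\<^sub>2) * ((\<bar>z $ k\<bar> powr \<alpha> * \<bar>z $ k\<bar> powr (- \<gamma>\<^sub>2)) *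
          (s z powr (2 * \<gamma>\<^sub>2) * s z powr (- D) * s z powr (- D)))"
        by (simp add: mult_ac)
      also have "4 powr D * 2 powr D = (8::real) powr D"
        by (simp add: powr_mult[symmetric])
      also have "\<bar>z $ k\<bar> powr \<alpha> * \<bar>z $ k\<bar> powr (- \<gamma>\<^sub>2) = \<bar>z $ k\<bar> powr (\<alpha> - \<gamma>\<^sub>2)"
        by (simp add: powr_add[symmetric])
      also have "s z powr (2 * \<gamma>\<^sub>2) * s z powr (- D) * s z powr (- D) = s z powr (- (2 * D - 2 * \<gamma>\<^sub>2))"
        by (simp add: powr_add[symmetric] algebra_simps)
      finally show ?thesis .
    qed
    have lo: "\<bar>z $ k\<bar> powr (\<alpha> - \<gamma>\<^sub>1) * s z powr (- (2 * D - 2 * \<gamma>\<^sub>1)) \<le> A * 2 powr D * Y powr \<gamma>\<^sub>1 * kern x y z"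
      if z: "z \<in> lower_half k" for z
    proof -
      have z': "z $ k < 0" using z by (simp add: lower_half_def)
      have YY: "Y powr \<gamma>\<^sub>1 * Y powr (- \<gamma>\<^sub>1) = 1"
        using Y by (simp add: powr_minus)
      have "\<bar>z $ k\<bar> powr (\<alpha> - \<gamma>\<^sub>1) = \<bar>z $ k\<bar> powr \<alpha> * \<bar>z $ k\<bar> powr (- \<gamma>\<^sub>1)"
        by (simp add: powr_add[symmetric])
      moreover have "s z powr (- (2 * D - 2 * \<gamma>\<^sub>1)) = s z powr (2 * \<gamma>\<^sub>1) * s z powr (- D) * s z powr (- D)"
        by (simp add: powr_add[symmetric] algebra_simps)
      ultimately have "\<bar>z $ k\<bar> powr (\<alpha> - \<gamma>\<^sub>1) * s z powr (- (2 * D - 2 * \<gamma>\<^sub>1)) =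
         (Y powr \<gamma>\<^sub>1 * Y powr (- \<gamma>\<^sub>1)) * (\<bar>z $ k\<bar> powr \<alpha> * \<bar>z $ k\<bar> powr (- \<gamma>\<^sub>1) * (s z powr (2 * \<gamma>\<^sub>1) * s z powr (- D) * s z powr (- D)))"
        using YY by simp
      also have "\<dots> = Y powr \<gamma>\<^sub>1 * ((s z powr (2 * \<gamma>\<^sub>1) * Y powr (- \<gamma>\<^sub>1) * \<bar>z $ k\<bar> powr (- \<gamma>\<^sub>1)) * \<bar>z $ k\<bar> powr \<alpha> *
          s z powr (- D) * s z powr (- D))"
        by (simp only: mult_ac)
      also have "\<dots> \<le> Y powr \<gamma>\<^sub>1 * ((A * \<Psi> ((norm (y - z))\<^sup>2 / (y $ k * \<bar>z $ k\<bar>))) * \<bar>z $ k\<bar> powr \<alpha> *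
          (2 powr D * norm (x - z) powr (- D)) * norm (y - z) powr (- D))"
        using A(3)[OF h(2) z' geo(1,2)[OF z]] powr_neg_le[OF geo(5)[OF z] geo(4)[OF z]] D_bounds A(1) geo(1,6)[OF z]
        by (intro mult_left_mono[OF mult_mono[OF mult_mono[OF mult_right_mono]]] powr_mono2')
           (auto simp: Y_def)
      also have "\<dots> = A * 2 powr D * Y powr \<gamma>\<^sub>1 * kern x y z"
        by (simp add: kern_def mult_ac)
      finally show ?thesis .
    qed
    have "kern_integral x y \<le> ennreal (A * 8 powr D * Y powr (- \<gamma>\<^sub>2)) *
        (\<integral>\<^sup>+z\<in>lower_half k. ennreal (\<bar>z $ k\<bar> powr (\<alpha> - \<gamma>\<^sub>2) * s z powr (- (2 * D - 2 * \<gamma>\<^sub>2))) \<partial>lborel)"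
      unfolding kern_integral_def using up A(1) by (intro nn_integral_set_le_scaled) simp_all
    also have "(\<integral>\<^sup>+z\<in>lower_half k. ennreal (\<bar>z $ k\<bar> powr (\<alpha> - \<gamma>\<^sub>2) * s z powr (- (2 * D - 2 * \<gamma>\<^sub>2))) \<partial>lborel) = ennreal (K2 * Y powr (\<gamma>\<^sub>2 - D))"
      unfolding s_def by (rule K2(2)[OF foot_nth Y, of y, unfolded expo])
    also have "ennreal (A * 8 powr D * Y powr (- \<gamma>\<^sub>2)) * \<dots> = ennreal (A * 8 powr D * K2 * (Y powr (- \<gamma>\<^sub>2) * Y powr (\<gamma>\<^sub>2 - D)))"
      using A(1) K2(1) by (simp add: ennreal_mult[symmetric] mult_ac)
    also have "Y powr (- \<gamma>\<^sub>2) * Y powr (\<gamma>\<^sub>2 - D) = Y powr (- D)"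
      by (simp add: powr_add[symmetric])
    also have "ennreal (A * 8 powr D * K2 * Y powr (- D)) \<le> ennreal (C * Y powr (- D))"
      using C by (intro ennreal_leI mult_right_mono) auto
    finally have U: "kern_integral x y \<le> ennreal (C * Y powr (- D))" .
    have "ennreal (K1 * Y powr (\<gamma>\<^sub>1 - D)) = (\<integral>\<^sup>+z\<in>lower_half k. ennreal (\<bar>z $ k\<bar> powr (\<alpha> - \<gamma>\<^sub>1) * s z powr (- (2 * D - 2 * \<gamma>\<^sub>1))) \<partial>lborel)"
      unfolding s_def by (rule K1(2)[OF foot_nth Y, of y, unfolded expo, symmetric])
    also have "\<dots> \<le> ennreal (A * 2 powr D * Y powr \<gamma>\<^sub>1) * kern_integral x y"
      unfolding kern_integral_def using lo A(1) by (intro nn_integral_set_le_scaled) simp_all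
    finally have "ennreal (K1 * Y powr (\<gamma>\<^sub>1 - D) / (A * 2 powr D * Y powr \<gamma>\<^sub>1)) \<le> kern_integral x y"
      using A(1) Y by (intro ennreal_div_le_cancel) auto
    moreover have "Y powr (- D) / C \<le> K1 * Y powr (\<gamma>\<^sub>1 - D) / (A * 2 powr D * Y powr \<gamma>\<^sub>1)"
    proof -
      have "1 / C \<le> K1 / (A * 2 powr D)"
        using C(1,2) K1(1) A(1) by (simp add: field_simps)
      then have "Y powr (- D) * (1 / C) \<le> Y powr (- D) * (K1 / (A * 2 powr D))"
        by (intro mult_left_mono) auto
      also have "\<dots> = K1 * Y powr (\<gamma>\<^sub>1 - D) / (A * 2 powr D * Y powr \<gamma>\<^sub>1)"
        using Y by (simp add: powr_diff powr_minus divide_inverse mult_ac)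
      finally show ?thesis by simp
    qed
    ultimately have "ennreal (Y powr (- D) / C) \<le> kern_integral x y"
      by (meson ennreal_leI order_trans)
    with U show ?thesis by (simp add: Y_def)
  qed
  show ?thesis
    by (rule that[OF C(1)]) (use * in blast)+
qed

section \<open>Pairs that are far apart compared with their distance to the boundary\<close>

text \<open>
  The common shape of the bounds for \<open>kern\<close>: a power of the depth times a function of the radial
  variable $s$ around the foot of $x$. The factor $s^{\gamma-D}$ is split off so that integration in
  polar coordinates turns $h$ into an integral of $h(s)/s$.
\<close>

definition radial_kern :: "real \<Rightarrow> (real \<Rightarrow> real) \<Rightarrow> real ^ 'n \<Rightarrow> real ^ 'n \<Rightarrow> real" where
  "radial_kern \<gamma> h x z = (let s = x $ k + norm (z - foot k x) in
     \<bar>z $ k\<bar> powr (\<alpha> - \<gamma>) * (s powr (\<gamma> - D) * h s))"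

lemma radial_kern_measurable[measurable]:
  assumes [measurable]: "h \<in> borel_measurable borel"
  shows "radial_kern \<gamma> h x \<in> borel_measurable borel"
  unfolding radial_kern_def Let_def by measurable

lemma radial_kern_nonneg: "(\<And>s. 0 \<le> h s) \<Longrightarrow> 0 \<le> radial_kern \<gamma> h x z"
  by (simp add: radial_kern_def Let_def)

text \<open>
  The polar density is $(s-a)^{D-\gamma-1}$. It is at most $s^{D-\gamma-1}$, and comparable to it when
  $s \ge 2a$, so that together with $s^{\gamma-D}$ it leaves $1/s$. The exponent $\gamma$ disappears: this
  is why the upper and the lower index lead to the same integral.
\<close>

lemma lower_half_log_integral:
  assumes \<gamma>: "D - \<gamma> > 1" "\<gamma> < \<alpha>"
  obtains \<kappa> where "\<kappa> > 0"
    "\<And>x h. x $ k > 0 \<Longrightarrow> h \<in> borel_measurable borel \<Longrightarrow> (\<forall>s. 0 \<le> h s) \<Longrightarrow>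
      (\<integral>\<^sup>+z\<in>lower_half k. ennreal (radial_kern \<gamma> h x z) \<partial>lborel) \<le>
      ennreal \<kappa> * (\<integral>\<^sup>+s\<in>{x $ k..}. ennreal (h s / s) \<partial>lborel)"
    "\<And>x h. x $ k > 0 \<Longrightarrow> h \<in> borel_measurable borel \<Longrightarrow> (\<forall>s. 0 \<le> h s) \<Longrightarrow>
      (\<integral>\<^sup>+s\<in>{2 * x $ k..}. ennreal (h s / s) \<partial>lborel) \<le>
      ennreal \<kappa> * (\<integral>\<^sup>+z\<in>lower_half k. ennreal (radial_kern \<gamma> h x z) \<partial>lborel)"
proof -
  define e where "e = D - \<gamma> - 1"
  have e: "e > 0" using \<gamma> by (simp add: e_def)
  have H: "half_space k (lower_half k)" by (simp add: half_space_def)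
  have "\<alpha> - \<gamma> > -1" using \<gamma> by simp
  have ee: "real CARD('n) + (\<alpha> - \<gamma>) - 1 = e" by (simp add: e_def D_def)
  obtain \<kappa> where \<kappa>: "\<kappa> > 0"
    "\<And>p a g. p $ k = 0 \<Longrightarrow> g \<in> borel_measurable borel \<Longrightarrow>
      (\<integral>\<^sup>+z\<in>lower_half k. ennreal (\<bar>z $ k\<bar> powr (\<alpha> - \<gamma>)) * g (a + norm (z - p)) \<partial>lborel) =
      ennreal \<kappa> * (\<integral>\<^sup>+s\<in>{a<..}. ennreal ((s - a) powr e) * g s \<partial>lborel)"
    using half_space_radial_integral[OF H \<open>\<alpha> - \<gamma> > -1\<close>, unfolded ee] by blast
  define \<kappa>' where "\<kappa>' = max \<kappa> (2 powr e / \<kappa>)"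
  have \<kappa>': "\<kappa> \<le> \<kappa>'" "2 powr e / \<kappa> \<le> \<kappa>'" "\<kappa>' > 0"
    using \<kappa>(1) by (auto simp: \<kappa>'_def less_max_iff_disj)
  have eq: "(\<integral>\<^sup>+z\<in>lower_half k. ennreal (radial_kern \<gamma> h x z) \<partial>lborel) =
     ennreal \<kappa> * (\<integral>\<^sup>+s\<in>{x $ k<..}. ennreal ((s - x $ k) powr e * (s powr (\<gamma> - D) * h s)) \<partial>lborel)"
    if "h \<in> borel_measurable borel" for x and h :: "real \<Rightarrow> real"
    using \<kappa>(2)[OF foot_nth, of "\<lambda>s. ennreal (s powr (\<gamma> - D) * h s)" "x $ k" x] that
    by (simp add: ennreal_mult' radial_kern_def Let_def)
  have pw: "s powr e * s powr (\<gamma> - D) = 1 / s" if "s > 0" for s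
    using that by (simp add: powr_add[symmetric] e_def powr_minus_divide)
  show ?thesis
  proof (rule that[OF \<kappa>'(3)])
    fix x :: "real ^ 'n" and h :: "real \<Rightarrow> real"
    assume x: "x $ k > 0" and h[measurable]: "h \<in> borel_measurable borel" and h_nonneg: "\<forall>s. 0 \<le> h s"
    define a where "a = x $ k"
    have a: "a > 0" using x by (simp add: a_def)
    have "(\<integral>\<^sup>+s\<in>{a<..}. ennreal ((s - a) powr e * (s powr (\<gamma> - D) * h s)) \<partial>lborel) \<le>
      (\<integral>\<^sup>+s\<in>{a..}. ennreal (h s / s) \<partial>lborel)"
    proof (intro nn_integral_mono)
      fix s :: real
      show "ennreal ((s - a) powr e * (s powr (\<gamma> - D) * h s)) * indicator {a<..} s \<le>
        ennreal (h s / s) * indicator {a..} s"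
      proof (cases "a < s")
        case True
        have "(s - a) powr e * (s powr (\<gamma> - D) * h s) \<le> s powr e * (s powr (\<gamma> - D) * h s)"
          using True a e h_nonneg by (intro mult_right_mono powr_mono2) auto
        also have "\<dots> = h s / s"
          using pw[of s] True a by (simp add: mult.assoc[symmetric])
        finally show ?thesis using True by (simp add: ennreal_leI)
      qed simp
    qed
    then have "ennreal \<kappa> * (\<integral>\<^sup>+s\<in>{a<..}. ennreal ((s - a) powr e * (s powr (\<gamma> - D) * h s)) \<partial>lborel) \<le>
      ennreal \<kappa>' * (\<integral>\<^sup>+s\<in>{a..}. ennreal (h s / s) \<partial>lborel)"
      using \<kappa>' by (intro mult_mono ennreal_leI) auto
    then show "(\<integral>\<^sup>+z\<in>lower_half k. ennreal (radial_kern \<gamma> h x z) \<partial>lborel) \<le>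
      ennreal \<kappa>' * (\<integral>\<^sup>+s\<in>{x $ k..}. ennreal (h s / s) \<partial>lborel)"
      unfolding eq[OF h] a_def .
  next
    fix x :: "real ^ 'n" and h :: "real \<Rightarrow> real"
    assume x: "x $ k > 0" and h[measurable]: "h \<in> borel_measurable borel" and h_nonneg: "\<forall>s. 0 \<le> h s"
    define a where "a = x $ k"
    have a: "a > 0" using x by (simp add: a_def)
    let ?I = "\<integral>\<^sup>+s\<in>{a<..}. ennreal ((s - a) powr e * (s powr (\<gamma> - D) * h s)) \<partial>lborel"
    have "(\<integral>\<^sup>+s\<in>{2 * a..}. ennreal (h s / s) \<partial>lborel) \<le>
        ennreal (2 powr e) * (\<integral>\<^sup>+s\<in>{2 * a..}. ennreal ((s - a) powr e * (s powr (\<gamma> - D) * h s)) \<partial>lborel)"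
    proof (rule nn_integral_set_le_scaled)
      fix s assume "s \<in> {2 * a..}"
      then have s: "s > 0" "s \<le> 2 * (s - a)" using a by auto
      have "h s / s = s powr e * (s powr (\<gamma> - D) * h s)"
        using pw[of s] s by (simp add: mult.assoc[symmetric])
      also have "\<dots> \<le> (2 * (s - a)) powr e * (s powr (\<gamma> - D) * h s)"
        using s e h_nonneg by (intro mult_right_mono powr_mono2) auto
      also have "\<dots> = 2 powr e * ((s - a) powr e * (s powr (\<gamma> - D) * h s))"
        using s by (subst powr_mult) simp_all
      finally show "h s / s \<le> 2 powr e * ((s - a) powr e * (s powr (\<gamma> - D) * h s))" .
    qed simp_all
    also have "\<dots> \<le> ennreal (2 powr e) * ?I"
      using a by (intro mult_left_mono nn_integral_mono) (simp_all add: indicator_def)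
    also have "\<dots> = ennreal (2 powr e / \<kappa>) * (ennreal \<kappa> * ?I)"
      using \<kappa>(1) by (simp add: mult.assoc[symmetric] ennreal_mult'[symmetric])
    also have "\<dots> \<le> ennreal \<kappa>' * (ennreal \<kappa> * ?I)"
      using \<kappa>' by (intro mult_right_mono ennreal_leI) auto
    finally show "(\<integral>\<^sup>+s\<in>{2 * x $ k..}. ennreal (h s / s) \<partial>lborel) \<le>
      ennreal \<kappa>' * (\<integral>\<^sup>+z\<in>lower_half k. ennreal (radial_kern \<gamma> h x z) \<partial>lborel)"
      unfolding eq[OF h] a_def .
  qed
qed

text \<open>
  The factor $s^{-D}$ beats the growth $s^{\gamma_2}$ of $\Psi$, so the integral from $r$ on is
  controlled by the integrand at $r$.
\<close>

lemma log_integral_tail: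
  obtains C where "C \<ge> 1"
    "\<And>r Y. 0 < Y \<Longrightarrow> Y \<le> 2 * r \<Longrightarrow>
      (\<integral>\<^sup>+s\<in>{r..}. ennreal (\<Psi> (s / Y) * s powr (- D) / s) \<partial>lborel) \<le> ennreal (C * (r powr (- D) * \<Psi> (r / Y)))"
proof -
  obtain A where A: "A \<ge> 1"
    "\<And>r R. 1/2 \<le> r \<Longrightarrow> r \<le> R \<Longrightarrow> \<Psi> R \<le> A * ((R / r) powr \<gamma>\<^sub>2 * \<Psi> r)"
    by (rule scaling_from[of "1/2"]) (simp, blast)
  define e where "e = D - \<gamma>\<^sub>2"
  have e: "e > 1" using D_bounds(4) by (simp add: e_def)
  show ?thesis
  proof (rule that[OF A(1)])
    fix r Y :: real assume Y: "0 < Y" "Y \<le> 2 * r"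
    have r: "r > 0" using Y by simp
    have "(\<integral>\<^sup>+s\<in>{r..}. ennreal (\<Psi> (s / Y) * s powr (- D) / s) \<partial>lborel) \<le>
       ennreal (A * r powr (- \<gamma>\<^sub>2) * \<Psi> (r / Y)) * (\<integral>\<^sup>+s\<in>{r..}. ennreal (s powr (- e - 1)) \<partial>lborel)"
    proof (rule nn_integral_set_le_scaled)
      fix s assume "s \<in> {r..}"
      then have s: "r \<le> s" "s > 0" using r by auto
      have "\<Psi> (s / Y) \<le> A * ((s / Y / (r / Y)) powr \<gamma>\<^sub>2 * \<Psi> (r / Y))"
        using s Y by (intro A(2)) (auto simp: field_simps)
      also have "s / Y / (r / Y) = s / r" using Y by simp
      finally have "\<Psi> (s / Y) * (s powr (- D) / s) \<le> A * ((s / r) powr \<gamma>\<^sub>2 * \<Psi> (r / Y)) * (s powr (- D) / s)"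
        using s by (intro mult_right_mono) auto
      also have "\<dots> = A * r powr (- \<gamma>\<^sub>2) * \<Psi> (r / Y) * (s powr \<gamma>\<^sub>2 * s powr (- D) / s powr 1)"
        using s r by (simp add: powr_divide powr_minus field_simps)
      also have "s powr \<gamma>\<^sub>2 * s powr (- D) / s powr 1 = s powr (- e - 1)"
        unfolding powr_add[symmetric] powr_diff[symmetric] by (simp add: e_def)
      finally show "\<Psi> (s / Y) * s powr (- D) / s \<le> A * r powr (- \<gamma>\<^sub>2) * \<Psi> (r / Y) * s powr (- e - 1)"
        by simp
    qed (use A(1) in simp_all)
    also have "(\<integral>\<^sup>+s\<in>{r..}. ennreal (s powr (- e - 1)) \<partial>lborel) = ennreal (r powr (- e) / e)"
      using nn_integral_powr_to_inf[of "- e - 1" r] e r by simp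
    also have "ennreal (A * r powr (- \<gamma>\<^sub>2) * \<Psi> (r / Y)) * \<dots> = ennreal (A * (r powr (- \<gamma>\<^sub>2) * r powr (- e)) * \<Psi> (r / Y) / e)"
      using A(1) e by (simp add: ennreal_mult[symmetric] mult_ac)
    also have "r powr (- \<gamma>\<^sub>2) * r powr (- e) = r powr (- D)"
      by (simp add: powr_add[symmetric] e_def)
    also have "A * r powr (- D) * \<Psi> (r / Y) / e \<le> A * (r powr (- D) * \<Psi> (r / Y))"
      using A(1) e mult_left_mono[of 1 e "A * r powr (- D) * \<Psi> (r / Y)"] by (simp add: divide_le_eq)
    finally show "(\<integral>\<^sup>+s\<in>{r..}. ennreal (\<Psi> (s / Y) * s powr (- D) / s) \<partial>lborel) \<le>
        ennreal (A * (r powr (- D) * \<Psi> (r / Y)))"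
      by (simp add: ennreal_leI)
  qed
qed

definition far :: "real ^ 'n \<Rightarrow> real ^ 'n \<Rightarrow> bool" where
  "far x y \<longleftrightarrow> x $ k > 0 \<and> y $ k > 0 \<and> (x $ k \<le> norm (x - y) \<or> y $ k \<le> norm (x - y))"

lemma far_bounds:
  assumes "far x y"
  shows "0 < x $ k" "0 < y $ k" "0 < norm (x - y)" "x $ k \<le> 2 * norm (x - y)" "y $ k \<le> 2 * norm (x - y)"
proof -
  have "\<bar>x $ k - y $ k\<bar> \<le> norm (x - y)"
    using component_le_norm_cart[of "x - y" k] by simp
  with assms show "0 < x $ k" "0 < y $ k" "0 < norm (x - y)"
    "x $ k \<le> 2 * norm (x - y)" "y $ k \<le> 2 * norm (x - y)"
    unfolding far_def by linarith+
qed

lemma opposite_sides_geometry: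
  assumes "x $ k > 0" "z \<in> lower_half k"
  shows "norm (x - z) \<le> x $ k + norm (z - foot k x)" "x $ k + norm (z - foot k x) \<le> 2 * norm (x - z)"
    "\<bar>z $ k\<bar> \<le> x $ k + norm (z - foot k x)" "x $ k + \<bar>z $ k\<bar> \<le> norm (x - z)" "\<bar>z $ k\<bar> > 0"
proof -
  have z: "z $ k < 0" using assms by (simp add: lower_half_def)
  have "x $ k * z $ k \<le> 0" using assms(1) z by (simp add: mult_le_0_iff)
  from foot_distance[OF this] assms(1) z
  show "norm (x - z) \<le> x $ k + norm (z - foot k x)" "x $ k + norm (z - foot k x) \<le> 2 * norm (x - z)"
    "\<bar>z $ k\<bar> \<le> x $ k + norm (z - foot k x)" "x $ k + \<bar>z $ k\<bar> \<le> norm (x - z)" "\<bar>z $ k\<bar> > 0"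
    by simp_all
qed

text \<open>
  Bookkeeping of exponents: the depth enters $\Psi$ through $(s/w)^{\gamma_2}$, which is merged with the
  weight $w^\alpha$.
\<close>

lemma kern_le_split:
  assumes "\<Psi> ((norm (y - z))\<^sup>2 / (y $ k * \<bar>z $ k\<bar>)) \<le> A * ((s / \<bar>z $ k\<bar>) powr \<gamma>\<^sub>2 * \<Psi> v)"
    and "norm (x - z) powr (- D) * norm (y - z) powr (- D) \<le> B * (s powr (- D) * q)"
    and "s > 0" "A \<ge> 0" "z $ k \<noteq> 0"
  shows "kern x y z \<le> A * B * (\<bar>z $ k\<bar> powr (\<alpha> - \<gamma>\<^sub>2) * (s powr (\<gamma>\<^sub>2 - D) * (\<Psi> v * q)))"
proof -
  have "kern x y z = \<Psi> ((norm (y - z))\<^sup>2 / (y $ k * \<bar>z $ k\<bar>)) * \<bar>z $ k\<bar> powr \<alpha>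
     * (norm (x - z) powr (- D) * norm (y - z) powr (- D))"
    by (simp add: kern_def)
  also have "\<dots> \<le> (A * ((s / \<bar>z $ k\<bar>) powr \<gamma>\<^sub>2 * \<Psi> v)) * \<bar>z $ k\<bar> powr \<alpha> * (B * (s powr (- D) * q))"
    using assms by (intro mult_mono[OF mult_right_mono]) simp_all
  also have "\<dots> = A * B * ((\<bar>z $ k\<bar> powr \<alpha> * \<bar>z $ k\<bar> powr (- \<gamma>\<^sub>2)) * ((s powr \<gamma>\<^sub>2 * s powr (- D)) * (\<Psi> v * q)))"
  proof -
    have "(s / \<bar>z $ k\<bar>) powr \<gamma>\<^sub>2 = s powr \<gamma>\<^sub>2 * \<bar>z $ k\<bar> powr (- \<gamma>\<^sub>2)"
      using assms(3,5) by (simp add: powr_divide powr_minus_divide)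
    then show ?thesis by (simp only: mult_ac)
  qed
  also have "\<dots> = A * B * (\<bar>z $ k\<bar> powr (\<alpha> - \<gamma>\<^sub>2) * (s powr (\<gamma>\<^sub>2 - D) * (\<Psi> v * q)))"
    unfolding powr_add[symmetric] by simp
  finally show ?thesis .
qed

lemma kern_ge_split:
  assumes "(s / \<bar>z $ k\<bar>) powr \<gamma>\<^sub>1 * \<Psi> v \<le> A * \<Psi> ((norm (y - z))\<^sup>2 / (y $ k * \<bar>z $ k\<bar>))"
    and "s powr (- D) * q \<le> B * (norm (x - z) powr (- D) * norm (y - z) powr (- D))"
    and "s > 0" "A \<ge> 0" "q \<ge> 0" "z $ k \<noteq> 0"
  shows "\<bar>z $ k\<bar> powr (\<alpha> - \<gamma>\<^sub>1) * (s powr (\<gamma>\<^sub>1 - D) * (\<Psi> v * q)) \<le> A * B * kern x y z"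
proof -
  have "\<bar>z $ k\<bar> powr (\<alpha> - \<gamma>\<^sub>1) * (s powr (\<gamma>\<^sub>1 - D) * (\<Psi> v * q)) =
     ((\<bar>z $ k\<bar> powr \<alpha> * \<bar>z $ k\<bar> powr (- \<gamma>\<^sub>1)) * ((s powr \<gamma>\<^sub>1 * s powr (- D)) * (\<Psi> v * q)))"
    unfolding powr_add[symmetric] by simp
  also have "\<dots> = ((s / \<bar>z $ k\<bar>) powr \<gamma>\<^sub>1 * \<Psi> v) * \<bar>z $ k\<bar> powr \<alpha> * (s powr (- D) * q)"
  proof -
    have "(s / \<bar>z $ k\<bar>) powr \<gamma>\<^sub>1 = s powr \<gamma>\<^sub>1 * \<bar>z $ k\<bar> powr (- \<gamma>\<^sub>1)"
      using assms(3,6) by (simp add: powr_divide powr_minus_divide)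
    then show ?thesis by (simp only: mult_ac)
  qed
  also have "\<dots> \<le> (A * \<Psi> ((norm (y - z))\<^sup>2 / (y $ k * \<bar>z $ k\<bar>))) * \<bar>z $ k\<bar> powr \<alpha> *
      (B * (norm (x - z) powr (- D) * norm (y - z) powr (- D)))"
    using assms by (intro mult_mono[OF mult_right_mono]) simp_all
  also have "\<dots> = A * B * kern x y z"
    by (simp add: kern_def mult_ac)
  finally show ?thesis .
qed

text \<open>
  The radial dependence of the kernel, up to the factor split off in \<open>radial_kern\<close>, where $z$ is closer
  to $y$ than to $x$; here $r = |x - y|$ and $b = y_k$.
\<close>

definition profile_near_y :: "real \<Rightarrow> real \<Rightarrow> real \<Rightarrow> real" where
  "profile_near_y r b s = \<Psi> (s / b) * (r + s) powr (- D)"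

text \<open>
  The corresponding function where $z$ is closer to $x$.
\<close>

definition profile_near_x :: "real \<Rightarrow> real \<Rightarrow> real \<Rightarrow> real" where
  "profile_near_x r b s = \<Psi> ((r + s)\<^sup>2 / (b * s)) * (r + s) powr (- D)"

text \<open>
  The version of \<open>profile_near_x\<close> for lower bounds: the cut-off at $r/2$ keeps $z$ away from $y$, so that
  $|y - z|$ is comparable to $r$.
\<close>

definition truncated_profile_near_x :: "real \<Rightarrow> real \<Rightarrow> real \<Rightarrow> real" where
  "truncated_profile_near_x r b s = \<Psi> (r\<^sup>2 / b / s) * r powr (- D) * indicator {..r / 2} s"

lemma profile_measurable[measurable]:
  "profile_near_y r b \<in> borel_measurable borel" "profile_near_x r b \<in> borel_measurable borel"
  "truncated_profile_near_x r b \<in> borel_measurable borel"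
  unfolding profile_near_y_def profile_near_x_def truncated_profile_near_x_def by measurable

lemma profile_nonneg: "0 \<le> profile_near_y r b s" "0 \<le> profile_near_x r b s"
  "0 \<le> truncated_profile_near_x r b s"
  by (simp_all add: profile_near_y_def profile_near_x_def truncated_profile_near_x_def)

text \<open>
  The kernel in terms of a radial variable and the depth $w$ of $z$. Near $y$ the argument of $\Psi$ is
  comparable to $s^2/(y_k w) = (s/y_k)(s/w)$ and $|x - z|$ is comparable to $r + s$. Near $x$ it is
  comparable to $(r+s)^2/(y_k w) = ((r+s)^2/(y_k s))(s/w)$ and $|y - z|$ is comparable to $r + s$.
\<close>

lemma far_kern_pointwise:
  obtains C where "C \<ge> 1"
    "\<And>x y z. far x y \<Longrightarrow> z \<in> lower_half k \<Longrightarrow> norm (y - z) \<le> norm (x - z) \<Longrightarrow>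
       kern x y z \<le> C * radial_kern \<gamma>\<^sub>2 (profile_near_y (norm (x - y)) (y $ k)) y z"
    "\<And>x y z. far x y \<Longrightarrow> z \<in> lower_half k \<Longrightarrow> norm (x - z) \<le> norm (y - z) \<Longrightarrow>
       kern x y z \<le> C * radial_kern \<gamma>\<^sub>2 (profile_near_x (norm (x - y)) (y $ k)) x z"
    "\<And>x y z. far x y \<Longrightarrow> z \<in> lower_half k \<Longrightarrow>
       radial_kern \<gamma>\<^sub>1 (profile_near_y (norm (x - y)) (y $ k)) y z \<le> C * kern x y z"
    "\<And>x y z. far x y \<Longrightarrow> z \<in> lower_half k \<Longrightarrow>
       radial_kern \<gamma>\<^sub>1 (truncated_profile_near_x (norm (x - y)) (y $ k)) x z \<le> C * kern x y z"
proof -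
  obtain A where A: "A \<ge> 1"
    "\<And>\<rho> v s w. 0 < w \<Longrightarrow> w \<le> s \<Longrightarrow> 1/2 \<le> v \<Longrightarrow> 1/2 \<le> \<rho> \<Longrightarrow> \<rho> \<le> 16 * (v * (s / w)) \<Longrightarrow>
       v * (s / w) \<le> 16 * \<rho> \<Longrightarrow> \<Psi> \<rho> \<le> A * ((s / w) powr \<gamma>\<^sub>2 * \<Psi> v)"
    "\<And>\<rho> v s w. 0 < w \<Longrightarrow> w \<le> s \<Longrightarrow> 1/2 \<le> v \<Longrightarrow> 1/2 \<le> \<rho> \<Longrightarrow> \<rho> \<le> 16 * (v * (s / w)) \<Longrightarrow>
       v * (s / w) \<le> 16 * \<rho> \<Longrightarrow> (s / w) powr \<gamma>\<^sub>1 * \<Psi> v \<le> A * \<Psi> \<rho>"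
    using Psi_split by blast
  define C where "C = A * (8 powr D)"
  have pows: "(1::real) \<le> 2 powr D" "(2::real) powr D \<le> 8 powr D" "(4::real) powr D * 2 powr D = 8 powr D"
    using D_bounds(2) by (auto intro: ge_one_powr_ge_zero powr_mono2 simp: powr_mult[symmetric])
  have C: "A \<le> C" "A * 2 powr D \<le> C"
    using A(1) pows mult_left_mono[of 1 "8 powr D" A] unfolding C_def by auto
  have C1: "C \<ge> 1" using A(1) C(1) by linarith
  have square_le: "a\<^sup>2 \<le> 16 * b\<^sup>2" if "0 \<le> a" "a \<le> 4 * b" for a b :: real
    using power_mono[OF that(2,1), of 2] by (simp add: power_mult_distrib)
  have quot: "1/2 \<le> N\<^sup>2 / (Y * w)" "N\<^sup>2 / (Y * w) \<le> 16 * (V / (Y * w))" "V / (Y * w) \<le> 16 * (N\<^sup>2 / (Y * w))"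
    if "Y + w \<le> N" "Y > 0" "w > 0" "N\<^sup>2 \<le> 16 * V" "V \<le> 16 * N\<^sup>2" for N Y w V :: real
  proof -
    have p: "Y * w > 0" using that by simp
    have "4 * (Y * w) \<le> N\<^sup>2" using four_mult_le_power2[OF that(1-3)] .
    with p have "Y * w \<le> 2 * N\<^sup>2" by linarith
    then show "1/2 \<le> N\<^sup>2 / (Y * w)" using p by (simp add: field_simps)
    show "N\<^sup>2 / (Y * w) \<le> 16 * (V / (Y * w))" "V / (Y * w) \<le> 16 * (N\<^sup>2 / (Y * w))"
      using that(4,5) p by (simp_all add: divide_right_mono)
  qed
  show ?thesis
  proof (rule that[OF C1])
    fix x y z assume f: "far x y" and z: "z \<in> lower_half k"
    define X Y r N M w s t where "X = x $ k" and "Y = y $ k" and "r = norm (x - y)"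
      and "N = norm (y - z)" and "M = norm (x - z)" and "w = \<bar>z $ k\<bar>"
      and "s = Y + norm (z - foot k y)" and "t = X + norm (z - foot k x)"
    note defs = X_def Y_def r_def N_def M_def w_def s_def t_def
    have fb: "0 < X" "0 < Y" "0 < r" "X \<le> 2 * r" "Y \<le> 2 * r"
      using far_bounds[OF f] by (simp_all add: defs)
    have gy: "N \<le> s" "s \<le> 2 * N" "w \<le> s" "Y + w \<le> N" "w > 0"
      using opposite_sides_geometry[OF far_bounds(2)[OF f] z] by (simp_all add: defs)
    have gx: "M \<le> t" "t \<le> 2 * M" "w \<le> t" "X + w \<le> M"
      using opposite_sides_geometry[OF far_bounds(1)[OF f] z] by (simp_all add: defs)
    have tri: "r \<le> M + N" "M \<le> r + N" "N \<le> r + M"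
      using norm_triangle_ineq4[of "x - z" "y - z"] norm_triangle_ineq[of "x - y" "y - z"]
        norm_triangle_ineq4[of "x - z" "x - y"] by (simp_all add: defs)
    have Ys: "Y \<le> s" "X \<le> t" by (simp_all add: s_def t_def)
    have pos: "s > 0" "t > 0" "N > 0" "M > 0" using fb gx gy Ys by linarith+
    have znz: "z $ k \<noteq> 0" using gy(5) by (auto simp: w_def)
    have sq: "N\<^sup>2 \<le> 16 * s\<^sup>2" "s\<^sup>2 \<le> 16 * N\<^sup>2"
      using gy pos by (auto intro!: square_le)
    have vs: "s / Y * (s / w) = s\<^sup>2 / (Y * w)" by (simp add: power2_eq_square)
    have v1: "1/2 \<le> s / Y" using Ys fb by (simp add: field_simps)
    note Q1 = quot[OF gy(4) fb(2) gy(5) sq]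
    {
      assume NM: "norm (y - z) \<le> norm (x - z)"
      then have rs: "r + s \<le> 4 * M" using tri gy by (simp add: N_def M_def)
      have "\<Psi> (N\<^sup>2 / (Y * w)) \<le> A * ((s / w) powr \<gamma>\<^sub>2 * \<Psi> (s / Y))"
        using Q1 v1 gy by (intro A(2)) (simp_all only: vs)
      moreover have "M powr (- D) * N powr (- D) \<le> (4 powr D * (r + s) powr (- D)) * (2 powr D * s powr (- D))"
        using rs gy pos fb D_bounds(2) by (intro mult_mono powr_neg_le) auto
      moreover have "\<dots> = 8 powr D * (s powr (- D) * (r + s) powr (- D))"
        by (simp add: pows(3)[symmetric] mult_ac)
      ultimately have "kern x y z \<le> A * 8 powr D * (\<bar>z $ k\<bar> powr (\<alpha> - \<gamma>\<^sub>2) * (s powr (\<gamma>\<^sub>2 - D) * (\<Psi> (s / Y) * (r + s) powr (- D))))"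
        using pos(1) A(1) znz by (intro kern_le_split) (simp_all only: defs, simp_all)
      then show "kern x y z \<le> C * radial_kern \<gamma>\<^sub>2 (profile_near_y (norm (x - y)) (y $ k)) y z"
        by (simp add: radial_kern_def profile_near_y_def Let_def C_def s_def r_def Y_def)
    next
      assume MN: "norm (x - z) \<le> norm (y - z)"
      then have rt: "r + t \<le> 4 * N" using tri gx by (simp add: N_def M_def)
      have Nrt: "N \<le> r + t" using tri gx by linarith
      have sq2: "N\<^sup>2 \<le> 16 * (r + t)\<^sup>2" "(r + t)\<^sup>2 \<le> 16 * N\<^sup>2"
        using Nrt rt pos fb by (auto intro!: square_le)
      note Q2 = quot[OF gy(4) fb(2) gy(5) sq2]
      have vt: "(r + t)\<^sup>2 / (Y * t) * (t / w) = (r + t)\<^sup>2 / (Y * w)"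
        using pos by simp
      have "Y * t \<le> 2 * r * t" using fb pos by (intro mult_right_mono) auto
      also have "\<dots> \<le> 2 * (r + t)\<^sup>2" using fb pos by (simp add: power2_eq_square algebra_simps)
      finally have v2: "1/2 \<le> (r + t)\<^sup>2 / (Y * t)" using fb pos by (simp add: field_simps)
      have "\<Psi> (N\<^sup>2 / (Y * w)) \<le> A * ((t / w) powr \<gamma>\<^sub>2 * \<Psi> ((r + t)\<^sup>2 / (Y * t)))"
        using Q2 v2 gy gx by (intro A(2)) (simp_all only: vt)
      moreover have "M powr (- D) * N powr (- D) \<le> (2 powr D * t powr (- D)) * (4 powr D * (r + t) powr (- D))"
        using rt gx pos fb D_bounds(2) by (intro mult_mono powr_neg_le) auto
      moreover have "\<dots> = 8 powr D * (t powr (- D) * (r + t) powr (- D))"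
        by (simp add: pows(3)[symmetric] mult_ac)
      ultimately have "kern x y z \<le> A * 8 powr D * (\<bar>z $ k\<bar> powr (\<alpha> - \<gamma>\<^sub>2) * (t powr (\<gamma>\<^sub>2 - D) * (\<Psi> ((r + t)\<^sup>2 / (Y * t)) * (r + t) powr (- D))))"
        using pos(2) A(1) znz by (intro kern_le_split) (simp_all only: defs, simp_all)
      then show "kern x y z \<le> C * radial_kern \<gamma>\<^sub>2 (profile_near_x (norm (x - y)) (y $ k)) x z"
        by (simp add: radial_kern_def profile_near_x_def Let_def C_def t_def r_def Y_def X_def)
    next
      have "(s / w) powr \<gamma>\<^sub>1 * \<Psi> (s / Y) \<le> A * \<Psi> (N\<^sup>2 / (Y * w))"
        using Q1 v1 gy by (intro A(3)) (simp_all only: vs)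
      moreover have "s powr (- D) * (r + s) powr (- D) \<le> N powr (- D) * M powr (- D)"
        using gy tri pos D_bounds(2) by (intro mult_mono powr_mono2') auto
      then have "s powr (- D) * (r + s) powr (- D) \<le> 1 * (M powr (- D) * N powr (- D))"
        by (simp add: mult.commute)
      ultimately have "\<bar>z $ k\<bar> powr (\<alpha> - \<gamma>\<^sub>1) * (s powr (\<gamma>\<^sub>1 - D) * (\<Psi> (s / Y) * (r + s) powr (- D))) \<le> A * 1 * kern x y z"
        using pos(1) A(1) znz by (intro kern_ge_split) (simp_all only: defs, simp_all)
      also have "\<dots> \<le> C * kern x y z"
        using C by (intro mult_right_mono) auto
      finally show "radial_kern \<gamma>\<^sub>1 (profile_near_y (norm (x - y)) (y $ k)) y z \<le> C * kern x y z"
        by (simp add: radial_kern_def profile_near_y_def Let_def s_def r_def Y_def)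
    next
      show "radial_kern \<gamma>\<^sub>1 (truncated_profile_near_x (norm (x - y)) (y $ k)) x z \<le> C * kern x y z"
      proof (cases "t \<le> r / 2")
        case tr: True
        have Nr: "N \<le> 2 * r" "r \<le> 2 * N" using tr gx tri pos fb by linarith+
        have sq3: "N\<^sup>2 \<le> 16 * r\<^sup>2" "r\<^sup>2 \<le> 16 * N\<^sup>2"
          using Nr pos fb by (auto intro!: square_le)
        note Q3 = quot[OF gy(4) fb(2) gy(5) sq3]
        have vt: "r\<^sup>2 / Y / t * (t / w) = r\<^sup>2 / (Y * w)"
          using pos by simp
        have "Y * t \<le> 2 * r * r" using fb pos tr by (intro mult_mono) auto
        then have v3: "1/2 \<le> r\<^sup>2 / Y / t" using fb pos by (simp add: field_simps power2_eq_square)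
        have "(t / w) powr \<gamma>\<^sub>1 * \<Psi> (r\<^sup>2 / Y / t) \<le> A * \<Psi> (N\<^sup>2 / (Y * w))"
          using Q3 v3 gy gx by (intro A(3)) (simp_all only: vt)
        moreover have "t powr (- D) * r powr (- D) \<le> M powr (- D) * (2 powr D * N powr (- D))"
          using gx Nr pos D_bounds(2) by (intro mult_mono powr_mono2' powr_neg_le) auto
        then have "t powr (- D) * r powr (- D) \<le> 2 powr D * (M powr (- D) * N powr (- D))"
          by (simp add: mult_ac)
        ultimately have "\<bar>z $ k\<bar> powr (\<alpha> - \<gamma>\<^sub>1) * (t powr (\<gamma>\<^sub>1 - D) * (\<Psi> (r\<^sup>2 / Y / t) * r powr (- D))) \<le> A * 2 powr D * kern x y z"
          using pos(2) A(1) znz by (intro kern_ge_split) (simp_all only: defs, simp_all)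
        also have "\<dots> \<le> C * kern x y z"
          using C by (intro mult_right_mono) auto
        finally show ?thesis
          using tr by (simp add: radial_kern_def truncated_profile_near_x_def Let_def t_def r_def Y_def X_def)
      next
        case False
        then show ?thesis
          using C1 by (simp add: radial_kern_def truncated_profile_near_x_def Let_def t_def r_def X_def)
      qed
    }
  qed
qed

text \<open>
  Both integrals are split at $s = r$. Below $r$ they are logarithmic integrals of $\Psi$ over intervals
  that end at $r/y_k \le 2u$ and at $u = r^2/(x_k y_k)$; above $r$ both integrands are controlled by
  that of \<open>log_integral_tail\<close>.
\<close>

lemma far_line_integrals:
  obtains C where "C \<ge> 1"
    "\<And>X Y r. 0 < X \<Longrightarrow> 0 < Y \<Longrightarrow> X \<le> 2 * r \<Longrightarrow> Y \<le> 2 * r \<Longrightarrow>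
       (\<integral>\<^sup>+s\<in>{Y..}. ennreal (profile_near_y r Y s / s) \<partial>lborel) \<le>
         ennreal (C * (r powr (- D) * Psi1 \<Psi> (r\<^sup>2 / (X * Y))))"
    "\<And>X Y r. 0 < X \<Longrightarrow> 0 < Y \<Longrightarrow> X \<le> 2 * r \<Longrightarrow> Y \<le> 2 * r \<Longrightarrow>
       (\<integral>\<^sup>+s\<in>{X..}. ennreal (profile_near_x r Y s / s) \<partial>lborel) \<le>
         ennreal (C * (r powr (- D) * Psi1 \<Psi> (r\<^sup>2 / (X * Y))))"
proof -
  obtain T where T: "T \<ge> 1" "\<And>r Y. 0 < Y \<Longrightarrow> Y \<le> 2 * r \<Longrightarrow>
      (\<integral>\<^sup>+s\<in>{r..}. ennreal (\<Psi> (s / Y) * s powr (- D) / s) \<partial>lborel) \<le> ennreal (T * (r powr (- D) * \<Psi> (r / Y)))"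
    using log_integral_tail by blast
  obtain B where B: "B \<ge> 1"
    "\<And>r R. 1/2 \<le> r \<Longrightarrow> 1/2 \<le> R \<Longrightarrow> r \<le> 4 * R \<Longrightarrow> R \<le> 4 * r \<Longrightarrow> \<Psi> R \<le> B * \<Psi> r"
    by (rule Psi_comparable[of "1/2" 4]) (simp, simp, blast)
  obtain E where E: "E \<ge> 1"
    "\<And>u w. 2 * 1 \<le> u \<Longrightarrow> w \<le> 2 * u \<Longrightarrow> log_integral (1/2) w \<le> ennreal E * log_integral 1 u"
    by (rule log_integral_absorb[of 1 2]) (simp, simp, blast)
  obtain G where G: "G \<ge> 1"
    "\<And>u v. 2 \<le> u \<Longrightarrow> v \<le> 2 * u \<Longrightarrow> ennreal (\<Psi> v) \<le> ennreal G * log_integral 1 u"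
    by (rule Psi_absorb[of 2]) (simp, blast)
  define C where "C = B * (E + T * G)"
  have TG: "T * G \<ge> 1" using T(1) G(1) by (simp add: mult_ge1_I)
  then have C: "C \<ge> 1" "E + T * G \<le> C"
    using B(1) E(1) unfolding C_def by (auto intro: mult_ge1_I mult_right_mono[of 1 B "E + T * G", simplified])
  have main: "(\<integral>\<^sup>+s\<in>{Y..}. ennreal (\<Psi> (s / Y) * (r + s) powr (- D) / s) \<partial>lborel) \<le>
         ennreal (C * (r powr (- D) * Psi1 \<Psi> (r\<^sup>2 / (X * Y)))) \<and>
       (\<integral>\<^sup>+s\<in>{X..}. ennreal (\<Psi> ((r + s)\<^sup>2 / (Y * s)) * (r + s) powr (- D) / s) \<partial>lborel) \<le>
         ennreal (C * (r powr (- D) * Psi1 \<Psi> (r\<^sup>2 / (X * Y))))"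
    if h: "0 < X" "0 < Y" "X \<le> 2 * r" "Y \<le> 2 * r" for X Y r :: real
  proof -
    define u where "u = r\<^sup>2 / (X * Y)"
    define P where "P = Psi1 \<Psi> u"
    define \<rho> where "\<rho> = r powr (- D)"
    have r: "r > 0" using h by simp
    have \<rho>: "\<rho> \<ge> 0" by (simp add: \<rho>_def)
    have P: "P \<ge> 0" "ennreal P = log_integral 1 (max 2 u)"
      using Psi1_nonneg ennreal_Psi1 by (simp_all add: P_def)
    have "r * X \<le> r * (2 * r)" using h r by (intro mult_left_mono) auto
    then have ru: "r / Y \<le> 2 * u"
      using h by (simp add: u_def field_simps power2_eq_square)
    then have ru': "r / Y \<le> 2 * max 2 u" by simp
    have rY: "1/2 \<le> r / Y" using h by (simp add: field_simps)
    have L1: "log_integral (1/2) (r / Y) \<le> ennreal (E * P)"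
      using E(2)[of "max 2 u" "r / Y"] ru' P E(1) by (simp add: ennreal_mult')
    have L2: "log_integral (1/2) u \<le> ennreal (E * P)"
      using E(2)[of "max 2 u" u] P E(1) by (simp add: ennreal_mult')
    have L3: "\<Psi> (r / Y) \<le> G * P"
    proof -
      have "ennreal (\<Psi> (r / Y)) \<le> ennreal (G * P)"
        using G(2)[of "max 2 u" "r / Y"] ru' P G(1) by (simp add: ennreal_mult')
      then show ?thesis using P(1) G(1) by (subst (asm) ennreal_le_iff) auto
    qed
    have tail: "(\<integral>\<^sup>+s\<in>{r..}. ennreal (\<Psi> (s / Y) * s powr (- D) / s) \<partial>lborel) \<le> ennreal (T * G * (\<rho> * P))"
    proof -
      have "T * (\<rho> * \<Psi> (r / Y)) \<le> T * (\<rho> * (G * P))"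
        using L3 T(1) \<rho> by (intro mult_left_mono) auto
      then have "T * (\<rho> * \<Psi> (r / Y)) \<le> T * G * (\<rho> * P)" by (simp add: mult_ac)
      then show ?thesis
        using T(2)[OF h(2,4)] by (auto simp: \<rho>_def intro: order_trans ennreal_leI)
    qed
    \<comment> \<open>Both integrals have this form: \<open>L\<close> comes from \<open>s \<le> r\<close>, the second summand from \<open>s \<ge> r\<close>.\<close>
    have combine: "I \<le> ennreal (C * (\<rho> * P))"
      if "I \<le> ennreal b * (ennreal \<rho> * L + (\<integral>\<^sup>+s\<in>{r..}. ennreal (\<Psi> (s / Y) * s powr (- D) / s) \<partial>lborel))"
        "L \<le> ennreal (E * P)" "0 \<le> b" "b \<le> B" for I L b
    proof -
      have "ennreal \<rho> * L \<le> ennreal \<rho> * ennreal (E * P)"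
        using that(2) by (rule mult_left_mono) simp
      then have "ennreal \<rho> * L + (\<integral>\<^sup>+s\<in>{r..}. ennreal (\<Psi> (s / Y) * s powr (- D) / s) \<partial>lborel) \<le>
          ennreal \<rho> * ennreal (E * P) + ennreal (T * G * (\<rho> * P))"
        using tail by (rule add_mono)
      also have "\<dots> = ennreal ((E + T * G) * (\<rho> * P))"
      proof -
        have "0 \<le> \<rho> * (E * P)" "0 \<le> T * G * (\<rho> * P)"
          using \<rho> P(1) E(1) TG by simp_all
        then have "ennreal (\<rho> * (E * P)) + ennreal (T * G * (\<rho> * P)) = ennreal (\<rho> * (E * P) + T * G * (\<rho> * P))"
          by (rule ennreal_plus[symmetric])
        also have "\<rho> * (E * P) + T * G * (\<rho> * P) = (E + T * G) * (\<rho> * P)"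
          by (simp add: algebra_simps)
        finally show ?thesis
          using \<rho> by (simp add: ennreal_mult'[symmetric])
      qed
      finally have "I \<le> ennreal (b * ((E + T * G) * (\<rho> * P)))"
        by (rule ennreal_bound_mult_left[OF that(1)]) fact
      also have "b * ((E + T * G) * (\<rho> * P)) \<le> B * ((E + T * G) * (\<rho> * P))"
        using that(4) \<rho> P(1) E(1) TG by (intro mult_right_mono) auto
      also have "\<dots> = C * (\<rho> * P)" by (simp add: C_def)
      finally show ?thesis by (simp add: ennreal_leI)
    qed
    have neg: "(r + s) powr (- D) \<le> \<rho>" "(r + s) powr (- D) \<le> s powr (- D)" if "s > 0" for s
      unfolding \<rho>_def using that r D_bounds(2) by (intro powr_mono2'; simp)+
    have sum: "(\<integral>\<^sup>+s. ennreal (\<rho> * (f s / s)) * indicator {a..r} s + ennreal (\<Psi> (s / Y) * s powr (- D) / s) * indicator {r..} s \<partial>lborel)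
       = ennreal \<rho> * (\<integral>\<^sup>+s\<in>{a..r}. ennreal (f s / s) \<partial>lborel) + (\<integral>\<^sup>+s\<in>{r..}. ennreal (\<Psi> (s / Y) * s powr (- D) / s) \<partial>lborel)"
      if [measurable]: "f \<in> borel_measurable borel" for f and a :: real
    proof -
      have "(\<integral>\<^sup>+s\<in>{a..r}. ennreal (\<rho> * (f s / s)) \<partial>lborel) =
          (\<integral>\<^sup>+s. ennreal \<rho> * (ennreal (f s / s) * indicator {a..r} s) \<partial>lborel)"
        using \<rho> by (intro nn_integral_cong) (simp add: indicator_def ennreal_mult'[symmetric])
      also have "\<dots> = ennreal \<rho> * (\<integral>\<^sup>+s\<in>{a..r}. ennreal (f s / s) \<partial>lborel)"
        by (rule nn_integral_cmult) measurable
      finally show ?thesis by (subst nn_integral_add) simp_all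
    qed
    have "(\<integral>\<^sup>+s\<in>{Y..}. ennreal (\<Psi> (s / Y) * (r + s) powr (- D) / s) \<partial>lborel) \<le>
      (\<integral>\<^sup>+s. ennreal (\<rho> * (\<Psi> (s / Y) / s)) * indicator {Y..r} s + ennreal (\<Psi> (s / Y) * s powr (- D) / s) * indicator {r..} s \<partial>lborel)"
    proof (intro nn_integral_mono)
      fix s :: real
      show "ennreal (\<Psi> (s / Y) * (r + s) powr (- D) / s) * indicator {Y..} s \<le>
        ennreal (\<rho> * (\<Psi> (s / Y) / s)) * indicator {Y..r} s + ennreal (\<Psi> (s / Y) * s powr (- D) / s) * indicator {r..} s"
      proof (cases "Y \<le> s")
        case True
        then have s: "s > 0" using h by simp
        show ?thesis
        proof (cases "s \<le> r")
          case True
          have "\<Psi> (s / Y) * (r + s) powr (- D) / s \<le> \<Psi> (s / Y) * \<rho> / s"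
            using neg s by (intro divide_right_mono mult_left_mono) auto
          also have "\<dots> = \<rho> * (\<Psi> (s / Y) / s)" by simp
          finally show ?thesis using True \<open>Y \<le> s\<close> by (simp add: add_increasing2 ennreal_leI)
        next
          case False
          have "\<Psi> (s / Y) * (r + s) powr (- D) / s \<le> \<Psi> (s / Y) * s powr (- D) / s"
            using neg s by (intro divide_right_mono mult_left_mono) auto
          then show ?thesis using False \<open>Y \<le> s\<close> by (simp add: add_increasing ennreal_leI)
        qed
      qed simp
    qed
    also have "\<dots> = ennreal 1 * (ennreal \<rho> * log_integral 1 (r / Y) + (\<integral>\<^sup>+s\<in>{r..}. ennreal (\<Psi> (s / Y) * s powr (- D) / s) \<partial>lborel))"
      by (subst sum) (use h in \<open>simp_all add: log_integral_scale\<close>)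
    finally have I1: "(\<integral>\<^sup>+s\<in>{Y..}. ennreal (\<Psi> (s / Y) * (r + s) powr (- D) / s) \<partial>lborel) \<le> ennreal (C * (\<rho> * P))"
    proof (rule combine)
      show "log_integral 1 (r / Y) \<le> ennreal (E * P)"
        using L1 log_integral_mono[of "1/2" 1 "r / Y" "r / Y"] by simp
    qed (use B(1) in simp_all)
    have "(\<integral>\<^sup>+s\<in>{X..}. ennreal (\<Psi> ((r + s)\<^sup>2 / (Y * s)) * (r + s) powr (- D) / s) \<partial>lborel) \<le>
      (\<integral>\<^sup>+s. ennreal B * (ennreal (\<rho> * (\<Psi> (r\<^sup>2 / Y / s) / s)) * indicator {X..r} s + ennreal (\<Psi> (s / Y) * s powr (- D) / s) * indicator {r..} s) \<partial>lborel)"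
    proof (intro nn_integral_mono)
      fix s :: real
      show "ennreal (\<Psi> ((r + s)\<^sup>2 / (Y * s)) * (r + s) powr (- D) / s) * indicator {X..} s \<le>
        ennreal B * (ennreal (\<rho> * (\<Psi> (r\<^sup>2 / Y / s) / s)) * indicator {X..r} s + ennreal (\<Psi> (s / Y) * s powr (- D) / s) * indicator {r..} s)"
      proof (cases "X \<le> s")
        case True
        then have s: "s > 0" using h by simp
        have four: "(2::real)\<^sup>2 = 4" by simp
        have quotient_le: "a / (Y * s) \<le> 4 * (b / (Y * s))" if "a \<le> 4 * b" for a b
          using that h s by (simp add: divide_right_mono)
        have "Y * s \<le> 2 * r * s" using h s by (intro mult_right_mono) auto
        also have "\<dots> \<le> 2 * (r + s)\<^sup>2" using r s by (simp add: power2_eq_square algebra_simps)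
        finally have v: "1/2 \<le> (r + s)\<^sup>2 / (Y * s)" using h s by (simp add: field_simps)
        show ?thesis
        proof (cases "s \<le> r")
          case True
          have "Y * s \<le> 2 * r * r" using h s r True by (intro mult_mono) auto
          then have v': "1/2 \<le> r\<^sup>2 / Y / s" using h s by (simp add: field_simps power2_eq_square)
          have "(r + s)\<^sup>2 \<le> (2 * r)\<^sup>2" "r\<^sup>2 \<le> (r + s)\<^sup>2"
            using True r s by (intro power_mono; linarith)+
          then have "(r + s)\<^sup>2 \<le> 4 * r\<^sup>2" "r\<^sup>2 \<le> 4 * (r + s)\<^sup>2"
            using zero_le_power2[of "r + s"] unfolding power_mult_distrib four by linarith+
          then have "(r + s)\<^sup>2 / (Y * s) \<le> 4 * (r\<^sup>2 / Y / s)" "r\<^sup>2 / Y / s \<le> 4 * ((r + s)\<^sup>2 / (Y * s))"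
            using quotient_le h s by simp_all
          then have "\<Psi> ((r + s)\<^sup>2 / (Y * s)) \<le> B * \<Psi> (r\<^sup>2 / Y / s)"
            using v v' by (intro B(2)) auto
          then have "\<Psi> ((r + s)\<^sup>2 / (Y * s)) * (r + s) powr (- D) / s \<le> (B * \<Psi> (r\<^sup>2 / Y / s)) * \<rho> / s"
            using neg s B(1) by (intro divide_right_mono mult_mono) auto
          also have "\<dots> = B * (\<rho> * (\<Psi> (r\<^sup>2 / Y / s) / s))" by simp
          finally have "ennreal (\<Psi> ((r + s)\<^sup>2 / (Y * s)) * (r + s) powr (- D) / s) \<le>
              ennreal B * ennreal (\<rho> * (\<Psi> (r\<^sup>2 / Y / s) / s))"
            using B(1) by (simp add: ennreal_mult'[symmetric] ennreal_leI)
          then show ?thesis using True \<open>X \<le> s\<close>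
            by (simp add: distrib_left add_increasing2)
        next
          case False
          have v': "1/2 \<le> s / Y" using h False by (simp add: field_simps)
          have "(r + s)\<^sup>2 \<le> (2 * s)\<^sup>2" "s\<^sup>2 \<le> (r + s)\<^sup>2"
            using False r s by (intro power_mono; linarith)+
          then have "(r + s)\<^sup>2 \<le> 4 * s\<^sup>2" "s\<^sup>2 \<le> 4 * (r + s)\<^sup>2"
            using zero_le_power2[of "r + s"] unfolding power_mult_distrib four by linarith+
          moreover have "s / Y = s\<^sup>2 / (Y * s)" using s by (simp add: power2_eq_square)
          ultimately have "(r + s)\<^sup>2 / (Y * s) \<le> 4 * (s / Y)" "s / Y \<le> 4 * ((r + s)\<^sup>2 / (Y * s))"
            using quotient_le h s by simp_all
          then have "\<Psi> ((r + s)\<^sup>2 / (Y * s)) \<le> B * \<Psi> (s / Y)"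
            using v v' by (intro B(2)) auto
          then have "\<Psi> ((r + s)\<^sup>2 / (Y * s)) * (r + s) powr (- D) / s \<le> (B * \<Psi> (s / Y)) * s powr (- D) / s"
            using neg s B(1) by (intro divide_right_mono mult_mono) auto
          also have "\<dots> = B * (\<Psi> (s / Y) * s powr (- D) / s)" by simp
          finally have "ennreal (\<Psi> ((r + s)\<^sup>2 / (Y * s)) * (r + s) powr (- D) / s) \<le>
              ennreal B * ennreal (\<Psi> (s / Y) * s powr (- D) / s)"
            using B(1) by (simp add: ennreal_mult'[symmetric] ennreal_leI)
          then show ?thesis using False \<open>X \<le> s\<close>
            by (simp add: distrib_left add_increasing)
        qed
      qed simp
    qed
    also have "\<dots> = ennreal B * (\<integral>\<^sup>+s. ennreal (\<rho> * (\<Psi> (r\<^sup>2 / Y / s) / s)) * indicator {X..r} s + ennreal (\<Psi> (s / Y) * s powr (- D) / s) * indicator {r..} s \<partial>lborel)"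
      by (rule nn_integral_cmult) measurable
    also have "\<dots> = ennreal B * (ennreal \<rho> * (\<integral>\<^sup>+s\<in>{X..r}. ennreal (\<Psi> (r\<^sup>2 / Y / s) / s) \<partial>lborel) +
        (\<integral>\<^sup>+s\<in>{r..}. ennreal (\<Psi> (s / Y) * s powr (- D) / s) \<partial>lborel))"
      by (subst sum) simp_all
    finally have I2: "(\<integral>\<^sup>+s\<in>{X..}. ennreal (\<Psi> ((r + s)\<^sup>2 / (Y * s)) * (r + s) powr (- D) / s) \<partial>lborel) \<le> ennreal (C * (\<rho> * P))"
    proof (rule combine)
      show "(\<integral>\<^sup>+s\<in>{X..r}. ennreal (\<Psi> (r\<^sup>2 / Y / s) / s) \<partial>lborel) \<le> ennreal (E * P)"
      proof (cases "X \<le> r")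
        case True
        have "(\<integral>\<^sup>+s\<in>{X..r}. ennreal (\<Psi> (r\<^sup>2 / Y / s) / s) \<partial>lborel) = log_integral (r\<^sup>2 / Y / r) (r\<^sup>2 / Y / X)"
          using h r True by (intro log_integral_invert) auto
        also have "\<dots> = log_integral (r / Y) u"
          using h r by (simp add: u_def power2_eq_square mult_ac)
        also have "\<dots> \<le> log_integral (1/2) u"
          using rY by (intro log_integral_mono) auto
        finally show ?thesis using L2 by (rule order_trans)
      qed (use h in simp)
    qed (use B(1) in simp_all)
    show ?thesis using I1 I2 by (simp add: \<rho>_def P_def u_def)
  qed
  show ?thesis
    by (rule that[OF C(1)]; unfold profile_near_y_def profile_near_x_def; use main in blast)
qed

text \<open>
  Every $z$ is closer to one of the two points, so that the sum of the two bounds of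
  \<open>far_kern_pointwise\<close> dominates the kernel on the whole half-space.
\<close>

lemma far_kern_integral_upper:
  obtains C where "C \<ge> 1"
    "\<And>x y. far x y \<Longrightarrow> kern_integral x y \<le>
       ennreal (C * (norm (x - y) powr (- D) * Psi1 \<Psi> ((norm (x - y))\<^sup>2 / (x $ k * y $ k))))"
proof -
  obtain A where A: "A \<ge> 1"
    "\<And>x y z. far x y \<Longrightarrow> z \<in> lower_half k \<Longrightarrow> norm (y - z) \<le> norm (x - z) \<Longrightarrow>
       kern x y z \<le> A * radial_kern \<gamma>\<^sub>2 (profile_near_y (norm (x - y)) (y $ k)) y z"
    "\<And>x y z. far x y \<Longrightarrow> z \<in> lower_half k \<Longrightarrow> norm (x - z) \<le> norm (y - z) \<Longrightarrow>
       kern x y z \<le> A * radial_kern \<gamma>\<^sub>2 (profile_near_x (norm (x - y)) (y $ k)) x z"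
    by (rule far_kern_pointwise, rule that; assumption)
  obtain \<kappa> where \<kappa>: "\<kappa> > 0"
    "\<And>x h. x $ k > 0 \<Longrightarrow> h \<in> borel_measurable borel \<Longrightarrow> (\<forall>s. 0 \<le> h s) \<Longrightarrow>
      (\<integral>\<^sup>+z\<in>lower_half k. ennreal (radial_kern \<gamma>\<^sub>2 h x z) \<partial>lborel) \<le>
      ennreal \<kappa> * (\<integral>\<^sup>+s\<in>{x $ k..}. ennreal (h s / s) \<partial>lborel)"
    by (rule lower_half_log_integral[OF D_bounds(4) gamma(3)], rule that; assumption)
  obtain E where E: "E \<ge> 1"
    "\<And>X Y r. 0 < X \<Longrightarrow> 0 < Y \<Longrightarrow> X \<le> 2 * r \<Longrightarrow> Y \<le> 2 * r \<Longrightarrow>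
       (\<integral>\<^sup>+s\<in>{Y..}. ennreal (profile_near_y r Y s / s) \<partial>lborel) \<le>
         ennreal (E * (r powr (- D) * Psi1 \<Psi> (r\<^sup>2 / (X * Y))))"
    "\<And>X Y r. 0 < X \<Longrightarrow> 0 < Y \<Longrightarrow> X \<le> 2 * r \<Longrightarrow> Y \<le> 2 * r \<Longrightarrow>
       (\<integral>\<^sup>+s\<in>{X..}. ennreal (profile_near_x r Y s / s) \<partial>lborel) \<le>
         ennreal (E * (r powr (- D) * Psi1 \<Psi> (r\<^sup>2 / (X * Y))))"
    using far_line_integrals by blast
  define C where "C = max 1 (A * (2 * \<kappa> * E))"
  have C: "C \<ge> 1" "A * (2 * \<kappa> * E) \<le> C" by (simp_all add: C_def)
  show ?thesis
  proof (rule that[OF C(1)])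
    fix x y assume f: "far x y"
    note fb = far_bounds[OF f]
    define r where "r = norm (x - y)"
    define Z where "Z = r powr (- D) * Psi1 \<Psi> (r\<^sup>2 / (x $ k * y $ k))"
    have Z: "Z \<ge> 0" by (simp add: Z_def Psi1_nonneg)
    define F1 where "F1 = radial_kern \<gamma>\<^sub>2 (profile_near_y r (y $ k)) y"
    define F2 where "F2 = radial_kern \<gamma>\<^sub>2 (profile_near_x r (y $ k)) x"
    have [measurable]: "F1 \<in> borel_measurable borel" "F2 \<in> borel_measurable borel"
      unfolding F1_def F2_def by measurable
    have Fpos: "F1 z \<ge> 0" "F2 z \<ge> 0" for z
      by (simp_all add: F1_def F2_def radial_kern_nonneg profile_nonneg)
    have "(\<integral>\<^sup>+z\<in>lower_half k. ennreal (F1 z) \<partial>lborel) \<le>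
        ennreal \<kappa> * (\<integral>\<^sup>+s\<in>{y $ k..}. ennreal (profile_near_y r (y $ k) s / s) \<partial>lborel)"
      unfolding F1_def using fb profile_nonneg by (intro \<kappa>(2)) simp_all
    moreover have "(\<integral>\<^sup>+s\<in>{y $ k..}. ennreal (profile_near_y r (y $ k) s / s) \<partial>lborel) \<le> ennreal (E * Z)"
      unfolding Z_def r_def using fb by (intro E(2))
    ultimately have I1: "(\<integral>\<^sup>+z\<in>lower_half k. ennreal (F1 z) \<partial>lborel) \<le> ennreal (\<kappa> * (E * Z))"
      by (rule ennreal_bound_mult_left) (use \<kappa>(1) in simp)
    have "(\<integral>\<^sup>+z\<in>lower_half k. ennreal (F2 z) \<partial>lborel) \<le>
        ennreal \<kappa> * (\<integral>\<^sup>+s\<in>{x $ k..}. ennreal (profile_near_x r (y $ k) s / s) \<partial>lborel)"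
      unfolding F2_def using fb profile_nonneg by (intro \<kappa>(2)) simp_all
    moreover have "(\<integral>\<^sup>+s\<in>{x $ k..}. ennreal (profile_near_x r (y $ k) s / s) \<partial>lborel) \<le> ennreal (E * Z)"
      unfolding Z_def r_def using fb by (intro E(3))
    ultimately have I2: "(\<integral>\<^sup>+z\<in>lower_half k. ennreal (F2 z) \<partial>lborel) \<le> ennreal (\<kappa> * (E * Z))"
      by (rule ennreal_bound_mult_left) (use \<kappa>(1) in simp)
    have "kern_integral x y \<le> ennreal A * (\<integral>\<^sup>+z\<in>lower_half k. ennreal (F1 z + F2 z) \<partial>lborel)"
      unfolding kern_integral_def
    proof (rule nn_integral_set_le_scaled)
      fix z assume z: "z \<in> lower_half k"
      have le: "A * F1 z \<le> A * (F1 z + F2 z)" "A * F2 z \<le> A * (F1 z + F2 z)"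
        using A(1) Fpos[of z] by simp_all
      show "kern x y z \<le> A * (F1 z + F2 z)"
      proof (cases "norm (y - z) \<le> norm (x - z)")
        case True
        then show ?thesis
          using A(2)[OF f z] le(1) unfolding F1_def r_def by linarith
      next
        case False
        then show ?thesis
          using A(3)[OF f z] le(2) unfolding F2_def r_def by linarith
      qed
    qed (use A(1) in simp_all)
    also have "(\<integral>\<^sup>+z\<in>lower_half k. ennreal (F1 z + F2 z) \<partial>lborel) =
       (\<integral>\<^sup>+z. ennreal (F1 z) * indicator (lower_half k) z + ennreal (F2 z) * indicator (lower_half k) z \<partial>lborel)"
      using Fpos by (intro nn_integral_cong) (simp add: distrib_right)
    also have "\<dots> = (\<integral>\<^sup>+z\<in>lower_half k. ennreal (F1 z) \<partial>lborel) + (\<integral>\<^sup>+z\<in>lower_half k. ennreal (F2 z) \<partial>lborel)"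
      by (rule nn_integral_add) measurable
    finally have "kern_integral x y \<le> ennreal A * \<dots>" .
    moreover have "(\<integral>\<^sup>+z\<in>lower_half k. ennreal (F1 z) \<partial>lborel) + (\<integral>\<^sup>+z\<in>lower_half k. ennreal (F2 z) \<partial>lborel)
        \<le> ennreal (2 * \<kappa> * E * Z)"
    proof -
      have "(\<integral>\<^sup>+z\<in>lower_half k. ennreal (F1 z) \<partial>lborel) + (\<integral>\<^sup>+z\<in>lower_half k. ennreal (F2 z) \<partial>lborel)
        \<le> ennreal (\<kappa> * (E * Z)) + ennreal (\<kappa> * (E * Z))"
        by (intro add_mono I1 I2)
      also have "\<dots> = ennreal (\<kappa> * (E * Z) + \<kappa> * (E * Z))"
        using \<kappa>(1) E(1) Z by (intro ennreal_plus[symmetric]) auto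
      finally show ?thesis by (simp add: mult_ac)
    qed
    ultimately have "kern_integral x y \<le> ennreal (A * (2 * \<kappa> * E * Z))"
      by (rule ennreal_bound_mult_left) (use A(1) in simp)
    also have "A * (2 * \<kappa> * E * Z) \<le> C * Z"
      using mult_right_mono[OF C(2) Z] by (simp add: mult_ac)
    finally show "kern_integral x y \<le>
       ennreal (C * (norm (x - y) powr (- D) * Psi1 \<Psi> ((norm (x - y))\<^sup>2 / (x $ k * y $ k))))"
      by (simp add: Z_def r_def ennreal_leI)
  qed
qed

text \<open>
  The bound near $y$ yields the integral of $\Psi(v)/v$ over $[2, 8r/y_k]$ and the one near $x$ that over
  $[2r/y_k, u/2]$ with $u = r^2/(x_k y_k)$. Together they cover $[2, V]$ with
  $V = \max(8r/y_k, u/2)$. The factor 8 ensures $V \ge 4$ even when $y_k$ is as large as $2r$, so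
  that \<open>log_integral_absorb\<close> applies.
\<close>

lemma far_kern_integral_lower:
  obtains C where "C \<ge> 1"
    "\<And>x y. far x y \<Longrightarrow>
       ennreal (norm (x - y) powr (- D) * Psi1 \<Psi> ((norm (x - y))\<^sup>2 / (x $ k * y $ k)) / C) \<le> kern_integral x y"
proof -
  obtain A where A: "A \<ge> 1"
    "\<And>x y z. far x y \<Longrightarrow> z \<in> lower_half k \<Longrightarrow>
       radial_kern \<gamma>\<^sub>1 (profile_near_y (norm (x - y)) (y $ k)) y z \<le> A * kern x y z"
    "\<And>x y z. far x y \<Longrightarrow> z \<in> lower_half k \<Longrightarrow>
       radial_kern \<gamma>\<^sub>1 (truncated_profile_near_x (norm (x - y)) (y $ k)) x z \<le> A * kern x y z"
    by (rule far_kern_pointwise, rule that; assumption)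
  have "\<gamma>\<^sub>1 < \<alpha>" using gamma by linarith
  obtain \<kappa> where \<kappa>: "\<kappa> > 0"
    "\<And>x h. x $ k > 0 \<Longrightarrow> h \<in> borel_measurable borel \<Longrightarrow> (\<forall>s. 0 \<le> h s) \<Longrightarrow>
      (\<integral>\<^sup>+s\<in>{2 * x $ k..}. ennreal (h s / s) \<partial>lborel) \<le>
      ennreal \<kappa> * (\<integral>\<^sup>+z\<in>lower_half k. ennreal (radial_kern \<gamma>\<^sub>1 h x z) \<partial>lborel)"
    by (rule lower_half_log_integral[OF D_bounds(3) \<open>\<gamma>\<^sub>1 < \<alpha>\<close>], rule that; assumption)
  obtain E where E: "E \<ge> 1"
    "\<And>u w. 2 * 2 \<le> u \<Longrightarrow> w \<le> 2 * u \<Longrightarrow> log_integral (1/2) w \<le> ennreal E * log_integral 2 u"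
    by (rule log_integral_absorb[of 2 2]) (simp, simp, blast)
  define C where "C = max 1 (E * ((9 powr D + 1) * (\<kappa> * A)))"
  have C: "C \<ge> 1" "E * ((9 powr D + 1) * (\<kappa> * A)) \<le> C" by (simp_all add: C_def)
  show ?thesis
  proof (rule that[OF C(1)])
    fix x y assume f: "far x y"
    define X Y r where "X = x $ k" and "Y = y $ k" and "r = norm (x - y)"
    have fb: "0 < X" "0 < Y" "0 < r" "X \<le> 2 * r" "Y \<le> 2 * r"
      using far_bounds[OF f] by (simp_all add: X_def Y_def r_def)
    define u where "u = r\<^sup>2 / (X * Y)"
    define \<rho> where "\<rho> = r powr (- D)"
    have \<rho>: "\<rho> \<ge> 0" by (simp add: \<rho>_def)
    define h1 where "h1 = profile_near_y r Y"
    define h2 where "h2 = truncated_profile_near_x r Y"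
    have [measurable]: "h1 \<in> borel_measurable borel" "h2 \<in> borel_measurable borel"
      unfolding h1_def h2_def by measurable
    have hpos: "h1 v \<ge> 0" "h2 v \<ge> 0" for v by (simp_all add: h1_def h2_def profile_nonneg)
    let ?Q = "kern_integral x y"
    have J: "(\<integral>\<^sup>+s\<in>{2 * p $ k..}. ennreal (h s / s) \<partial>lborel) \<le> ennreal (\<kappa> * A) * ?Q"
      if "p $ k > 0" "h \<in> borel_measurable borel" "\<forall>s. 0 \<le> h s"
        "\<And>z. z \<in> lower_half k \<Longrightarrow> radial_kern \<gamma>\<^sub>1 h p z \<le> A * kern x y z" for p h
    proof -
      have "(\<integral>\<^sup>+z\<in>lower_half k. ennreal (radial_kern \<gamma>\<^sub>1 h p z) \<partial>lborel) \<le> ennreal A * ?Q"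
        unfolding kern_integral_def using that(4) A(1) by (intro nn_integral_set_le_scaled) simp_all
      with \<kappa>(2)[OF that(1-3)] show ?thesis
        by (rule ennreal_bound_trans) (use \<kappa>(1) in simp)
    qed
    have J1: "(\<integral>\<^sup>+s\<in>{2 * Y..}. ennreal (h1 s / s) \<partial>lborel) \<le> ennreal (\<kappa> * A) * ?Q"
      using J[of y h1] fb hpos A(2)[OF f] by (simp add: h1_def r_def Y_def)
    have J2: "(\<integral>\<^sup>+s\<in>{2 * X..}. ennreal (h2 s / s) \<partial>lborel) \<le> ennreal (\<kappa> * A) * ?Q"
      using J[of x h2] fb hpos A(3)[OF f] by (simp add: h2_def r_def X_def Y_def)
    have "ennreal \<rho> * log_integral 2 (8 * r / Y) = (\<integral>\<^sup>+s. ennreal \<rho> * (ennreal (\<Psi> (s / Y) / s) * indicator {2 * Y..8 * r} s) \<partial>lborel)"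
      using fb log_integral_scale[of Y "2 * Y" "8 * r"] by (subst nn_integral_cmult) simp_all
    also have "\<dots> = (\<integral>\<^sup>+s\<in>{2 * Y..8 * r}. ennreal (\<rho> * (\<Psi> (s / Y) / s)) \<partial>lborel)"
      using \<rho> by (intro nn_integral_cong) (simp add: indicator_def ennreal_mult'[symmetric])
    also have "\<dots> \<le> ennreal (9 powr D) * (\<integral>\<^sup>+s\<in>{2 * Y..8 * r}. ennreal (h1 s / s) \<partial>lborel)"
    proof (rule nn_integral_set_le_scaled)
      \<comment> \<open>On this range \<open>r + s \<le> 9 * r\<close>, hence the constant \<open>9 powr D\<close>.\<close>
      fix s assume "s \<in> {2 * Y..8 * r}"
      then have s: "s > 0" "r + s \<le> 9 * r" using fb by auto
      have "\<rho> \<le> 9 powr D * (r + s) powr (- D)"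
        unfolding \<rho>_def using s fb D_bounds(2) by (intro powr_neg_le) auto
      then have "\<rho> * (\<Psi> (s / Y) / s) \<le> 9 powr D * (r + s) powr (- D) * (\<Psi> (s / Y) / s)"
        using s by (intro mult_right_mono) auto
      then show "\<rho> * (\<Psi> (s / Y) / s) \<le> 9 powr D * (h1 s / s)"
        by (simp add: h1_def profile_near_y_def mult_ac)
    qed simp_all
    also have "\<dots> \<le> ennreal (9 powr D) * (ennreal (\<kappa> * A) * ?Q)"
    proof (rule mult_left_mono)
      have "(\<integral>\<^sup>+s\<in>{2 * Y..8 * r}. ennreal (h1 s / s) \<partial>lborel) \<le> (\<integral>\<^sup>+s\<in>{2 * Y..}. ennreal (h1 s / s) \<partial>lborel)"
        by (intro nn_integral_mono mult_left_mono) (simp_all add: indicator_def)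
      then show "(\<integral>\<^sup>+s\<in>{2 * Y..8 * r}. ennreal (h1 s / s) \<partial>lborel) \<le> ennreal (\<kappa> * A) * ?Q"
        using J1 by (rule order_trans)
    qed simp
    finally have K1: "ennreal \<rho> * log_integral 2 (8 * r / Y) \<le> ennreal (9 powr D * (\<kappa> * A)) * ?Q"
      by (simp add: ennreal_mult' mult.assoc)
    define V where "V = max (8 * r / Y) (u / 2)"
    have V4: "4 \<le> V" using fb by (simp add: V_def le_max_iff_disj field_simps)
    have K2: "ennreal \<rho> * log_integral (8 * r / Y) (u / 2) \<le> ennreal (\<kappa> * A) * ?Q"
    proof (cases "2 * X \<le> r / 2")
      case True
      have "log_integral (8 * r / Y) (u / 2) \<le> log_integral (2 * r / Y) (u / 2)"
        using fb by (intro log_integral_mono divide_right_mono) auto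
      also have "\<dots> = log_integral (r\<^sup>2 / Y / (r / 2)) (r\<^sup>2 / Y / (2 * X))"
      proof -
        have "r\<^sup>2 / Y / (r / 2) = 2 * r / Y" using fb by (simp add: power2_eq_square)
        moreover have "r\<^sup>2 / Y / (2 * X) = u / 2" using fb by (simp add: u_def)
        ultimately show ?thesis by (simp only:)
      qed
      also have "\<dots> = (\<integral>\<^sup>+s\<in>{2 * X..r / 2}. ennreal (\<Psi> (r\<^sup>2 / Y / s) / s) \<partial>lborel)"
        using fb True by (intro log_integral_invert[symmetric]) auto
      finally have "ennreal \<rho> * log_integral (8 * r / Y) (u / 2) \<le> ennreal \<rho> * \<dots>"
        by (rule mult_left_mono) simp
      also have "\<dots> = (\<integral>\<^sup>+s. ennreal \<rho> * (ennreal (\<Psi> (r\<^sup>2 / Y / s) / s) * indicator {2 * X..r / 2} s) \<partial>lborel)"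
        by (subst nn_integral_cmult) simp_all
      also have "\<dots> = (\<integral>\<^sup>+s\<in>{2 * X..}. ennreal (h2 s / s) \<partial>lborel)"
        using \<rho> by (intro nn_integral_cong) (simp add: h2_def truncated_profile_near_x_def \<rho>_def indicator_def ennreal_mult'[symmetric] mult_ac)
      finally show ?thesis using J2 by (rule order_trans)
    next
      \<comment> \<open>If \<open>x\<close> is far from the boundary, the interval near \<open>x\<close> is already covered by the one near \<open>y\<close>.\<close>
      case False
      then have "r \<le> 4 * X" by simp
      then have "r * r \<le> 4 * X * r" using fb by (intro mult_right_mono) auto
      then have "u \<le> 4 * r / Y" using fb by (simp add: u_def field_simps power2_eq_square)
      moreover have "r / Y > 0" using fb by simp
      ultimately have "u / 2 < 8 * r / Y" by simp
      then have "log_integral (8 * r / Y) (u / 2) = 0" by (simp add: log_integral_def)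
      then show ?thesis by simp
    qed
    have "log_integral 2 V \<le> log_integral 2 (8 * r / Y) + log_integral (8 * r / Y) (u / 2)"
      using log_integral_split[of 2 "u / 2" "8 * r / Y"] by (auto simp: V_def max_def add_increasing2)
    then have "ennreal \<rho> * log_integral 2 V \<le> ennreal \<rho> * (log_integral 2 (8 * r / Y) + log_integral (8 * r / Y) (u / 2))"
      by (rule mult_left_mono) simp
    also have "\<dots> \<le> ennreal (9 powr D * (\<kappa> * A)) * ?Q + ennreal (\<kappa> * A) * ?Q"
      unfolding distrib_left by (intro add_mono K1 K2)
    also have "\<dots> = ennreal ((9 powr D + 1) * (\<kappa> * A)) * ?Q"
      using \<kappa>(1) A(1) by (simp add: distrib_right[symmetric] ennreal_plus[symmetric] del: ennreal_plus) (simp add: distrib_right)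
    finally have K3: "ennreal \<rho> * log_integral 2 V \<le> ennreal ((9 powr D + 1) * (\<kappa> * A)) * ?Q" .
    have "ennreal (Psi1 \<Psi> u) \<le> ennreal E * log_integral 2 V"
    proof -
      have "ennreal (Psi1 \<Psi> u) \<le> log_integral (1/2) (max 2 u)"
        unfolding ennreal_Psi1 by (intro log_integral_mono) auto
      also have "\<dots> \<le> ennreal E * log_integral 2 V"
        using V4 by (intro E(2)) (auto simp: V_def)
      finally show ?thesis .
    qed
    then have "ennreal \<rho> * ennreal (Psi1 \<Psi> u) \<le> ennreal \<rho> * (ennreal E * log_integral 2 V)"
      by (rule mult_left_mono) simp
    then have "ennreal (\<rho> * Psi1 \<Psi> u) \<le> ennreal E * (ennreal \<rho> * log_integral 2 V)"
      using \<rho> by (simp add: ennreal_mult' mult_ac)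
    then have "ennreal (\<rho> * Psi1 \<Psi> u) \<le> ennreal (E * ((9 powr D + 1) * (\<kappa> * A))) * ?Q"
      by (rule ennreal_bound_trans) (use K3 E(1) in simp_all)
    also have "\<dots> \<le> ennreal C * ?Q"
      using C by (intro mult_right_mono ennreal_leI) auto
    finally have "ennreal (\<rho> * Psi1 \<Psi> u / C) \<le> ?Q"
      using C(1) by (intro ennreal_div_le_cancel) auto
    then show "ennreal (norm (x - y) powr (- D) * Psi1 \<Psi> ((norm (x - y))\<^sup>2 / (x $ k * y $ k)) / C) \<le> ?Q"
      by (simp add: \<rho>_def u_def r_def X_def Y_def)
  qed
qed

section \<open>Comparability of kernels\<close>

lemma jker_eq: "jker \<alpha> x y = stable_const (real CARD('n)) \<alpha> * norm (x - y) powr (- D)"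
  for x y :: "real ^ 'n"
  by (simp add: jker_def exponent)

lemma near_pairs_bounds:
  assumes "(x, y) \<in> near_pairs k"
  shows "0 < x $ k" "0 < y $ k" "norm (x - y) < x $ k" "norm (x - y) < y $ k"
    "max (x $ k) (y $ k) \<le> 2 * min (x $ k) (y $ k)"
proof -
  have "\<bar>x $ k - y $ k\<bar> \<le> norm (x - y)"
    using component_le_norm_cart[of "x - y" k] by simp
  with assms show "0 < x $ k" "0 < y $ k" "norm (x - y) < x $ k" "norm (x - y) < y $ k"
    "max (x $ k) (y $ k) \<le> 2 * min (x $ k) (y $ k)"
    by (auto simp: near_pairs_def upper_half_def)
qed

lemma near_qker:
  obtains a b where
    "\<And>x y. (x, y) \<in> near_pairs k \<Longrightarrow> min (x $ k) (y $ k) powr (- D) \<le> a * qker \<alpha> \<Psi> k x y"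
    "\<And>x y. (x, y) \<in> near_pairs k \<Longrightarrow> qker \<alpha> \<Psi> k x y \<le> b * min (x $ k) (y $ k) powr (- D)"
    "\<And>x y. (x, y) \<in> near_pairs k \<Longrightarrow> 0 \<le> qker \<alpha> \<Psi> k x y"
proof -
  obtain c where c: "c \<ge> 1"
    "\<And>x y a b. 0 \<le> b \<Longrightarrow> ennreal a \<le> kern_integral x y \<Longrightarrow> kern_integral x y \<le> ennreal b \<Longrightarrow>
        a \<le> c * qker \<alpha> \<Psi> k x y"
    "\<And>x y a b. 0 \<le> b \<Longrightarrow> kern_integral x y \<le> ennreal b \<Longrightarrow> qker \<alpha> \<Psi> k x y \<le> c * b"
    by (rule qker_comparable_kern_integral, rule that; assumption)
  obtain C where C: "C \<ge> 1"
    "\<And>x y. x $ k > 0 \<Longrightarrow> y $ k > 0 \<Longrightarrow> norm (x - y) < x $ k \<Longrightarrow> norm (x - y) < y $ k \<Longrightarrow>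
       ennreal ((y $ k) powr (- D) / C) \<le> kern_integral x y"
    "\<And>x y. x $ k > 0 \<Longrightarrow> y $ k > 0 \<Longrightarrow> norm (x - y) < x $ k \<Longrightarrow> norm (x - y) < y $ k \<Longrightarrow>
       kern_integral x y \<le> ennreal (C * (y $ k) powr (- D))"
    using near_kern_integral by blast
  show ?thesis
  proof (rule that[of "2 powr D * C * c" "c * C"])
    fix x y assume xy: "(x, y) \<in> near_pairs k"
    note n = near_pairs_bounds[OF xy]
    define m where "m = min (x $ k) (y $ k)"
    have m: "0 < m" "m \<le> y $ k" "y $ k \<le> 2 * m" using n by (auto simp: m_def)
    have b0: "0 \<le> C * (y $ k) powr (- D)" using C(1) by simp
    have lo: "(y $ k) powr (- D) / C \<le> c * qker \<alpha> \<Psi> k x y"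
      using c(2)[OF b0 C(2)[OF n(1-4)] C(3)[OF n(1-4)]] .
    have up: "qker \<alpha> \<Psi> k x y \<le> c * (C * (y $ k) powr (- D))"
      using c(3)[OF b0 C(3)[OF n(1-4)]] .
    have "m powr (- D) \<le> 2 powr D * (y $ k) powr (- D)"
      using m n D_bounds(2) by (intro powr_neg_le) auto
    also have "\<dots> \<le> 2 powr D * (C * (c * qker \<alpha> \<Psi> k x y))"
      using lo C(1) by (intro mult_left_mono) (auto simp: field_simps)
    finally show "min (x $ k) (y $ k) powr (- D) \<le> 2 powr D * C * c * qker \<alpha> \<Psi> k x y"
      by (simp add: m_def mult_ac)
    have "(y $ k) powr (- D) \<le> m powr (- D)"
      using m D_bounds(2) by (intro powr_mono2') auto
    then have "c * (C * (y $ k) powr (- D)) \<le> c * (C * m powr (- D))"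
      using c(1) C(1) by (intro mult_left_mono) auto
    with up show "qker \<alpha> \<Psi> k x y \<le> c * C * min (x $ k) (y $ k) powr (- D)"
      by (simp add: m_def mult_ac)
    have "0 \<le> (y $ k) powr (- D) / C" using C(1) by simp
    then have "0 \<le> c * qker \<alpha> \<Psi> k x y" using lo by (rule order_trans)
    then show "0 \<le> qker \<alpha> \<Psi> k x y" using c(1) by (simp add: zero_le_mult_iff)
  qed
qed

text \<open>
  In the third claim $\mathcal B - 1 = q/j$ for $x \ne y$. For $x = y$ both sides vanish, since
  $0^D = 0$.
\<close>

lemma near_comparable:
  shows "comparable_on (near_pairs k) (qker \<alpha> \<Psi> k) (\<lambda>x y. min (x $ k) (y $ k) powr (- D))"
    and "comparable_on (near_pairs k) (\<lambda>x y. min (x $ k) (y $ k) powr (- D)) (\<lambda>x y. max (x $ k) (y $ k) powr (- D))"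
    and "comparable_on (near_pairs k) (\<lambda>x y. Bcal \<alpha> \<Psi> k x y - 1) (\<lambda>x y. (norm (x - y) / min (x $ k) (y $ k)) powr D)"
proof -
  obtain a b where ab:
    "\<And>x y. (x, y) \<in> near_pairs k \<Longrightarrow> min (x $ k) (y $ k) powr (- D) \<le> a * qker \<alpha> \<Psi> k x y"
    "\<And>x y. (x, y) \<in> near_pairs k \<Longrightarrow> qker \<alpha> \<Psi> k x y \<le> b * min (x $ k) (y $ k) powr (- D)"
    "\<And>x y. (x, y) \<in> near_pairs k \<Longrightarrow> 0 \<le> qker \<alpha> \<Psi> k x y"
    using near_qker by blast
  show "comparable_on (near_pairs k) (qker \<alpha> \<Psi> k) (\<lambda>x y. min (x $ k) (y $ k) powr (- D))"
    by (rule comparable_onI[of _ _ _ a b]) (use ab in auto)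
  show "comparable_on (near_pairs k) (\<lambda>x y. min (x $ k) (y $ k) powr (- D)) (\<lambda>x y. max (x $ k) (y $ k) powr (- D))"
  proof (rule comparable_onI[of _ _ _ 1 "2 powr D"])
    fix x y assume "(x, y) \<in> near_pairs k"
    note n = near_pairs_bounds[OF this]
    have "max (x $ k) (y $ k) powr (- D) \<le> min (x $ k) (y $ k) powr (- D)"
      using n D_bounds(2) by (intro powr_mono2') auto
    moreover have "min (x $ k) (y $ k) powr (- D) \<le> 2 powr D * max (x $ k) (y $ k) powr (- D)"
      using n D_bounds(2) by (intro powr_neg_le) auto
    ultimately show "0 \<le> min (x $ k) (y $ k) powr (- D) \<and> 0 \<le> max (x $ k) (y $ k) powr (- D) \<and>
      max (x $ k) (y $ k) powr (- D) \<le> 1 * min (x $ k) (y $ k) powr (- D) \<and>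
      min (x $ k) (y $ k) powr (- D) \<le> 2 powr D * max (x $ k) (y $ k) powr (- D)"
      by simp
  qed
  define S where "S = stable_const (real CARD('n)) \<alpha>"
  have S: "S > 0" using stable_const_pos by (simp add: S_def)
  show "comparable_on (near_pairs k) (\<lambda>x y. Bcal \<alpha> \<Psi> k x y - 1) (\<lambda>x y. (norm (x - y) / min (x $ k) (y $ k)) powr D)"
  proof (rule comparable_onI[of _ _ _ "S * a" "b / S"])
    fix x y assume xy: "(x, y) \<in> near_pairs k"
    note n = near_pairs_bounds[OF xy]
    define m q r where "m = min (x $ k) (y $ k)" and "q = qker \<alpha> \<Psi> k x y" and "r = norm (x - y)"
    have m: "m > 0" using n by (simp add: m_def)
    have q: "m powr (- D) \<le> a * q" "q \<le> b * m powr (- D)" "0 \<le> q"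
      using ab[OF xy] by (simp_all add: m_def q_def)
    have B: "Bcal \<alpha> \<Psi> k x y - 1 = r powr D * q / S"
      by (simp add: Bcal_def jker_eq S_def q_def r_def powr_minus divide_inverse mult_ac)
    have T: "(r / m) powr D = r powr D * m powr (- D)"
      using m by (simp add: r_def powr_divide powr_minus_divide)
    have "r powr D * m powr (- D) \<le> S * a * (r powr D * q / S)"
      using mult_left_mono[OF q(1), of "r powr D"] S by (simp add: mult_ac)
    moreover have "r powr D * q / S \<le> b / S * (r powr D * m powr (- D))"
      using divide_right_mono[OF mult_left_mono[OF q(2), of "r powr D"], of S] S by (simp add: mult_ac)
    ultimately show "0 \<le> Bcal \<alpha> \<Psi> k x y - 1 \<and> 0 \<le> (norm (x - y) / min (x $ k) (y $ k)) powr D \<and>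
      (norm (x - y) / min (x $ k) (y $ k)) powr D \<le> S * a * (Bcal \<alpha> \<Psi> k x y - 1) \<and>
      Bcal \<alpha> \<Psi> k x y - 1 \<le> b / S * (norm (x - y) / min (x $ k) (y $ k)) powr D"
      unfolding B r_def[symmetric] m_def[symmetric] T using q(3) S by simp
  qed
qed

lemma far_pairs_far: "(x, y) \<in> far_pairs k \<Longrightarrow> far x y"
  by (auto simp: far_pairs_def far_def upper_half_def min_le_iff_disj)

lemma far_comparable:
  shows "comparable_on (far_pairs k) (qker \<alpha> \<Psi> k) (Jker \<alpha> \<Psi> k)"
    and "comparable_on (far_pairs k) (Jker \<alpha> \<Psi> k)
        (\<lambda>x y. norm (x - y) powr (- D) * Psi1 \<Psi> ((norm (x - y))\<^sup>2 / (x $ k * y $ k)))"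
proof -
  obtain c where c: "c \<ge> 1"
    "\<And>x y a b. 0 \<le> b \<Longrightarrow> ennreal a \<le> kern_integral x y \<Longrightarrow> kern_integral x y \<le> ennreal b \<Longrightarrow>
        a \<le> c * qker \<alpha> \<Psi> k x y"
    "\<And>x y a b. 0 \<le> b \<Longrightarrow> kern_integral x y \<le> ennreal b \<Longrightarrow> qker \<alpha> \<Psi> k x y \<le> c * b"
    by (rule qker_comparable_kern_integral, rule that; assumption)
  define F where "F x y = norm (x - y) powr (- D) * Psi1 \<Psi> ((norm (x - y))\<^sup>2 / (x $ k * y $ k))" for x y
  have F0: "F x y \<ge> 0" for x y by (simp add: F_def Psi1_nonneg)
  obtain U where U: "U \<ge> 1" "\<And>x y. far x y \<Longrightarrow> kern_integral x y \<le> ennreal (U * F x y)"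
    unfolding F_def using far_kern_integral_upper by blast
  obtain L where L: "L \<ge> 1" "\<And>x y. far x y \<Longrightarrow> ennreal (F x y / L) \<le> kern_integral x y"
    unfolding F_def using far_kern_integral_lower by blast
  obtain G where G: "G \<ge> 1" "\<And>u. 1 \<le> G * Psi1 \<Psi> u"
    by (rule Psi_le_Psi1, rule that; assumption)
  define S where "S = stable_const (real CARD('n)) \<alpha>"
  have S: "S > 0" using stable_const_pos by (simp add: S_def)
  define q where "q = qker \<alpha> \<Psi> k"
  have bounds: "F x y \<le> L * c * q x y" "q x y \<le> c * U * F x y" "0 \<le> q x y"
      "0 \<le> jker \<alpha> x y" "jker \<alpha> x y \<le> S * G * F x y" if "(x, y) \<in> far_pairs k" for x y
  proof -
    note f = far_pairs_far[OF that]
    have b0: "0 \<le> U * F x y" using U(1) F0 by simp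
    have lo: "F x y / L \<le> c * q x y"
      unfolding q_def using c(2)[OF b0 L(2)[OF f] U(2)[OF f]] .
    then show "F x y \<le> L * c * q x y" using L(1) by (simp add: field_simps)
    show "q x y \<le> c * U * F x y"
      unfolding q_def using c(3)[OF b0 U(2)[OF f]] by (simp add: mult_ac)
    have "0 \<le> F x y / L" using L(1) F0 by simp
    then have "0 \<le> c * q x y" using lo by (rule order_trans)
    then show "0 \<le> q x y" using c(1) by (simp add: zero_le_mult_iff)
    show "0 \<le> jker \<alpha> x y" using S by (simp add: jker_eq S_def[symmetric])
    have "S * norm (x - y) powr (- D) * 1 \<le> S * norm (x - y) powr (- D) *
        (G * Psi1 \<Psi> ((norm (x - y))\<^sup>2 / (x $ k * y $ k)))"
      using G(2) S by (intro mult_left_mono) auto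
    then show "jker \<alpha> x y \<le> S * G * F x y"
      by (simp add: jker_eq S_def[symmetric] F_def mult_ac)
  qed
  have J: "Jker \<alpha> \<Psi> k x y = jker \<alpha> x y + q x y" for x y
    by (simp add: Jker_def q_def)
  show "comparable_on (far_pairs k) (qker \<alpha> \<Psi> k) (Jker \<alpha> \<Psi> k)"
  proof (rule comparable_onI[of _ _ _ "S * G * (L * c) + 1" 1])
    fix x y assume "(x, y) \<in> far_pairs k"
    note h = bounds[OF this]
    have "S * G * F x y \<le> S * G * (L * c * q x y)"
      using h(1) S G(1) by (intro mult_left_mono) auto
    with h show "0 \<le> qker \<alpha> \<Psi> k x y \<and> 0 \<le> Jker \<alpha> \<Psi> k x y \<and>
        Jker \<alpha> \<Psi> k x y \<le> (S * G * (L * c) + 1) * qker \<alpha> \<Psi> k x y \<and>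
        qker \<alpha> \<Psi> k x y \<le> 1 * Jker \<alpha> \<Psi> k x y"
      unfolding J q_def[symmetric] by (simp add: distrib_right mult.assoc)
  qed
  have "comparable_on (far_pairs k) (Jker \<alpha> \<Psi> k) F"
  proof (rule comparable_onI[of _ _ _ "L * c" "S * G + c * U"])
    fix x y assume "(x, y) \<in> far_pairs k"
    note h = bounds[OF this]
    have "L * c * q x y \<le> L * c * (jker \<alpha> x y + q x y)"
      using h L(1) c(1) by (intro mult_left_mono) auto
    with h show "0 \<le> Jker \<alpha> \<Psi> k x y \<and> 0 \<le> F x y \<and>
        F x y \<le> L * c * Jker \<alpha> \<Psi> k x y \<and> Jker \<alpha> \<Psi> k x y \<le> (S * G + c * U) * F x y"
      unfolding J using F0[of x y] by (auto simp: distrib_right)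
  qed
  then show "comparable_on (far_pairs k) (Jker \<alpha> \<Psi> k)
        (\<lambda>x y. norm (x - y) powr (- D) * Psi1 \<Psi> ((norm (x - y))\<^sup>2 / (x $ k * y $ k)))"
    unfolding F_def .
qed

lemma far_comparable_positive_index:
  assumes "\<gamma>\<^sub>1 > 0"
  shows "comparable_on (far_pairs k) (Jker \<alpha> \<Psi> k)
        (\<lambda>x y. norm (x - y) powr (- D) * \<Psi> ((norm (x - y))\<^sup>2 / (x $ k * y $ k)))"
proof -
  obtain G where G: "G \<ge> 1" "\<And>u. \<Psi> u \<le> G * Psi1 \<Psi> u"
    by (rule Psi_le_Psi1, rule that; assumption)
  obtain H where H: "H \<ge> 0" "\<And>u. Psi1 \<Psi> u \<le> H * \<Psi> u"
    using Psi1_le_Psi[OF assms] by blast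
  have "comparable_on (far_pairs k) (\<lambda>x y. norm (x - y) powr (- D) * Psi1 \<Psi> ((norm (x - y))\<^sup>2 / (x $ k * y $ k)))
        (\<lambda>x y. norm (x - y) powr (- D) * \<Psi> ((norm (x - y))\<^sup>2 / (x $ k * y $ k)))"
  proof (rule comparable_onI[of _ _ _ G H])
    fix x y :: "real ^ 'n"
    let ?p = "norm (x - y) powr (- D)" and ?u = "(norm (x - y))\<^sup>2 / (x $ k * y $ k)"
    show "0 \<le> ?p * Psi1 \<Psi> ?u \<and> 0 \<le> ?p * \<Psi> ?u \<and> ?p * \<Psi> ?u \<le> G * (?p * Psi1 \<Psi> ?u) \<and>
        ?p * Psi1 \<Psi> ?u \<le> H * (?p * \<Psi> ?u)"
      using mult_left_mono[OF G(2)[of ?u], of ?p] mult_left_mono[OF H(2)[of ?u], of ?p] Psi1_nonneg[of ?u]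
      by (simp add: mult_ac)
  qed
  with far_comparable(2) show ?thesis by (rule comparable_on_trans)
qed

lemma far_comparable_negative_index:
  assumes "\<gamma>\<^sub>2 < 0"
  shows "comparable_on (far_pairs k) (Jker \<alpha> \<Psi> k) (\<lambda>x y. norm (x - y) powr (- D))"
proof -
  obtain G where G: "G \<ge> 1" "\<And>u. 1 \<le> G * Psi1 \<Psi> u"
    by (rule Psi_le_Psi1, rule that; assumption)
  obtain H where H: "H \<ge> 0" "\<And>u. Psi1 \<Psi> u \<le> H"
    using Psi1_bounded[OF assms] by blast
  have "comparable_on (far_pairs k) (\<lambda>x y. norm (x - y) powr (- D) * Psi1 \<Psi> ((norm (x - y))\<^sup>2 / (x $ k * y $ k)))
        (\<lambda>x y. norm (x - y) powr (- D))"
  proof (rule comparable_onI[of _ _ _ G H])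
    fix x y :: "real ^ 'n"
    let ?p = "norm (x - y) powr (- D)" and ?u = "(norm (x - y))\<^sup>2 / (x $ k * y $ k)"
    show "0 \<le> ?p * Psi1 \<Psi> ?u \<and> 0 \<le> ?p \<and> ?p \<le> G * (?p * Psi1 \<Psi> ?u) \<and> ?p * Psi1 \<Psi> ?u \<le> H * ?p"
      using mult_left_mono[OF G(2)[of ?u], of ?p] mult_left_mono[OF H(2)[of ?u], of ?p] Psi1_nonneg[of ?u]
      by (simp add: mult_ac)
  qed
  with far_comparable(2) show ?thesis by (rule comparable_on_trans)
qed

end

theorem theorem2p4:
  fixes \<alpha> \<gamma>\<^sub>1 \<gamma>\<^sub>2 C\<^sub>1 C\<^sub>2 :: real
    and \<Psi> :: "real \<Rightarrow> real"
    and k :: "'n::finite"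
  assumes alpha: "0 < \<alpha>" "\<alpha> < 2"
    and gamma: "\<gamma>\<^sub>1 \<le> \<gamma>\<^sub>2" "\<gamma>\<^sub>2 < min 1 \<alpha>"
    and Psi_borel: "\<Psi> \<in> borel_measurable (restrict_space borel {0..})"
    and Psi_pos: "\<And>t. t \<ge> 0 \<Longrightarrow> \<Psi> t > 0"
    and Psi_const: "\<And>t. 0 \<le> t \<Longrightarrow> t < 2 \<Longrightarrow> \<Psi> t = \<Psi> 2"
    and C_pos: "C\<^sub>1 > 0" "C\<^sub>2 > 0"
    and Psi_scaling: "\<And>r R. 2 \<le> r \<Longrightarrow> r < R \<Longrightarrow>
          C\<^sub>1 * (R / r) powr \<gamma>\<^sub>1 \<le> \<Psi> R / \<Psi> r \<and> \<Psi> R / \<Psi> r \<le> C\<^sub>2 * (R / r) powr \<gamma>\<^sub>2"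
  shows
    "(comparable_on (near_pairs k) (qker \<alpha> \<Psi> k)
        (\<lambda>x y. min (x $ k) (y $ k) powr (- real CARD('n) - \<alpha>))
      \<and> comparable_on (near_pairs k)
        (\<lambda>x y. min (x $ k) (y $ k) powr (- real CARD('n) - \<alpha>))
        (\<lambda>x y. max (x $ k) (y $ k) powr (- real CARD('n) - \<alpha>))
      \<and> comparable_on (near_pairs k)
        (\<lambda>x y. Bcal \<alpha> \<Psi> k x y - 1)
        (\<lambda>x y. (norm (x - y) / min (x $ k) (y $ k)) powr (real CARD('n) + \<alpha>)))
     \<and>
     (comparable_on (far_pairs k) (qker \<alpha> \<Psi> k) (Jker \<alpha> \<Psi> k)
      \<and> comparable_on (far_pairs k) (Jker \<alpha> \<Psi> k)
        (\<lambda>x y. norm (x - y) powr (- real CARD('n) - \<alpha>)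
                 * Psi1 \<Psi> ((norm (x - y))\<^sup>2 / (x $ k * y $ k)))
      \<and> (\<gamma>\<^sub>1 > 0 \<longrightarrow>
           comparable_on (far_pairs k) (qker \<alpha> \<Psi> k) (Jker \<alpha> \<Psi> k)
           \<and> comparable_on (far_pairs k) (Jker \<alpha> \<Psi> k)
             (\<lambda>x y. norm (x - y) powr (- real CARD('n) - \<alpha>)
                      * \<Psi> ((norm (x - y))\<^sup>2 / (x $ k * y $ k))))
      \<and> (\<gamma>\<^sub>2 < 0 \<longrightarrow>
           comparable_on (far_pairs k) (qker \<alpha> \<Psi> k) (Jker \<alpha> \<Psi> k)
           \<and> comparable_on (far_pairs k) (Jker \<alpha> \<Psi> k)
             (\<lambda>x y. norm (x - y) powr (- real CARD('n) - \<alpha>))))"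
proof -
  \<comment> \<open>The kernels evaluate \<open>\<Psi>\<close> at nonnegative arguments only, so a globally measurable and positive extension may replace it.\<close>
  define \<Phi> where "\<Phi> t = \<Psi> (max 0 t)" for t
  have eq: "\<Phi> t = \<Psi> t" if "t \<ge> 0" for t
    using that by (simp add: \<Phi>_def)
  have "(\<lambda>t. max 0 t) \<in> measurable borel (restrict_space borel {0::real..})"
    by (intro measurable_restrict_space2) auto
  from measurable_compose[OF this Psi_borel] have [measurable]: "\<Phi> \<in> borel_measurable borel"
    by (simp add: \<Phi>_def[abs_def])
  interpret R: resurrection \<Phi> \<gamma>\<^sub>1 \<gamma>\<^sub>2 C\<^sub>1 C\<^sub>2 \<alpha> "real CARD('n) + \<alpha>" k
  proof
    show "\<Phi> t > 0" for t by (simp add: \<Phi>_def Psi_pos)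
    show "\<Phi> t = \<Phi> 2" if "t < 2" for t
      using Psi_const[of "max 0 t"] that by (simp add: \<Phi>_def)
    show "C\<^sub>1 * (R / r) powr \<gamma>\<^sub>1 \<le> \<Phi> R / \<Phi> r \<and> \<Phi> R / \<Phi> r \<le> C\<^sub>2 * (R / r) powr \<gamma>\<^sub>2"
      if "2 \<le> r" "r < R" for r R
      using Psi_scaling[OF that] that by (simp add: eq)
  qed (use alpha gamma C_pos in auto)
  have expo: "- (real CARD('n) + \<alpha>) = - real CARD('n) - \<alpha>" by simp
  have pt: "ptilde \<alpha> \<Phi> k z y = ptilde \<alpha> \<Psi> k z y" if "y \<in> upper_half k" for z y
    using that by (simp add: ptilde_def eq upper_half_def)
  have rc: "ret_const \<alpha> \<Phi> k z = ret_const \<alpha> \<Psi> k z" for z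
    unfolding ret_const_def by (intro set_lebesgue_integral_cong) (auto simp: pt)
  have q: "qker \<alpha> \<Phi> k x y = qker \<alpha> \<Psi> k x y" if "y \<in> upper_half k" for x y
    unfolding qker_def return_kernel_def by (simp add: rc pt[OF that])
  have J: "Jker \<alpha> \<Phi> k x y = Jker \<alpha> \<Psi> k x y" "Bcal \<alpha> \<Phi> k x y = Bcal \<alpha> \<Psi> k x y"
    if "y \<in> upper_half k" for x y
    by (simp_all add: Jker_def Bcal_def q[OF that])
  have P1: "Psi1 \<Phi> u = Psi1 \<Psi> u" for u
  proof -
    have "(LINT v:{1..w}|lborel. \<Phi> v / v) = (LINT v:{1..w}|lborel. \<Psi> v / v)" for w :: real
      by (intro set_lebesgue_integral_cong) (auto simp: eq)
    then show ?thesis by (simp add: Psi1_def)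
  qed
  have near: "y \<in> upper_half k" if "(x, y) \<in> near_pairs k" for x y
    using that by (simp add: near_pairs_def)
  have far: "y \<in> upper_half k" "0 \<le> (norm (x - y))\<^sup>2 / (x $ k * y $ k)" if "(x, y) \<in> far_pairs k" for x y
    using that by (simp_all add: far_pairs_def upper_half_def)
  have n1: "comparable_on (near_pairs k) (qker \<alpha> \<Psi> k) (\<lambda>x y. min (x $ k) (y $ k) powr (- real CARD('n) - \<alpha>))"
    using R.near_comparable(1) unfolding expo
    by (rule comparable_on_cong[THEN iffD1, rotated]) (simp add: q near)
  have n3: "comparable_on (near_pairs k) (\<lambda>x y. Bcal \<alpha> \<Psi> k x y - 1)
        (\<lambda>x y. (norm (x - y) / min (x $ k) (y $ k)) powr (real CARD('n) + \<alpha>))"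
    using R.near_comparable(3)
    by (rule comparable_on_cong[THEN iffD1, rotated]) (simp add: J near)
  have f1: "comparable_on (far_pairs k) (qker \<alpha> \<Psi> k) (Jker \<alpha> \<Psi> k)"
    using R.far_comparable(1)
    by (rule comparable_on_cong[THEN iffD1, rotated]) (simp add: q J far)
  have f2: "comparable_on (far_pairs k) (Jker \<alpha> \<Psi> k) (\<lambda>x y. norm (x - y) powr (- real CARD('n) - \<alpha>)
                 * Psi1 \<Psi> ((norm (x - y))\<^sup>2 / (x $ k * y $ k)))"
    using R.far_comparable(2) unfolding expo
    by (rule comparable_on_cong[THEN iffD1, rotated]) (simp add: J P1 far)
  have f3: "comparable_on (far_pairs k) (Jker \<alpha> \<Psi> k) (\<lambda>x y. norm (x - y) powr (- real CARD('n) - \<alpha>)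
                 * \<Psi> ((norm (x - y))\<^sup>2 / (x $ k * y $ k)))" if "\<gamma>\<^sub>1 > 0"
    using R.far_comparable_positive_index[OF that] unfolding expo
    by (rule comparable_on_cong[THEN iffD1, rotated]) (use far in \<open>simp add: J eq\<close>)
  have f4: "comparable_on (far_pairs k) (Jker \<alpha> \<Psi> k) (\<lambda>x y. norm (x - y) powr (- real CARD('n) - \<alpha>))" if "\<gamma>\<^sub>2 < 0"
    using R.far_comparable_negative_index[OF that] unfolding expo
    by (rule comparable_on_cong[THEN iffD1, rotated]) (simp add: J far)
  show ?thesis
    using n1 R.near_comparable(2)[unfolded expo] n3 f1 f2 f3 f4 by blast
qed

end
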